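(* Let $\mathcal{X},\mathcal{Y}$ be closed convex sets and $f=\frac1n\sum_{i=1}^n f_i:\mathcal{X}\times\mathcal{Y}\to\mathbb{R}$, where each $f_i(\mathbf{x},\mathbf{y})$ is differentiable, convex in $\mathbf{x}$ and concave in $\mathbf{y}$, and $\{f_i\}_{i=1}^n$ is $L$-average smooth. Suppose $f$ is $(0,\mu_y)$-convex-concave with $\mu_y>0$, $\mathcal{X}$ is bounded with diameter $D_x$, and $\mathbf{x}_0\in\mathcal{X}$. Let $\kappa_y=L/\mu_y$ and $$f_{\varepsilon,\mathbf{x}_0}(\mathbf{x},\mathbf{y})=f(\mathbf{x},\mathbf{y})+\frac{\varepsilon}{4D_x^2}\|\mathbf{x}-\mathbf{x}_0\|_2^2.$$ Then for $0<\varepsilon\le 4LD_x^2$, the total number of SFO calls for AL-SVRE (defined in the context, with suitably chosen parameters) to find, in expectation, an $\varepsilon/2$-saddle point of $f_{\varepsilon,\mathbf{x}_0}$, which is also an $\varepsilon$-saddle point of $f$, is $$\tilde{\mathcal{O}}\left(\left(n+D_x\sqrt{\frac{nL\kappa_y}{\varepsilon}}+n^{3/4}\sqrt{\kappa_y}+n^{3/4}D_x\sqrt{\frac{L}{\varepsilon}}\right)\log\left(\frac1\varepsilon\right)\right).$$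
   Context: Average smoothness: differentiable functions $\{f_i\}_{i=1}^n$ are $L$-average smooth if $\frac1n\sum_{i=1}^n\|\nabla f_i(\mathbf{z})-\nabla f_i(\mathbf{z}')\|_2^2\le L^2\|\mathbf{z}-\mathbf{z}'\|_2^2$ for all $\mathbf{z},\mathbf{z}'$ in the domain. $f$ is $(\mu_x,\mu_y)$-convex-concave ($\mu_x,\mu_y\ge0$) if $f(\cdot,\mathbf{y})$ is $\mu_x$-strongly convex for every $\mathbf{y}$ and $f(\mathbf{x},\cdot)$ is $\mu_y$-strongly concave for every $\mathbf{x}$ (parameter $0$ meaning plain convexity/concavity). $(\hat{\mathbf{x}},\hat{\mathbf{y}})\in\mathcal{X}\times\mathcal{Y}$ is an $\varepsilon$-saddle point of $h$ if $\max_{\mathbf{y}\in\mathcal{Y}}h(\hat{\mathbf{x}},\mathbf{y})-\min_{\mathbf{x}\in\mathcal{X}}h(\mathbf{x},\hat{\mathbf{y}})\le\varepsilon$; for the output of a randomized algorithm, the inequality is required for the expectation of the left-hand side. An SFO call is one evaluation of the gradient $\nabla f_i$ of a single component at a point; the number of calls is understood in expectation. $\tilde{\mathcal{O}}$ hides logarithmic factors of $n$ and of the condition numbers of the problem being solved (here those of $f_{\varepsilon,\mathbf{x}_0}$, of order $LD_x^2/\varepsilon$ and $L/\mu_y$) and of the initial duality gap of $f_{\varepsilon,\mathbf{x}_0}$. AL-SVRE is applied to the components $f_{\varepsilon,\mathbf{x}_0,i}(\mathbf{x},\mathbf{y})=f_i(\mathbf{x},\mathbf{y})+\frac{\varepsilon}{4D_x^2}\|\mathbf{x}-\mathbf{x}_0\|_2^2$.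 By the paper's convention that the condition number in $\mathbf{x}$ is, without loss of generality, the larger one, the roles of the two variables may be exchanged (applying the algorithm to $-f$). $\mathcal{P}_{\mathcal{C}}$ denotes Euclidean projection onto $\mathcal{C}$. Algorithm L-SVRE$(\{h_i\}_{i=1}^n,(\mathbf{x}_0,\mathbf{y}_0),\tau,p,T)$, for $h=\frac1n\sum_i h_i$ on $\mathcal{Z}=\mathcal{X}\times\mathcal{Y}$: let $\mathbf{g}=(\nabla_{\mathbf{x}}h,-\nabla_{\mathbf{y}}h)$, $\mathbf{g}_i=(\nabla_{\mathbf{x}}h_i,-\nabla_{\mathbf{y}}h_i)$, $\alpha=1-p$, $\mathbf{z}_0=\mathbf{w}_0=(\mathbf{x}_0,\mathbf{y}_0)$. For $k=0,\dots,T-1$: $\bar{\mathbf{z}}_k=\alpha\mathbf{z}_k+(1-\alpha)\mathbf{w}_k$; $\mathbf{z}_{k+1/2}=\mathcal{P}_{\mathcal{Z}}(\bar{\mathbf{z}}_k-\tau\mathbf{g}(\mathbf{w}_k))$; draw $i\in\{1,\dots,n\}$ uniformly at random; $\mathbf{z}_{k+1}=\mathcal{P}_{\mathcal{Z}}(\bar{\mathbf{z}}_k-\tau[\mathbf{g}(\mathbf{w}_k)+\mathbf{g}_i(\mathbf{z}_{k+1/2})-\mathbf{g}_i(\mathbf{w}_k)])$; $\mathbf{w}_{k+1}=\mathbf{z}_{k+1}$ with probability $p$ and $\mathbf{w}_{k+1}=\mathbf{w}_k$ with probability $1-p$ (the full gradient at $\mathbf{w}_k$ is recomputed only when $\mathbf{w}_k$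 changes). Output $\mathbf{z}_T$. Algorithm AL-SVRE$(\{h_i\}_{i=1}^n,(\mathbf{x}_0,\mathbf{y}_0),\beta,q,K,p,\{\tau_k\},\{T_k\})$: set $\gamma=\frac{1-\sqrt q}{1+\sqrt q}$, $\mathbf{u}_0=\mathbf{x}_0$. For $k=1,\dots,K$, with $F_k(\mathbf{x},\mathbf{y})=h(\mathbf{x},\mathbf{y})+\frac{\beta}{2}\|\mathbf{x}-\mathbf{u}_{k-1}\|_2^2$: (1) $(\tilde{\mathbf{x}}_k,\tilde{\mathbf{y}}_k)=$ L-SVRE$\big(\{h_i+\frac{\beta}{2}\|\mathbf{x}-\mathbf{u}_{k-1}\|_2^2\}_{i=1}^n,(\mathbf{x}_{k-1},\mathbf{y}_{k-1}),\tau_k,p,T_k\big)$; (2) $\mathbf{x}_k=\mathcal{P}_{\mathcal{X}}(\tilde{\mathbf{x}}_k-\tau_k\nabla_{\mathbf{x}}F_k(\tilde{\mathbf{x}}_k,\tilde{\mathbf{y}}_k))$; (3) $\mathbf{y}_k=\mathcal{P}_{\mathcal{Y}}(\tilde{\mathbf{y}}_k+\tau_k\nabla_{\mathbf{y}}F_k(\tilde{\mathbf{x}}_k,\tilde{\mathbf{y}}_k))$; (4) $\mathbf{u}_k=\mathbf{x}_k+\gamma(\mathbf{x}_k-\mathbf{x}_{k-1})$. Output $(\mathbf{x}_K,\mathbf{y}_K)$. *)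

theory Defs
  imports "HOL-Probability.Probability" "HOL-Library.Poly_Mapping"
begin

section \<open>Euclidean spaces of variable dimension\<close>

text \<open>
  The constants hidden in a complexity bound must not depend on the dimensions, so these are
  quantified inside the statement and cannot be types.  All spaces \<open>\<real>\<^sup>d\<close> are therefore realised as
  subspaces of one inner product space, the finitely supported real sequences
  \<^typ>\<open>nat \<Rightarrow>\<^sub>0 real\<close>; topology, inner product and derivatives on them are the library's.
\<close>

instantiation poly_mapping :: (type, real_vector) real_vector
begin

definition scaleR_poly_mapping :: "real \<Rightarrow> ('a \<Rightarrow>\<^sub>0 'b) \<Rightarrow> 'a \<Rightarrow>\<^sub>0 'b"
  where "scaleR r v = Poly_Mapping.map (scaleR r) v"

lemma lookup_scaleR:
  "Poly_Mapping.lookup (r *\<^sub>R v) k = r *\<^sub>R Poly_Mapping.lookup v k" for v :: "'a \<Rightarrow>\<^sub>0 'b"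
  by (simp add: scaleR_poly_mapping_def Poly_Mapping.map.rep_eq when_def)

instance
proof
  fix v w :: "'a \<Rightarrow>\<^sub>0 'b" and r s :: real
  show "r *\<^sub>R (v + w) = r *\<^sub>R v + r *\<^sub>R w"
    by (rule poly_mapping_eqI) (simp add: lookup_scaleR lookup_add scaleR_add_right)
  show "(r + s) *\<^sub>R v = r *\<^sub>R v + s *\<^sub>R v"
    by (rule poly_mapping_eqI) (simp add: lookup_scaleR lookup_add scaleR_add_left)
  show "r *\<^sub>R s *\<^sub>R v = (r * s) *\<^sub>R v"
    by (rule poly_mapping_eqI) (simp add: lookup_scaleR)
  show "1 *\<^sub>R v = v"
    by (rule poly_mapping_eqI) (simp add: lookup_scaleR)
qed

end

instantiation poly_mapping :: (type, real_normed_vector) real_normed_vector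
begin

definition norm_poly_mapping :: "('a \<Rightarrow>\<^sub>0 'b) \<Rightarrow> real"
  where "norm v = L2_set (\<lambda>k. norm (Poly_Mapping.lookup v k)) (Poly_Mapping.keys v)"

definition dist_poly_mapping :: "('a \<Rightarrow>\<^sub>0 'b) \<Rightarrow> ('a \<Rightarrow>\<^sub>0 'b) \<Rightarrow> real"
  where "dist v w = norm (v - w)" for v w :: "'a \<Rightarrow>\<^sub>0 'b"

definition sgn_poly_mapping :: "('a \<Rightarrow>\<^sub>0 'b) \<Rightarrow> 'a \<Rightarrow>\<^sub>0 'b"
  where "sgn v = v /\<^sub>R norm v" for v :: "'a \<Rightarrow>\<^sub>0 'b"

definition uniformity_poly_mapping :: "(('a \<Rightarrow>\<^sub>0 'b) \<times> ('a \<Rightarrow>\<^sub>0 'b)) filter"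
  where "uniformity_poly_mapping =
    (INF e\<in>{0<..}. principal {(v::'a \<Rightarrow>\<^sub>0 'b, w). dist v w < e})"

definition open_poly_mapping :: "('a \<Rightarrow>\<^sub>0 'b) set \<Rightarrow> bool"
  where "open_poly_mapping U \<longleftrightarrow>
    (\<forall>v\<in>U. eventually (\<lambda>(v', w). v' = v \<longrightarrow> w \<in> U) uniformity)"

lemma norm_poly_mapping_superset:
  fixes v :: "'a \<Rightarrow>\<^sub>0 'b"
  assumes "finite S" "Poly_Mapping.keys v \<subseteq> S"
  shows "norm v = L2_set (\<lambda>k. norm (Poly_Mapping.lookup v k)) S"
proof -
  have "(\<Sum>k\<in>Poly_Mapping.keys v. (norm (Poly_Mapping.lookup v k))\<^sup>2)
      = (\<Sum>k\<in>S. (norm (Poly_Mapping.lookup v k))\<^sup>2)"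
    by (rule sum.mono_neutral_left) (use assms in \<open>auto simp: in_keys_iff\<close>)
  then show ?thesis
    by (simp add: norm_poly_mapping_def L2_set_def)
qed

instance
proof
  fix v w :: "'a \<Rightarrow>\<^sub>0 'b" and r :: real
  let ?S = "Poly_Mapping.keys v \<union> Poly_Mapping.keys w"
  have fin: "finite ?S" by simp
  show "norm v = 0 \<longleftrightarrow> v = 0"
    by (auto simp: norm_poly_mapping_def L2_set_eq_0_iff in_keys_iff intro!: poly_mapping_eqI)
  have "norm (v + w)
      = L2_set (\<lambda>k. norm (Poly_Mapping.lookup v k + Poly_Mapping.lookup w k)) ?S"
    using norm_poly_mapping_superset[OF fin Poly_Mapping.keys_add] by (simp add: lookup_add)
  also have "\<dots> \<le> L2_set (\<lambda>k. norm (Poly_Mapping.lookup v k) + norm (Poly_Mapping.lookup w k)) ?S"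
    by (rule L2_set_mono) (auto intro: norm_triangle_ineq)
  also have "\<dots> \<le> L2_set (\<lambda>k. norm (Poly_Mapping.lookup v k)) ?S
      + L2_set (\<lambda>k. norm (Poly_Mapping.lookup w k)) ?S"
    by (rule L2_set_triangle_ineq)
  also have "\<dots> = norm v + norm w"
    using norm_poly_mapping_superset[OF fin, of v] norm_poly_mapping_superset[OF fin, of w] by simp
  finally show "norm (v + w) \<le> norm v + norm w" .
  have "Poly_Mapping.keys (r *\<^sub>R v) \<subseteq> Poly_Mapping.keys v"
    by (auto simp: in_keys_iff lookup_scaleR)
  from norm_poly_mapping_superset[OF finite_keys this]
  show "norm (r *\<^sub>R v) = \<bar>r\<bar> * norm v"
    by (simp add: norm_poly_mapping_def lookup_scaleR L2_set_right_distrib)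
qed (simp_all add: dist_poly_mapping_def sgn_poly_mapping_def
      uniformity_poly_mapping_def open_poly_mapping_def)

end

instantiation poly_mapping :: (type, real_inner) real_inner
begin

definition inner_poly_mapping :: "('a \<Rightarrow>\<^sub>0 'b) \<Rightarrow> ('a \<Rightarrow>\<^sub>0 'b) \<Rightarrow> real"
  where "inner v w =
    (\<Sum>k\<in>Poly_Mapping.keys v. Poly_Mapping.lookup v k \<bullet> Poly_Mapping.lookup w k)"

lemma inner_poly_mapping_superset:
  fixes v w :: "'a \<Rightarrow>\<^sub>0 'b"
  assumes "finite S" "Poly_Mapping.keys v \<subseteq> S"
  shows "v \<bullet> w = (\<Sum>k\<in>S. Poly_Mapping.lookup v k \<bullet> Poly_Mapping.lookup w k)"
  unfolding inner_poly_mapping_def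
  by (rule sum.mono_neutral_left) (use assms in \<open>auto simp: in_keys_iff\<close>)

instance
proof
  fix u v w :: "'a \<Rightarrow>\<^sub>0 'b" and r :: real
  let ?S = "Poly_Mapping.keys u \<union> Poly_Mapping.keys v \<union> Poly_Mapping.keys w"
  have fin: "finite ?S" by simp
  have *: "a \<bullet> b = (\<Sum>k\<in>?S. Poly_Mapping.lookup a k \<bullet> Poly_Mapping.lookup b k)"
    if "Poly_Mapping.keys a \<subseteq> ?S" for a b :: "'a \<Rightarrow>\<^sub>0 'b"
    using inner_poly_mapping_superset[OF fin that] .
  show "v \<bullet> w = w \<bullet> v"
    by (subst (1 2) *) (auto simp: inner_commute)
  have "Poly_Mapping.keys (u + v) \<subseteq> ?S"
    using Poly_Mapping.keys_add by fastforce
  then show "(u + v) \<bullet> w = u \<bullet> w + v \<bullet> w"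
    by (subst (1 2 3) *) (auto simp: lookup_add inner_add_left sum.distrib)
  have "Poly_Mapping.keys (r *\<^sub>R v) \<subseteq> ?S"
    by (auto simp: in_keys_iff lookup_scaleR)
  then show "r *\<^sub>R v \<bullet> w = r * (v \<bullet> w)"
    by (subst (1 2) *) (auto simp: lookup_scaleR sum_distrib_left)
  show "0 \<le> v \<bullet> v"
    by (simp add: inner_poly_mapping_def sum_nonneg)
  show "v \<bullet> v = 0 \<longleftrightarrow> v = 0"
    by (auto simp: inner_poly_mapping_def sum_nonneg_eq_0_iff in_keys_iff intro!: poly_mapping_eqI)
  show "norm v = sqrt (v \<bullet> v)"
    by (simp add: norm_poly_mapping_def inner_poly_mapping_def L2_set_def power2_norm_eq_inner)
qed

end

type_synonym rvec = "nat \<Rightarrow>\<^sub>0 real"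

definition eucl :: "nat \<Rightarrow> rvec set"
  where "eucl d = {v. Poly_Mapping.keys v \<subseteq> {..<d}}"

lemma inner_eucl: "v \<in> eucl d \<Longrightarrow>
    v \<bullet> w = (\<Sum>k<d. Poly_Mapping.lookup v k * Poly_Mapping.lookup w k)"
  by (simp add: eucl_def inner_poly_mapping_superset[of "{..<d}"])

section \<open>Finite-sum minimax problems\<close>

definition strongly_convex_on :: "real \<Rightarrow> 'a::real_normed_vector set \<Rightarrow> ('a \<Rightarrow> real) \<Rightarrow> bool"
  where "strongly_convex_on \<mu> S \<phi> \<longleftrightarrow> convex S \<and>
    (\<forall>x\<in>S. \<forall>y\<in>S. \<forall>t\<in>{0..1}. \<phi> ((1 - t) *\<^sub>R x + t *\<^sub>R y)
        \<le> (1 - t) * \<phi> x + t * \<phi> y - \<mu> / 2 * (t * (1 - t)) * (norm (x - y))\<^sup>2)"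

lemma strongly_convex_on_0: "strongly_convex_on 0 S \<phi> \<longleftrightarrow> convex_on S \<phi>"
proof
  assume "strongly_convex_on 0 S \<phi>"
  then show "convex_on S \<phi>"
    by (auto simp: strongly_convex_on_def intro!: convex_onI)
next
  assume "convex_on S \<phi>"
  then show "strongly_convex_on 0 S \<phi>"
    by (auto simp: strongly_convex_on_def convex_on_imp_convex intro!: convex_onD)
qed

definition convex_concave ::
    "real \<Rightarrow> real \<Rightarrow> 'a::real_normed_vector set \<Rightarrow> 'b::real_normed_vector set \<Rightarrow> ('a \<times> 'b \<Rightarrow> real) \<Rightarrow> bool"
  where "convex_concave \<mu>x \<mu>y X Y h \<longleftrightarrow>
    (\<forall>y\<in>Y. strongly_convex_on \<mu>x X (\<lambda>x. h (x, y))) \<and>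
    (\<forall>x\<in>X. strongly_convex_on \<mu>y Y (\<lambda>y. - h (x, y)))"

text \<open>
  The functions live on the domain \<open>S\<close> only, hence derivatives are taken within \<open>S\<close>.  They need
  not be unique if \<open>S\<close> has empty interior, so the gradient is a datum \<open>g\<close>.
\<close>

definition gradient_on :: "'a::real_inner set \<Rightarrow> ('a \<Rightarrow> real) \<Rightarrow> ('a \<Rightarrow> 'a) \<Rightarrow> bool"
  where "gradient_on S \<phi> g \<longleftrightarrow> (\<forall>z\<in>S. (\<phi> has_derivative (\<lambda>h. g z \<bullet> h)) (at z within S))"

definition average_smooth :: "nat \<Rightarrow> real \<Rightarrow> 'a::real_inner set \<Rightarrow> (nat \<Rightarrow> 'a \<Rightarrow> 'a) \<Rightarrow> bool"
  where "average_smooth n L S g \<longleftrightarrow>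
    (\<forall>z\<in>S. \<forall>z'\<in>S. (\<Sum>i<n. (norm (g i z - g i z'))\<^sup>2) / real n \<le> L\<^sup>2 * (norm (z - z'))\<^sup>2)"

definition average :: "nat \<Rightarrow> (nat \<Rightarrow> 'a \<Rightarrow> 'b::real_vector) \<Rightarrow> 'a \<Rightarrow> 'b"
  where "average n F z = (1 / real n) *\<^sub>R (\<Sum>i<n. F i z)"

text \<open>
  The extrema below are attained in the cases of interest: \<open>h(x,\<cdot>)\<close> continuous and strongly
  concave on a closed subset of some \<open>\<real>\<^sup>d\<close>, and \<open>h(\<cdot>,y)\<close> continuous on a compact set.
\<close>

definition duality_gap :: "'a set \<Rightarrow> 'b set \<Rightarrow> ('a \<times> 'b \<Rightarrow> real) \<Rightarrow> 'a \<times> 'b \<Rightarrow> real"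
  where "duality_gap X Y h z = (SUP y\<in>Y. h (fst z, y)) - (INF x\<in>X. h (x, snd z))"

definition saddle_in_expectation ::
    "'a set \<Rightarrow> 'b set \<Rightarrow> ('a \<times> 'b \<Rightarrow> real) \<Rightarrow> real \<Rightarrow> ('a \<times> 'b) pmf \<Rightarrow> bool"
  where "saddle_in_expectation X Y h \<epsilon> M \<longleftrightarrow>
    set_pmf M \<subseteq> X \<times> Y \<and> measure_pmf.expectation M (duality_gap X Y h) \<le> \<epsilon>"

definition add_prox :: "real \<Rightarrow> 'a::real_inner \<Rightarrow> ('a \<times> 'b \<Rightarrow> real) \<Rightarrow> 'a \<times> 'b \<Rightarrow> real"
  where "add_prox c u h z = h z + c * (norm (fst z - u))\<^sup>2"

definition add_prox_grad ::
    "real \<Rightarrow> 'a::real_inner \<Rightarrow> ('a \<times> 'b \<Rightarrow> 'a \<times> 'b) \<Rightarrow> 'a \<times> 'b::real_inner \<Rightarrow> 'a \<times> 'b"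
  where "add_prox_grad c u G z = G z + ((2 * c) *\<^sub>R (fst z - u), 0)"

lemma gradient_on_add_prox:
  assumes "gradient_on S h G"
  shows "gradient_on S (add_prox c u h) (add_prox_grad c u G)"
  unfolding gradient_on_def
proof
  fix z assume z: "z \<in> S"
  have h: "(h has_derivative (\<lambda>d. G z \<bullet> d)) (at z within S)"
    using assms z by (simp add: gradient_on_def)
  have "((\<lambda>z. h z + c * ((fst z - u) \<bullet> (fst z - u))) has_derivative
      (\<lambda>d. G z \<bullet> d + c * ((fst z - u) \<bullet> fst d + fst d \<bullet> (fst z - u)))) (at z within S)"
    by (auto intro!: derivative_eq_intros h)
  then show "(add_prox c u h has_derivative (\<lambda>d. add_prox_grad c u G z \<bullet> d)) (at z within S)"
    by (simp add: add_prox_def[abs_def] add_prox_grad_def power2_norm_eq_inner inner_add_left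
        inner_prod_def inner_commute algebra_simps)
qed

lemma average_add_prox:
  "n \<ge> 1 \<Longrightarrow> average n (\<lambda>i. add_prox c u (h i)) = add_prox c u (average n h)"
  by (simp add: fun_eq_iff average_def add_prox_def sum.distrib add_divide_distrib)

section \<open>The algorithms\<close>

text \<open>The library's \<^const>\<open>closest_point\<close>, whose type excludes \<^typ>\<open>rvec\<close>.\<close>

definition projection :: "'a::metric_space set \<Rightarrow> 'a \<Rightarrow> 'a"
  where "projection S a = (SOME x. x \<in> S \<and> (\<forall>y\<in>S. dist a x \<le> dist a y))"

text \<open>
  The algorithms access \<open>n\<close> components, indexed by \<open>{..<n}\<close>, through a family \<open>G\<close> of gradients
  with \<open>G i z = (\<nabla>\<^sub>x h\<^sub>i(z), \<nabla>\<^sub>y h\<^sub>i(z))\<close>.  Their states carry the number of evaluations of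
  single components made so far; gradients of proximal terms cost nothing.
\<close>

definition saddle_operator :: "('a \<times> 'b \<Rightarrow> 'a \<times> 'b) \<Rightarrow> 'a \<times> 'b \<Rightarrow> 'a \<times> 'b::real_vector"
  where "saddle_operator G z = (fst (G z), - snd (G z))"

text \<open>
  State \<open>(z, w, new, c)\<close>: \<open>new\<close> says that the full gradient at \<open>w\<close> is not yet known, in which case
  the next iteration pays \<open>n\<close> evaluations for it.  The other two evaluations are \<open>g\<^sub>i(zh)\<close> and
  \<open>g\<^sub>i(w)\<close>.
\<close>

definition lsvre_step ::
    "nat \<Rightarrow> ('a::real_inner \<times> 'b::real_inner) set \<Rightarrow> (nat \<Rightarrow> 'a \<times> 'b \<Rightarrow> 'a \<times> 'b) \<Rightarrow> real \<Rightarrow> real \<Rightarrow>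
     ('a \<times> 'b) \<times> ('a \<times> 'b) \<times> bool \<times> nat \<Rightarrow> (('a \<times> 'b) \<times> ('a \<times> 'b) \<times> bool \<times> nat) pmf"
  where "lsvre_step n Z G \<tau> p = (\<lambda>(z, w, new, c).
    let g = (\<lambda>i. saddle_operator (G i));
        gw = average n g w;
        zbar = (1 - p) *\<^sub>R z + p *\<^sub>R w;
        zh = projection Z (zbar - \<tau> *\<^sub>R gw);
        c' = c + (if new then n else 0) + 2
    in do {
      i \<leftarrow> pmf_of_set {..<n};
      b \<leftarrow> bernoulli_pmf p;
      let z' = projection Z (zbar - \<tau> *\<^sub>R (gw + g i zh - g i w));
      return_pmf (if b then (z', z', True, c') else (z', w, False, c'))
    })"

primrec lsvre_iter ::
    "nat \<Rightarrow> ('a::real_inner \<times> 'b::real_inner) set \<Rightarrow> (nat \<Rightarrow> 'a \<times> 'b \<Rightarrow> 'a \<times> 'b) \<Rightarrow> 'a \<times> 'b \<Rightarrow>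
     real \<Rightarrow> real \<Rightarrow> nat \<Rightarrow> (('a \<times> 'b) \<times> ('a \<times> 'b) \<times> bool \<times> nat) pmf"
  where
    "lsvre_iter n Z G z0 \<tau> p 0 = return_pmf (z0, z0, True, 0)"
  | "lsvre_iter n Z G z0 \<tau> p (Suc k) = bind_pmf (lsvre_iter n Z G z0 \<tau> p k) (lsvre_step n Z G \<tau> p)"

definition lsvre ::
    "nat \<Rightarrow> ('a::real_inner \<times> 'b::real_inner) set \<Rightarrow> (nat \<Rightarrow> 'a \<times> 'b \<Rightarrow> 'a \<times> 'b) \<Rightarrow> 'a \<times> 'b \<Rightarrow>
     real \<Rightarrow> real \<Rightarrow> nat \<Rightarrow> (('a \<times> 'b) \<times> nat) pmf"
  where "lsvre n Z G z0 \<tau> p T = map_pmf (\<lambda>(z, w, new, c). (z, c)) (lsvre_iter n Z G z0 \<tau> p T)"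

text \<open>
  \<open>exchange\<close> tells whether the roles of the two variables are exchanged; only the indices
  \<open>1, \<dots>, iters\<close> of \<open>step_size\<close> and \<open>inner_iters\<close> matter.
\<close>

record al_params =
  exchange :: bool
  prox_weight :: real    \<comment> \<open>\<open>\<beta>\<close>\<close>
  momentum :: real       \<comment> \<open>\<open>q\<close>\<close>
  iters :: nat           \<comment> \<open>\<open>K\<close>\<close>
  refresh_prob :: real   \<comment> \<open>\<open>p\<close>\<close>
  step_size :: "nat \<Rightarrow> real"    \<comment> \<open>\<open>\<tau>\<^sub>k\<close>\<close>
  inner_iters :: "nat \<Rightarrow> nat"   \<comment> \<open>\<open>T\<^sub>k\<close>\<close>

definition admissible :: "al_params \<Rightarrow> bool"
  where "admissible P \<longleftrightarrow> 0 \<le> prox_weight P \<and> 0 < momentum P \<and> momentum P \<le> 1 \<and>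
    0 < refresh_prob P \<and> refresh_prob P \<le> 1 \<and> (\<forall>k. 0 < step_size P k)"

text \<open>
  State \<open>(x\<^sub>k, y\<^sub>k, u\<^sub>k, c)\<close>.  One evaluation of the full gradient, \<open>n\<close> calls, serves both final
  projected steps.
\<close>

primrec al_svre_iter ::
    "al_params \<Rightarrow> nat \<Rightarrow> 'a::real_inner set \<Rightarrow> 'b::real_inner set \<Rightarrow> (nat \<Rightarrow> 'a \<times> 'b \<Rightarrow> 'a \<times> 'b) \<Rightarrow>
     'a \<Rightarrow> 'b \<Rightarrow> nat \<Rightarrow> ('a \<times> 'b \<times> 'a \<times> nat) pmf"
  where
    "al_svre_iter P n X Y G x0 y0 0 = return_pmf (x0, y0, x0, 0)"
  | "al_svre_iter P n X Y G x0 y0 (Suc k) =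
      do {
        (x, y, u, c) \<leftarrow> al_svre_iter P n X Y G x0 y0 k;
        let F = (\<lambda>i. add_prox_grad (prox_weight P / 2) u (G i));
        let \<tau> = step_size P (Suc k);
        let \<gamma> = (1 - sqrt (momentum P)) / (1 + sqrt (momentum P));
        (zt, c') \<leftarrow> lsvre n (X \<times> Y) F (x, y) \<tau> (refresh_prob P) (inner_iters P (Suc k));
        let x' = projection X (fst zt - \<tau> *\<^sub>R fst (average n F zt));
        let y' = projection Y (snd zt + \<tau> *\<^sub>R snd (average n F zt));
        return_pmf (x', y', x' + \<gamma> *\<^sub>R (x' - x), c + c' + n)
      }"

definition al_svre_direct ::
    "al_params \<Rightarrow> nat \<Rightarrow> 'a::real_inner set \<Rightarrow> 'b::real_inner set \<Rightarrow> (nat \<Rightarrow> 'a \<times> 'b \<Rightarrow> 'a \<times> 'b) \<Rightarrow>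
     'a \<Rightarrow> 'b \<Rightarrow> (('a \<times> 'b) \<times> nat) pmf"
  where "al_svre_direct P n X Y G x0 y0 =
    map_pmf (\<lambda>(x, y, u, c). ((x, y), c)) (al_svre_iter P n X Y G x0 y0 (iters P))"

definition exchange_grad :: "('a::real_vector \<times> 'b::real_vector \<Rightarrow> 'a \<times> 'b) \<Rightarrow> 'b \<times> 'a \<Rightarrow> 'b \<times> 'a"
  where "exchange_grad G z = - prod.swap (G (prod.swap z))"

lemma gradient_on_exchange:
  fixes X :: "'a::real_inner set" and Y :: "'b::real_inner set"
  assumes "gradient_on (X \<times> Y) h G"
  shows "gradient_on (Y \<times> X) (\<lambda>z. - h (prod.swap z)) (exchange_grad G)"
  unfolding gradient_on_def
proof
  fix z :: "'b \<times> 'a" assume z: "z \<in> Y \<times> X"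
  have swap: "(prod.swap has_derivative prod.swap) (at z within Y \<times> X)"
    unfolding prod.swap_def by (auto intro!: derivative_eq_intros)
  have "(h has_derivative (\<lambda>d. G (prod.swap z) \<bullet> d)) (at (prod.swap z) within prod.swap ` (Y \<times> X))"
    using assms z by (auto simp: gradient_on_def product_swap)
  from has_derivative_minus[OF has_derivative_in_compose[OF swap this]]
  show "((\<lambda>z. - h (prod.swap z)) has_derivative (\<lambda>d. exchange_grad G z \<bullet> d)) (at z within Y \<times> X)"
    by (simp add: exchange_grad_def inner_prod_def algebra_simps)
qed

definition al_svre ::
    "al_params \<Rightarrow> nat \<Rightarrow> 'a::real_inner set \<Rightarrow> 'b::real_inner set \<Rightarrow> (nat \<Rightarrow> 'a \<times> 'b \<Rightarrow> 'a \<times> 'b) \<Rightarrow>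
     'a \<Rightarrow> 'b \<Rightarrow> (('a \<times> 'b) \<times> nat) pmf"
  where "al_svre P n X Y G x0 y0 =
    (if exchange P
     then map_pmf (\<lambda>(z, c). (prod.swap z, c)) (al_svre_direct P n Y X (\<lambda>i. exchange_grad (G i)) y0 x0)
     else al_svre_direct P n X Y G x0 y0)"

end

theory Submission
  imports Defs
begin

hide_const (open) Tree.complete

text \<open>
  With \<open>\<mu>\<^sub>x = \<epsilon> / (2 D\<^sub>x\<^sup>2)\<close> the regularised function is \<open>(\<mu>\<^sub>x, \<mu>\<^sub>y)\<close>-convex-concave, and the
  variable with the smaller modulus is accelerated; call that one \<open>x\<close>.  L-SVRE contracts the
  expected squared distance to the saddle point of a proximal subproblem, and one projected step
  turns distance into duality gap.  For the primal function \<open>max\<^sub>y h(x, y)\<close> the outer loop is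
  Nesterov's method with inexact proximal steps, so its Lyapunov function loses a factor
  \<open>1 - \<alpha> / 2\<close> up to the gap of the subproblem, where \<open>\<alpha>\<^sup>2 = \<mu>\<^sub>x / (\<mu>\<^sub>x + \<beta>)\<close>.  The warm start of the
  subproblem is controlled by the same Lyapunov function plus a small multiple of the squared
  distance of \<open>y\<close> to the solution; hence a fixed number of inner iterations, logarithmic in the
  condition numbers, suffices in every round.  The choice \<open>\<beta> = min \<mu>\<^sub>y (L / \<surd>n)\<close> balances inner and
  outer iterations.
\<close>

section \<open>Projections and variational inequalities in inner product spaces\<close>

text \<open>The ambient space of finitely supported sequences is not complete and \<open>Y\<close>
  may be unbounded, so compactness is not at hand. Completeness of the sets takes its place: the
  parallelogram law gives projections, and saddle points, of the regularised function and of each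
  proximal subproblem, are Banach fixed points of a projected operator step. Two considerations fix
  \<beta>. A subproblem has the moduli \<open>mx + \<beta>\<close> and \<open>my\<close>; raising
  \<beta> beyond \<open>my\<close> costs outer rounds without improving its conditioning. And a run
  of L-SVRE takes about \<open>sqrt n * L / \<beta>\<close> cheap iterations besides a fixed cost of
  order \<open>n\<close>, which dominates from \<open>\<beta> = L / sqrt n\<close> on. The Lyapunov
  function sees only the primal gap, so the duality gap is extracted in one further round, from the
  residual of its projected step. A one-point \<open>Y\<close> satisfies the hypothesis with every
  \<open>\<mu>\<^sub>y\<close>; the analysis therefore runs with \<open>min \<mu>\<^sub>y L\<close>,
  and the resulting \<open>max \<kappa> 1\<close> is absorbed by the other terms of the bound. The
  square of the logarithm comes from the two nested loops.\<close>

lemma projection_exists: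
  fixes S :: "'a::real_inner set"
  assumes "complete S" "convex S" "S \<noteq> {}"
  shows "\<exists>x\<in>S. \<forall>y\<in>S. dist a x \<le> dist a y"
proof -
  define D where "D = (INF x\<in>S. (norm (a - x))\<^sup>2)"
  have bdd: "bdd_below ((\<lambda>x. (norm (a - x))\<^sup>2) ` S)"
    by (rule bdd_belowI[of _ 0]) auto
  have lower: "D \<le> (norm (a - x))\<^sup>2" if "x \<in> S" for x
    unfolding D_def using bdd that by (rule cINF_lower)
  have "\<exists>x\<in>S. (norm (a - x))\<^sup>2 < D + 1 / real (Suc k)" for k
    using cINF_less_iff[OF \<open>S \<noteq> {}\<close> bdd, of "D + 1 / real (Suc k)"] by (simp add: D_def)
  then obtain s where s: "s k \<in> S" "(norm (a - s k))\<^sup>2 < D + 1 / real (Suc k)" for k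
    by metis
  \<comment> \<open>Parallelogram law: the midpoint of two almost minimisers lies in
    \<open>S\<close>, hence at squared distance at least \<open>D\<close> from \<open>a\<close>,
    which forces the two together.\<close>
  have close: "(norm (s j - s k))\<^sup>2 \<le> 2 / real (Suc j) + 2 / real (Suc k)" for j k
  proof -
    have "(1/2) *\<^sub>R s j + (1/2) *\<^sub>R s k \<in> S"
      using s(1) assms(2) by (intro convexD) auto
    then have "D \<le> (norm (a - ((1/2) *\<^sub>R s j + (1/2) *\<^sub>R s k)))\<^sup>2"
      by (rule lower)
    moreover have "(norm (s j - s k))\<^sup>2 = 2 * (norm (a - s j))\<^sup>2 + 2 * (norm (a - s k))\<^sup>2
        - 4 * (norm (a - ((1/2) *\<^sub>R s j + (1/2) *\<^sub>R s k)))\<^sup>2"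
      by (simp add: power2_norm_eq_inner inner_diff inner_add inner_commute algebra_simps)
    ultimately show ?thesis using s(2)[of j] s(2)[of k] by simp
  qed
  have "Cauchy s"
  proof (rule metric_CauchyI)
    fix e :: real assume "0 < e"
    then obtain N where N: "4 / e\<^sup>2 < real N" using reals_Archimedean2 by blast
    have "dist (s j) (s k) < e" if "N \<le> j" "N \<le> k" for j k
    proof -
      have "4 / real (Suc N) < e\<^sup>2"
        using N \<open>0 < e\<close> by (simp add: field_simps) (smt (verit) zero_less_power)
      moreover have "2 / real (Suc j) \<le> 2 / real (Suc N)" "2 / real (Suc k) \<le> 2 / real (Suc N)"
        using that by (auto intro!: divide_left_mono)
      ultimately have "(norm (s j - s k))\<^sup>2 < e\<^sup>2" using close[of j k] by simp
      then show ?thesis using \<open>0 < e\<close> by (simp add: dist_norm power_less_imp_less_base)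
    qed
    then show "\<exists>M. \<forall>m\<ge>M. \<forall>n\<ge>M. dist (s m) (s n) < e" by blast
  qed
  then obtain x where x: "x \<in> S" "s \<longlonglongrightarrow> x"
    using assms(1) s(1) by (meson complete_def)
  have "(\<lambda>k. (norm (a - s k))\<^sup>2) \<longlonglongrightarrow> (norm (a - x))\<^sup>2"
    by (intro tendsto_intros x)
  moreover have "(\<lambda>k. D + 1 / real (Suc k)) \<longlonglongrightarrow> D + 0"
    by (intro tendsto_intros LIMSEQ_Suc[OF lim_1_over_n])
  ultimately have "(norm (a - x))\<^sup>2 \<le> D"
    using LIMSEQ_le[of "\<lambda>k. (norm (a - s k))\<^sup>2" _ "\<lambda>k. D + 1 / real (Suc k)" "D + 0"]
      less_imp_le[OF s(2)] by simp
  then have "dist a x \<le> dist a y" if "y \<in> S" for y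
    using lower[OF that] unfolding dist_norm
    by (meson norm_ge_zero order_trans power2_le_imp_le)
  with x(1) show ?thesis by blast
qed

context
  fixes S :: "'a::real_inner set"
  assumes S: "complete S" "convex S" "S \<noteq> {}"
begin

lemma projection_least: "projection S a \<in> S \<and> (\<forall>y\<in>S. dist a (projection S a) \<le> dist a y)"
  unfolding projection_def by (rule someI_ex) (use projection_exists[OF S] in blast)

lemma projection_in: "projection S a \<in> S"
  using projection_least by blast

lemma projection_obtuse:
  assumes "w \<in> S"
  shows "0 \<le> (projection S a - a) \<bullet> (w - projection S a)"
  using any_closest_point_dot[OF S(2) complete_imp_closed[OF S(1)] projection_in assms, of a a]
    projection_least[of a]
  by (simp add: inner_diff)

text \<open>Two points with the obtuse angle property, tested against each other, have nonpositive
  squared distance. Solutions of variational inequalities are recognised in this way as fixed points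
  of projected steps.\<close>

lemma projection_unique:
  assumes "p \<in> S" "\<And>w. w \<in> S \<Longrightarrow> 0 \<le> (p - a) \<bullet> (w - p)"
  shows "projection S a = p"
proof -
  have "0 \<le> (projection S a - a) \<bullet> (p - projection S a)" "0 \<le> (p - a) \<bullet> (projection S a - p)"
    using projection_obtuse[OF assms(1)] assms(2)[OF projection_in] by auto
  then have "(projection S a - p) \<bullet> (projection S a - p) \<le> 0"
    by (simp add: inner_diff inner_commute)
  then show ?thesis by (simp add: dot_square_norm)
qed

lemma projection_nonexpansive: "norm (projection S a - projection S b) \<le> norm (a - b)"
proof -
  have "0 \<le> (projection S a - a) \<bullet> (projection S b - projection S a)"
    "0 \<le> (projection S b - b) \<bullet> (projection S a - projection S b)"
    by (simp_all add: projection_obtuse projection_in)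
  then have "(projection S a - projection S b) \<bullet> (projection S a - projection S b)
      \<le> (a - b) \<bullet> (projection S a - projection S b)"
    by (simp add: inner_diff inner_commute)
  also have "\<dots> \<le> norm (a - b) * norm (projection S a - projection S b)"
    by (rule norm_cauchy_schwarz)
  finally have "norm (projection S a - projection S b) * norm (projection S a - projection S b)
      \<le> norm (a - b) * norm (projection S a - projection S b)"
    by (simp add: dot_square_norm power2_eq_square)
  then show ?thesis
    by (cases "norm (projection S a - projection S b) = 0") auto
qed

text \<open>For a small step size the projected step is a contraction, and its fixed point solves
  the inequality. This replaces a minimax theorem based on compactness.\<close>

lemma variational_inequality_solvable:
  assumes mono: "\<And>z w. z \<in> S \<Longrightarrow> w \<in> S \<Longrightarrow> m * (norm (z - w))\<^sup>2 \<le> (A z - A w) \<bullet> (z - w)"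
    and lip: "\<And>z w. z \<in> S \<Longrightarrow> w \<in> S \<Longrightarrow> norm (A z - A w) \<le> \<Lambda> * norm (z - w)"
    and "0 < m"
  shows "\<exists>z\<in>S. \<forall>w\<in>S. 0 \<le> A z \<bullet> (w - z)"
proof -
  \<comment> \<open>The squared Lipschitz constant is at most 1 - 2 \<tau> m + \<tau>^2 \<Lambda>^2.
    This \<tau> satisfies both \<tau> \<Lambda>^2 \<le> m, which leaves 1 - \<tau> m, and \<tau> m
    \<le> 1, without comparing m and \<Lambda>.\<close>
  define \<tau> where "\<tau> = m / (m\<^sup>2 + \<Lambda>\<^sup>2)"
  define c where "c = sqrt (1 - \<tau> * m)"
  have pos: "0 < m\<^sup>2 + \<Lambda>\<^sup>2" using \<open>0 < m\<close> by (simp add: add_pos_nonneg)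
  have \<tau>: "0 < \<tau>" using \<open>0 < m\<close> pos by (simp add: \<tau>_def)
  have "\<tau> * m \<le> 1" "\<tau> * \<Lambda>\<^sup>2 \<le> m"
    using pos \<open>0 < m\<close> by (simp_all add: \<tau>_def divide_simps power2_eq_square algebra_simps)
  then have c: "0 \<le> c" "c < 1" "c\<^sup>2 = 1 - \<tau> * m" using \<tau> \<open>0 < m\<close> by (auto simp: c_def)
  let ?P = "\<lambda>z. projection S (z - \<tau> *\<^sub>R A z)"
  have "dist (?P z) (?P w) \<le> c * dist z w" if "z \<in> S" "w \<in> S" for z w
  proof -
    have "(norm ((z - \<tau> *\<^sub>R A z) - (w - \<tau> *\<^sub>R A w)))\<^sup>2
        = (norm (z - w))\<^sup>2 - 2 * \<tau> * ((A z - A w) \<bullet> (z - w)) + \<tau>\<^sup>2 * (norm (A z - A w))\<^sup>2"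
      by (simp only: power2_norm_eq_inner)
        (simp add: inner_diff inner_commute algebra_simps power2_eq_square)
    also have "\<dots> \<le> (norm (z - w))\<^sup>2 - 2 * \<tau> * (m * (norm (z - w))\<^sup>2) + \<tau>\<^sup>2 * (\<Lambda> * norm (z - w))\<^sup>2"
      using mono[OF that] lip[OF that] \<tau> by (intro add_mono diff_mono mult_left_mono power_mono) auto
    also have "\<dots> = (1 - 2 * \<tau> * m + \<tau> * (\<tau> * \<Lambda>\<^sup>2)) * (norm (z - w))\<^sup>2"
      by (simp add: power_mult_distrib algebra_simps power2_eq_square)
    also have "\<dots> \<le> c\<^sup>2 * (norm (z - w))\<^sup>2"
      using mult_left_mono[OF \<open>\<tau> * \<Lambda>\<^sup>2 \<le> m\<close>, of \<tau>] \<tau> c(3) by (intro mult_right_mono) auto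
    finally have "norm ((z - \<tau> *\<^sub>R A z) - (w - \<tau> *\<^sub>R A w)) \<le> c * norm (z - w)"
      using c(1) by (simp add: power2_le_iff_abs_le flip: power_mult_distrib)
    then show ?thesis
      using projection_nonexpansive order_trans unfolding dist_norm by blast
  qed
  then obtain z where z: "z \<in> S" "?P z = z"
    using Banach_fix[OF S(1,3) c(1,2), of ?P] projection_in by blast
  have "0 \<le> A z \<bullet> (w - z)" if "w \<in> S" for w
    using projection_obtuse[OF that, of "z - \<tau> *\<^sub>R A z"] \<tau> by (simp add: z zero_le_mult_iff)
  with z show ?thesis by blast
qed

end

lemma complete_Times:
  fixes S :: "'a::metric_space set" and T :: "'b::metric_space set"
  assumes "complete S" "complete T"
  shows "complete (S \<times> T)"
  unfolding complete_def
proof (intro allI impI, elim conjE)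
  fix f :: "nat \<Rightarrow> 'a \<times> 'b"
  assume f: "\<forall>n. f n \<in> S \<times> T" "Cauchy f"
  have "Cauchy (\<lambda>n. fst (f n))" "Cauchy (\<lambda>n. snd (f n))"
    using f(2) by (auto intro: Cauchy_fst Cauchy_snd)
  moreover have "fst (f n) \<in> S" "snd (f n) \<in> T" for n
    using f(1) by (auto simp: mem_Times_iff)
  ultimately obtain a b where "a \<in> S" "(\<lambda>n. fst (f n)) \<longlonglongrightarrow> a" "b \<in> T" "(\<lambda>n. snd (f n)) \<longlonglongrightarrow> b"
    using assms unfolding complete_def by metis
  then show "\<exists>l\<in>S \<times> T. f \<longlonglongrightarrow> l"
    using tendsto_Pair[of "\<lambda>n. fst (f n)" a sequentially "\<lambda>n. snd (f n)" b] by (auto intro!: bexI[of _ "(a, b)"])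
qed

lemma projection_Times:
  fixes S :: "'a::real_inner set" and T :: "'b::real_inner set"
  assumes "complete S" "convex S" "S \<noteq> {}" "complete T" "convex T" "T \<noteq> {}"
  shows "projection (S \<times> T) z = (projection S (fst z), projection T (snd z))"
  by (rule projection_unique)
    (use assms in \<open>auto simp: complete_Times convex_Times projection_in inner_prod_def
        intro!: add_nonneg_nonneg projection_obtuse\<close>)

section \<open>Expectations over finitely supported distributions\<close>

text \<open>Every distribution here has finite support, so iterated expectations are finite sums and
  integrability is automatic.\<close>

lemma expectation_bind_finite:
  fixes h :: "'b \<Rightarrow> real"
  assumes "finite (set_pmf M)" "\<And>x. x \<in> set_pmf M \<Longrightarrow> finite (set_pmf (K x))"
  shows "measure_pmf.expectation (bind_pmf M K) h
    = measure_pmf.expectation M (\<lambda>x. measure_pmf.expectation (K x) h)"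
  using pmf_expectation_bind[OF assms(1) assms(2) order_refl, where h = h]
    integral_measure_pmf[OF assms(1), of M "\<lambda>x. measure_pmf.expectation (K x) h"]
  by simp

lemma expectation_mono_finite:
  fixes h k :: "'a \<Rightarrow> real"
  assumes "finite (set_pmf M)" "\<And>x. x \<in> set_pmf M \<Longrightarrow> h x \<le> k x"
  shows "measure_pmf.expectation M h \<le> measure_pmf.expectation M k"
  by (rule integral_mono_AE) (use assms in \<open>auto simp: integrable_measure_pmf_finite AE_measure_pmf_iff\<close>)

lemma expectation_bind_le:
  fixes h :: "'b \<Rightarrow> real"
  assumes "finite (set_pmf M)" "\<And>x. x \<in> set_pmf M \<Longrightarrow> finite (set_pmf (K x))"
    and "\<And>x. x \<in> set_pmf M \<Longrightarrow> measure_pmf.expectation (K x) h \<le> k x"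
  shows "measure_pmf.expectation (bind_pmf M K) h \<le> measure_pmf.expectation M k"
  using expectation_mono_finite[OF assms(1) assms(3)] by (simp add: expectation_bind_finite[OF assms(1,2)])

section \<open>Linear convergence of L-SVRE\<close>

lemma norm_diff_squared_le:
  fixes a b c :: "'a::real_inner"
  shows "(norm (a - c))\<^sup>2 \<le> 2 * (norm (a - b))\<^sup>2 + 2 * (norm (b - c))\<^sup>2"
proof -
  have "2 * (norm (a - b))\<^sup>2 + 2 * (norm (b - c))\<^sup>2 - (norm (a - c))\<^sup>2 = (norm (a - b - (b - c)))\<^sup>2"
    by (simp add: power2_norm_eq_inner inner_diff inner_commute algebra_simps)
  then show ?thesis by (smt (verit) zero_le_power2)
qed

text \<open>The hypotheses are the obtuse angle properties of the projections \<open>zp\<close> and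
  \<open>zh\<close>, tested with \<open>zs\<close> and \<open>zp\<close>. The difference of the two
  sides is twice each of them plus a square. The convex combination of \<open>z\<close> and
  \<open>w\<close> is what splits into separate squared distances with weights 1 - p and p.\<close>

lemma extragradient_step:
  fixes z :: "'a::real_inner"
  assumes "0 \<le> (zp - ((1 - p) *\<^sub>R z + p *\<^sub>R w - \<tau> *\<^sub>R gh)) \<bullet> (zs - zp)"
    and "0 \<le> (zh - ((1 - p) *\<^sub>R z + p *\<^sub>R w - \<tau> *\<^sub>R gw)) \<bullet> (zp - zh)"
  shows "(norm (zp - zs))\<^sup>2 \<le> (1 - p) * (norm (z - zs))\<^sup>2 + p * (norm (w - zs))\<^sup>2
    - (1 - p) * (norm (zh - z))\<^sup>2 - p * (norm (zh - w))\<^sup>2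
    + \<tau>\<^sup>2 * (norm (gh - gw))\<^sup>2 + 2 * \<tau> * (gh \<bullet> (zs - zh))"
    (is "?l \<le> ?r")
proof -
  have "?r - ?l = 2 * ((zp - ((1 - p) *\<^sub>R z + p *\<^sub>R w - \<tau> *\<^sub>R gh)) \<bullet> (zs - zp))
    + 2 * ((zh - ((1 - p) *\<^sub>R z + p *\<^sub>R w - \<tau> *\<^sub>R gw)) \<bullet> (zp - zh))
    + (norm (\<tau> *\<^sub>R (gh - gw) + (zp - zh)))\<^sup>2"
    unfolding power2_norm_eq_inner
    by (simp add: inner_diff inner_add inner_commute algebra_simps power2_eq_square)
  with assms show ?thesis by (smt (verit) zero_le_power2)
qed

lemma norm_saddle_operator_diff:
  "norm (saddle_operator G z - saddle_operator G w) = norm (G z - G w)"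
  by (simp add: saddle_operator_def norm_prod_def norm_minus_commute)

lemma average_saddle_operator:
  "average n (\<lambda>i. saddle_operator (G i)) = saddle_operator (average n G)"
  by (simp add: fun_eq_iff average_def saddle_operator_def prod_eq_iff fst_sum snd_sum sum_negf
      scaleR_minus_right)

text \<open>Since \<open>F\<close> is an arbitrary function of the full state, both the cost and the
  decay of one iteration are read off this sum over the index and the coin.\<close>

lemma lsvre_step_expectation:
  fixes F :: "('a::real_inner \<times> 'b::real_inner) \<times> ('a \<times> 'b) \<times> bool \<times> nat \<Rightarrow> real"
    and G :: "nat \<Rightarrow> 'a \<times> 'b \<Rightarrow> 'a \<times> 'b" and z w :: "'a \<times> 'b" and Z and n c :: nat and p \<tau> and new :: bool
  assumes "n \<ge> 1" "0 \<le> p" "p \<le> 1"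
  defines "g \<equiv> \<lambda>i. saddle_operator (G i)"
  defines "zb \<equiv> (1 - p) *\<^sub>R z + p *\<^sub>R w"
  defines "zh \<equiv> projection Z (zb - \<tau> *\<^sub>R average n g w)"
  defines "zp \<equiv> \<lambda>i. projection Z (zb - \<tau> *\<^sub>R (average n g w + g i zh - g i w))"
  defines "c' \<equiv> c + (if new then n else 0) + 2"
  shows "measure_pmf.expectation (lsvre_step n Z G \<tau> p (z, w, new, c)) F
    = (\<Sum>i<n. p * F (zp i, zp i, True, c') + (1 - p) * F (zp i, w, False, c')) / real n"
proof -
  let ?K = "\<lambda>i. map_pmf (\<lambda>b. if b then (zp i, zp i, True, c') else (zp i, w, False, c')) (bernoulli_pmf p)"
  have eq: "lsvre_step n Z G \<tau> p (z, w, new, c) = bind_pmf (pmf_of_set {..<n}) ?K"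
    unfolding g_def zb_def zh_def zp_def c'_def
    by (simp only: lsvre_step_def Let_def map_pmf_def case_prod_conv)
  have "measure_pmf.expectation (bind_pmf (pmf_of_set {..<n}) ?K) F
      = (\<Sum>i<n. measure_pmf.expectation (?K i) F /\<^sub>R real (card {..<n}))"
    using assms(1) by (intro pmf_expectation_bind_pmf_of_set) (auto simp: lessThan_empty_iff)
  then show ?thesis
    using assms(1-3) by (simp add: eq sum_divide_distrib field_simps lessThan_empty_iff)
qed

section \<open>Support and expected cost of the L-SVRE chain\<close>

lemma set_lsvre_step:
  assumes "complete Z" "convex Z" "Z \<noteq> {}" "n \<ge> 1" "w \<in> Z"
    "(z', w', new', c') \<in> set_pmf (lsvre_step n Z G \<tau> p (z, w, new, c))"
  shows "z' \<in> Z \<and> w' \<in> Z"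
  using assms(4-6)
  by (auto simp: projection_in[OF assms(1-3)] lsvre_step_def Let_def set_pmf_of_set split: if_splits)

lemma set_lsvre_iter:
  assumes "complete Z" "convex Z" "z0 \<in> Z" "n \<ge> 1"
  shows "(z, w, new, c) \<in> set_pmf (lsvre_iter n Z G z0 \<tau> p T) \<Longrightarrow> z \<in> Z \<and> w \<in> Z"
proof (induction T arbitrary: z w new c)
  case (Suc T)
  then obtain z1 w1 new1 c1 where "(z1, w1, new1, c1) \<in> set_pmf (lsvre_iter n Z G z0 \<tau> p T)"
    "(z, w, new, c) \<in> set_pmf (lsvre_step n Z G \<tau> p (z1, w1, new1, c1))"
    by (auto)
  with Suc.IH set_lsvre_step[OF assms(1,2) _ assms(4)] assms(3) show ?case by blast
qed (use assms in auto)

lemma finite_lsvre_step: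
  assumes "n \<ge> 1"
  shows "finite (set_pmf (lsvre_step n Z G \<tau> p s))"
  using assms by (cases s) (auto simp: lsvre_step_def Let_def set_pmf_of_set lessThan_empty_iff)

lemma finite_lsvre_iter:
  assumes "n \<ge> 1"
  shows "finite (set_pmf (lsvre_iter n Z G z0 \<tau> p T))"
  by (induction T) (use assms in \<open>auto simp: finite_lsvre_step\<close>)

text \<open>The cost is tracked together with the full gradient that a raised flag still owes.\<close>

lemma lsvre_iter_cost:
  assumes "n \<ge> 1" "0 \<le> p" "p \<le> 1"
  shows "measure_pmf.expectation (lsvre_iter n Z G z0 \<tau> p T)
      (\<lambda>(z, w, new, c). real c + (if new then real n else 0)) \<le> real n + real T * (2 + p * real n)"
proof (induction T)
  case (Suc T)
  let ?F = "\<lambda>(z, w, new, c). real c + (if new then real n else 0)"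
  have "measure_pmf.expectation (lsvre_iter n Z G z0 \<tau> p (Suc T)) ?F
      \<le> measure_pmf.expectation (lsvre_iter n Z G z0 \<tau> p T) (\<lambda>s. ?F s + (2 + p * real n))"
    unfolding lsvre_iter.simps
    using assms by (intro expectation_bind_le finite_lsvre_iter finite_lsvre_step)
      (auto simp: lsvre_step_expectation field_simps)
  also have "\<dots> = measure_pmf.expectation (lsvre_iter n Z G z0 \<tau> p T) ?F + (2 + p * real n)"
    by (subst Bochner_Integration.integral_add)
      (auto intro!: integrable_measure_pmf_finite finite_lsvre_iter assms(1) simp del: lsvre_iter.simps)
  finally show ?case using Suc.IH by (simp add: algebra_simps)
qed simp

lemma lsvre_cost:
  assumes "n \<ge> 1" "0 \<le> p" "p \<le> 1"
  shows "measure_pmf.expectation (lsvre n Z G z0 \<tau> p T) (\<lambda>(z, c). real c)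
    \<le> real n + real T * (2 + p * real n)"
proof -
  have "measure_pmf.expectation (lsvre n Z G z0 \<tau> p T) (\<lambda>(z, c). real c)
      = measure_pmf.expectation (lsvre_iter n Z G z0 \<tau> p T) (\<lambda>(z, w, new, c). real c)"
    by (simp add: lsvre_def case_prod_unfold)
  also have "\<dots> \<le> measure_pmf.expectation (lsvre_iter n Z G z0 \<tau> p T)
      (\<lambda>(z, w, new, c). real c + (if new then real n else 0))"
    using assms(1) by (intro expectation_mono_finite finite_lsvre_iter) auto
  finally show ?thesis by (rule order_trans[OF _ lsvre_iter_cost[OF assms]])
qed

text \<open>\<open>mono\<close> is strong monotonicity centred at \<open>zs\<close>, with the
  variational inequality at \<open>zs\<close> already built in. The bound on \<tau> makes the
  variance term cost only half of the negative term
  \<open>p * (norm (zh - w))\<^sup>2\<close>.\<close>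

locale lsvre_problem =
  fixes n :: nat and Z :: "('a::real_inner \<times> 'b::real_inner) set"
    and G :: "nat \<Rightarrow> 'a \<times> 'b \<Rightarrow> 'a \<times> 'b" and m \<Lambda> \<tau> p :: real and zs :: "'a \<times> 'b"
  assumes Z: "complete Z" "convex Z"
    and n: "n \<ge> 1"
    and smooth: "average_smooth n \<Lambda> Z G"
    and mono: "\<And>z. z \<in> Z \<Longrightarrow> m * (norm (z - zs))\<^sup>2 \<le> saddle_operator (average n G) z \<bullet> (z - zs)"
    and zs: "zs \<in> Z"
    and m: "0 < m" and p: "0 < p" "p \<le> 1/2" and \<tau>: "0 < \<tau>" "\<tau>\<^sup>2 * \<Lambda>\<^sup>2 \<le> p / 2"
begin

text \<open>The weight 1 - p makes the refresh coin neutral: after a step to z' the expected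
  potential is |z' - zs|^2 + (1 - p) |w - zs|^2, whose first term is the left side of the
  extragradient inequality.\<close>

definition potential :: "'a \<times> 'b \<Rightarrow> 'a \<times> 'b \<Rightarrow> real"
  where "potential z w = (1 - p) * (norm (z - zs))\<^sup>2 + (norm (w - zs))\<^sup>2"

lemma nonempty: "Z \<noteq> {}"
  using zs by blast

text \<open>Variance reduction: the corrections average out, so the mean direction is the full
  operator at \<open>zh\<close>, while average smoothness bounds the mean squared deviation by
  \<Lambda>^2 |zh - w|^2.\<close>

lemma potential_step:
  assumes r: "r \<le> p / 4" "r \<le> \<tau> * m / 2" and zw: "z \<in> Z" "w \<in> Z"
  shows "measure_pmf.expectation (lsvre_step n Z G \<tau> p (z, w, new, c)) (\<lambda>(z, w, _). potential z w)
    \<le> (1 - r) * potential z w"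
proof -
  define g where "g = (\<lambda>i. saddle_operator (G i))"
  define zb where "zb = (1 - p) *\<^sub>R z + p *\<^sub>R w"
  define zh where "zh = projection Z (zb - \<tau> *\<^sub>R average n g w)"
  define gh where "gh = (\<lambda>i. average n g w + g i zh - g i w)"
  define zp where "zp = (\<lambda>i. projection Z (zb - \<tau> *\<^sub>R gh i))"
  note proj = Z nonempty
  have in_Z: "zh \<in> Z" "zp i \<in> Z" for i
    by (simp_all add: zh_def zp_def projection_in[OF proj])
  define B where "B = (1 - p) * (norm (z - zs))\<^sup>2 + p * (norm (w - zs))\<^sup>2
      - (1 - p) * (norm (zh - z))\<^sup>2 - p * (norm (zh - w))\<^sup>2"
  have "(norm (zp i - zs))\<^sup>2 \<le> B + \<tau>\<^sup>2 * (norm (gh i - average n g w))\<^sup>2 + 2 * \<tau> * (gh i \<bullet> (zs - zh))" for i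
    unfolding B_def
    by (rule extragradient_step)
      (auto simp: zp_def zh_def zb_def intro!: projection_obtuse[OF proj] zs projection_in[OF proj])
  then have "(\<Sum>i<n. (norm (zp i - zs))\<^sup>2)
      \<le> (\<Sum>i<n. B + \<tau>\<^sup>2 * (norm (gh i - average n g w))\<^sup>2 + 2 * \<tau> * (gh i \<bullet> (zs - zh)))"
    by (rule sum_mono)
  also have "\<dots> = n * B + \<tau>\<^sup>2 * (\<Sum>i<n. (norm (G i zh - G i w))\<^sup>2)
      + 2 * \<tau> * ((\<Sum>i<n. gh i) \<bullet> (zs - zh))"
    by (simp add: sum.distrib gh_def g_def norm_saddle_operator_diff sum_distrib_left inner_sum_left)
  also have "(\<Sum>i<n. gh i) = real n *\<^sub>R average n g zh"
    using n by (simp add: gh_def sum.distrib sum_subtractf average_def sum_constant_scaleR)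
  also have "(\<Sum>i<n. (norm (G i zh - G i w))\<^sup>2) \<le> n * (\<Lambda>\<^sup>2 * (norm (zh - w))\<^sup>2)"
    using smooth in_Z(1) zw n by (auto simp: average_smooth_def field_simps)
  finally have "(\<Sum>i<n. (norm (zp i - zs))\<^sup>2) \<le> n * B + \<tau>\<^sup>2 * (n * (\<Lambda>\<^sup>2 * (norm (zh - w))\<^sup>2))
      + 2 * \<tau> * (real n *\<^sub>R average n g zh \<bullet> (zs - zh))"
    using \<tau> by (simp add: mult_left_mono)
  then have "(\<Sum>i<n. (norm (zp i - zs))\<^sup>2) / n \<le> B + (\<tau>\<^sup>2 * \<Lambda>\<^sup>2) * (norm (zh - w))\<^sup>2
      + 2 * \<tau> * (average n g zh \<bullet> (zs - zh))"
    using n by (simp add: divide_simps algebra_simps)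
  also have "\<dots> \<le> B + p / 2 * (norm (zh - w))\<^sup>2 + 2 * \<tau> * (- (m * (norm (zh - zs))\<^sup>2))"
    using mono[OF in_Z(1)] \<tau>
    by (intro add_mono mult_right_mono mult_left_mono)
      (auto simp: g_def average_saddle_operator inner_diff_right)
  finally have main: "(\<Sum>i<n. (norm (zp i - zs))\<^sup>2) / n
    \<le> (1 - p) * (norm (z - zs))\<^sup>2 + p * (norm (w - zs))\<^sup>2 - (1 - p) * (norm (zh - z))\<^sup>2
      - p / 2 * (norm (zh - w))\<^sup>2 - 2 * (\<tau> * m) * (norm (zh - zs))\<^sup>2"
    by (simp add: B_def algebra_simps)
  have "measure_pmf.expectation (lsvre_step n Z G \<tau> p (z, w, new, c)) (\<lambda>(z, w, _). potential z w)
      = (\<Sum>i<n. (norm (zp i - zs))\<^sup>2 + (1 - p) * (norm (w - zs))\<^sup>2) / n"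
    using n p by (subst lsvre_step_expectation)
      (auto simp: potential_def gh_def g_def zb_def zh_def zp_def algebra_simps intro!: sum.cong)
  also have "\<dots> = (\<Sum>i<n. (norm (zp i - zs))\<^sup>2) / n + (1 - p) * (norm (w - zs))\<^sup>2"
    using n by (simp add: sum.distrib add_divide_distrib)
  also have "\<dots> \<le> (1 - r) * potential z w"
  proof (cases "r \<le> 0")
    case True
    then have "r * potential z w \<le> 0"
      using p by (intro mult_nonpos_nonneg) (auto simp: potential_def)
    moreover have "0 \<le> (1 - p) * (norm (zh - z))\<^sup>2" "0 \<le> p / 2 * (norm (zh - w))\<^sup>2"
      "0 \<le> 2 * (\<tau> * m) * (norm (zh - zs))\<^sup>2"
      using p m \<tau> by auto
    ultimately show ?thesis using main by (simp add: potential_def algebra_simps)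
  next
    \<comment> \<open>Both distances to \<open>zs\<close> are taken through \<open>zh\<close>. The
      three negative terms of \<open>main\<close> pay for the result because 2 r \<le> 1, 2 r \<le>
      p / 2 and 4 r \<le> 2 \<tau> m.\<close>
    case False
    have "r * (1 - p) * (norm (z - zs))\<^sup>2
        \<le> r * (1 - p) * (2 * (norm (zh - z))\<^sup>2 + 2 * (norm (zh - zs))\<^sup>2)"
      using False p norm_diff_squared_le[of z zs zh]
      by (intro mult_left_mono) (auto simp: norm_minus_commute)
    moreover have "r * (norm (w - zs))\<^sup>2 \<le> r * (2 * (norm (zh - w))\<^sup>2 + 2 * (norm (zh - zs))\<^sup>2)"
      using False norm_diff_squared_le[of w zs zh]
      by (intro mult_left_mono) (auto simp: norm_minus_commute)
    moreover have "2 * r * (1 - p) * (norm (zh - z))\<^sup>2 \<le> (1 - p) * (norm (zh - z))\<^sup>2"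
      using r(1) p by (intro mult_right_mono) auto
    moreover have "2 * r * (norm (zh - w))\<^sup>2 \<le> p / 2 * (norm (zh - w))\<^sup>2"
      using r(1) by (intro mult_right_mono) auto
    moreover have "2 * r * (1 - p) * (norm (zh - zs))\<^sup>2 \<le> 2 * r * (norm (zh - zs))\<^sup>2"
      using False p by (intro mult_right_mono) auto
    moreover have "4 * r * (norm (zh - zs))\<^sup>2 \<le> 2 * (\<tau> * m) * (norm (zh - zs))\<^sup>2"
      using r(2) by (intro mult_right_mono) auto
    ultimately show ?thesis using main by (simp add: potential_def algebra_simps)
  qed
  finally show ?thesis .
qed

lemma potential_iter:
  assumes r: "r \<le> p / 4" "r \<le> \<tau> * m / 2" and "z0 \<in> Z"
  shows "measure_pmf.expectation (lsvre_iter n Z G z0 \<tau> p T) (\<lambda>(z, w, _). potential z w)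
    \<le> (1 - r) ^ T * potential z0 z0"
proof (induction T)
  case (Suc T)
  have "measure_pmf.expectation (lsvre_iter n Z G z0 \<tau> p (Suc T)) (\<lambda>(z, w, _). potential z w)
      \<le> measure_pmf.expectation (lsvre_iter n Z G z0 \<tau> p T) (\<lambda>s. (1 - r) * (\<lambda>(z, w, _). potential z w) s)"
    unfolding lsvre_iter.simps
    by (intro expectation_bind_le finite_lsvre_iter finite_lsvre_step n)
      (use set_lsvre_iter[OF Z assms(3) n] potential_step[OF r] in auto)
  also have "\<dots> = (1 - r) * measure_pmf.expectation (lsvre_iter n Z G z0 \<tau> p T) (\<lambda>(z, w, _). potential z w)"
    by (rule integral_mult_right_zero)
  also have "\<dots> \<le> (1 - r) * ((1 - r) ^ T * potential z0 z0)"
    using Suc.IH r(1) p by (intro mult_left_mono) auto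
  finally show ?case by simp
qed simp

text \<open>One factor 2 comes from 1 - p \<ge> 1/2, the other from the start \<open>z = w\<close>,
  where the potential counts the distance almost twice.\<close>

lemma lsvre_distance:
  assumes r: "r \<le> p / 4" "r \<le> \<tau> * m / 2" and "z0 \<in> Z"
  shows "measure_pmf.expectation (lsvre n Z G z0 \<tau> p T) (\<lambda>(z, c). (norm (z - zs))\<^sup>2)
    \<le> 4 * (1 - r) ^ T * (norm (z0 - zs))\<^sup>2"
proof -
  have "measure_pmf.expectation (lsvre n Z G z0 \<tau> p T) (\<lambda>(z, c). (norm (z - zs))\<^sup>2)
      = measure_pmf.expectation (lsvre_iter n Z G z0 \<tau> p T) (\<lambda>(z, w, _). (norm (z - zs))\<^sup>2)"
    by (simp add: lsvre_def case_prod_unfold)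
  also have "\<dots> \<le> measure_pmf.expectation (lsvre_iter n Z G z0 \<tau> p T)
      (\<lambda>s. 2 * (\<lambda>(z, w, _). potential z w) s)"
  proof (intro expectation_mono_finite finite_lsvre_iter n, clarify)
    fix z w
    define K where "K = (1 - p) * (norm (z - zs))\<^sup>2"
    have "1/2 * (norm (z - zs))\<^sup>2 \<le> K"
      unfolding K_def using p by (intro mult_right_mono) auto
    then show "(norm (z - zs))\<^sup>2 \<le> 2 * potential z w"
      using zero_le_power2[of "norm (w - zs)"] unfolding potential_def K_def[symmetric] by argo
  qed
  also have "\<dots> = 2 * measure_pmf.expectation (lsvre_iter n Z G z0 \<tau> p T) (\<lambda>(z, w, _). potential z w)"
    by (rule integral_mult_right_zero)
  also have "\<dots> \<le> 2 * ((1 - r) ^ T * (2 * (norm (z0 - zs))\<^sup>2))"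
  proof -
    have "potential z0 z0 \<le> 2 * (norm (z0 - zs))\<^sup>2"
      using p by (simp add: potential_def algebra_simps)
    moreover have "0 \<le> (1 - r) ^ T" using r(1) p by simp
    ultimately show ?thesis
      using potential_iter[OF assms, of T] by (smt (verit) mult_left_mono)
  qed
  finally show ?thesis by simp
qed

end

section \<open>Strongly convex-concave saddle point problems\<close>

text \<open>The difference quotient along the segment is bounded by \<phi> z' - \<phi> z - K (1 -
  t); let t tend to 0 from the right. Working on one segment suits a set with empty interior and
  also covers moves in only one of two variables.\<close>

lemma has_derivative_lower_bound:
  fixes \<phi> :: "'a::real_inner \<Rightarrow> real"
  assumes deriv: "(\<phi> has_derivative (\<lambda>h. g \<bullet> h)) (at z within S)"
    and seg: "\<And>t. t \<in> {0..1} \<Longrightarrow> z + t *\<^sub>R (z' - z) \<in> S"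
    and conv: "\<And>t. t \<in> {0..1} \<Longrightarrow>
      \<phi> (z + t *\<^sub>R (z' - z)) \<le> (1 - t) * \<phi> z + t * \<phi> z' - K * (t * (1 - t))"
  shows "\<phi> z + g \<bullet> (z' - z) + K \<le> \<phi> z'"
proof -
  let ?\<psi> = "\<lambda>t. \<phi> (z + t *\<^sub>R (z' - z))"
  have "((\<lambda>t. z + t *\<^sub>R (z' - z)) has_derivative (\<lambda>t. t *\<^sub>R (z' - z))) (at 0 within {0..1})"
    by (auto intro!: derivative_eq_intros)
  moreover have "(\<phi> has_derivative (\<lambda>h. g \<bullet> h))
      (at (z + 0 *\<^sub>R (z' - z)) within (\<lambda>t. z + t *\<^sub>R (z' - z)) ` {0..1})"
    using has_derivative_subset[OF deriv, of "(\<lambda>t. z + t *\<^sub>R (z' - z)) ` {0..1}"] seg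
    by (simp add: image_subset_iff)
  ultimately have "(?\<psi> has_derivative (\<lambda>t. g \<bullet> (t *\<^sub>R (z' - z)))) (at 0 within {0..1})"
    by (rule has_derivative_in_compose)
  then have "(?\<psi> has_real_derivative g \<bullet> (z' - z)) (at 0 within {0..1})"
    by (simp add: has_field_derivative_def mult.commute[of _ "g \<bullet> (z' - z)"] mult_commute_abs)
  then have "((\<lambda>t. (?\<psi> t - ?\<psi> 0) / (t - 0)) \<longlongrightarrow> g \<bullet> (z' - z)) (at 0 within {0..1})"
    by (simp only: has_field_derivative_iff)
  moreover have "((\<lambda>t. \<phi> z' - \<phi> z - K * (1 - t)) \<longlongrightarrow> \<phi> z' - \<phi> z - K * (1 - 0)) (at 0 within {0..1})"
    by (intro tendsto_intros)
  moreover have "\<forall>\<^sub>F t in at 0 within {0..1}. (?\<psi> t - ?\<psi> 0) / (t - 0) \<le> \<phi> z' - \<phi> z - K * (1 - t)"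
    unfolding eventually_at_filter
  proof (intro always_eventually allI impI)
    fix t :: real assume t: "t \<noteq> 0" "t \<in> {0..1}"
    have "?\<psi> t - \<phi> z \<le> (\<phi> z' - \<phi> z - K * (1 - t)) * t"
      using conv[OF t(2)] by (simp only: algebra_simps)
    then show "(?\<psi> t - ?\<psi> 0) / (t - 0) \<le> \<phi> z' - \<phi> z - K * (1 - t)"
      using t by (simp add: pos_divide_le_eq)
  qed
  moreover have "at (0::real) within {0..1} \<noteq> bot"
    by (simp add: at_within_Icc_at_right)
  ultimately have "g \<bullet> (z' - z) \<le> \<phi> z' - \<phi> z - K * (1 - 0)"
    by (intro tendsto_le[of "at 0 within {0..1}"])
  then show ?thesis by simp
qed

text \<open>\<open>gap_bound\<close> expresses both strong convexity in \<open>x\<close> and strong concavity in \<open>y\<close> by first-order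
  inequalities, added up so that only the operator \<open>A = (\<nabla>\<^sub>x H, -\<nabla>\<^sub>y H)\<close> appears.\<close>

locale saddle_problem =
  fixes X :: "'a::real_inner set" and Y :: "'b::real_inner set"
    and H :: "'a \<times> 'b \<Rightarrow> real" and A :: "'a \<times> 'b \<Rightarrow> 'a \<times> 'b" and mx my \<Lambda> :: real
  assumes X: "complete X" "convex X" "X \<noteq> {}"
    and Y: "complete Y" "convex Y" "Y \<noteq> {}"
    and mx: "0 < mx" and my: "0 < my"
    and strongly_convex: "\<And>y. y \<in> Y \<Longrightarrow> strongly_convex_on mx X (\<lambda>x. H (x, y))"
    and gap_bound: "\<And>x y x' y'. x \<in> X \<Longrightarrow> y \<in> Y \<Longrightarrow> x' \<in> X \<Longrightarrow> y' \<in> Y \<Longrightarrow>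
      H (x, y') - H (x', y) \<le> A (x, y) \<bullet> ((x, y) - (x', y'))
        - mx / 2 * (norm (x - x'))\<^sup>2 - my / 2 * (norm (y - y'))\<^sup>2"
    and lipschitz: "\<And>z w. z \<in> X \<times> Y \<Longrightarrow> w \<in> X \<times> Y \<Longrightarrow> norm (A z - A w) \<le> \<Lambda> * norm (z - w)"
begin

lemma XY: "complete (X \<times> Y)" "convex (X \<times> Y)" "X \<times> Y \<noteq> {}"
  using X Y by (auto simp: complete_Times convex_Times)

lemma monotone_operator:
  assumes "x \<in> X" "y \<in> Y" "x' \<in> X" "y' \<in> Y"
  shows "mx * (norm (x - x'))\<^sup>2 + my * (norm (y - y'))\<^sup>2
    \<le> (A (x, y) - A (x', y')) \<bullet> ((x, y) - (x', y'))"
proof -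
  have "A (x', y') \<bullet> ((x', y') - (x, y)) = - (A (x', y') \<bullet> ((x, y) - (x', y')))"
    by (metis inner_minus_right minus_diff_eq)
  then show ?thesis
    using gap_bound[OF assms] gap_bound[OF assms(3,4,1,2)]
    by (simp add: inner_diff_left norm_minus_commute del: diff_Pair)
qed

lemma strongly_monotone_operator:
  assumes "m \<le> mx" "m \<le> my" "z \<in> X \<times> Y" "w \<in> X \<times> Y"
  shows "m * (norm (z - w))\<^sup>2 \<le> (A z - A w) \<bullet> (z - w)"
proof -
  obtain x y x' y' where [simp]: "z = (x, y)" "w = (x', y')" by (meson surj_pair)
  have "m * (norm (z - w))\<^sup>2 = m * (norm (x - x'))\<^sup>2 + m * (norm (y - y'))\<^sup>2"
    by (simp add: norm_prod_def distrib_left)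
  also have "\<dots> \<le> mx * (norm (x - x'))\<^sup>2 + my * (norm (y - y'))\<^sup>2"
    using assms by (intro add_mono mult_right_mono) auto
  finally show ?thesis using monotone_operator[of x y x' y'] assms by simp
qed

definition saddle :: "'a \<times> 'b"
  where "saddle = (SOME z. z \<in> X \<times> Y \<and> (\<forall>w\<in>X \<times> Y. 0 \<le> A z \<bullet> (w - z)))"

definition xs :: 'a where "xs = fst saddle"
definition ys :: 'b where "ys = snd saddle"

lemma saddle: "saddle \<in> X \<times> Y \<and> (\<forall>w\<in>X \<times> Y. 0 \<le> A saddle \<bullet> (w - saddle))"
proof -
  have "\<exists>z\<in>X \<times> Y. \<forall>w\<in>X \<times> Y. 0 \<le> A z \<bullet> (w - z)"
    by (rule variational_inequality_solvable[OF XY, of "min mx my" A \<Lambda>])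
      (auto simp: mx my intro: strongly_monotone_operator lipschitz)
  then show ?thesis
    unfolding saddle_def Bex_def by (rule someI_ex)
qed

lemma xs_in: "xs \<in> X" and ys_in: "ys \<in> Y" and saddle_eq: "saddle = (xs, ys)"
  using saddle by (auto simp: xs_def ys_def mem_Times_iff)

lemma saddle_operator_nonneg: "x \<in> X \<Longrightarrow> y \<in> Y \<Longrightarrow> 0 \<le> A (xs, ys) \<bullet> ((x, y) - (xs, ys))"
  using saddle by (auto simp: saddle_eq)

text \<open>At the saddle point the variational inequality removes the operator term of
  \<open>gap_bound\<close>, and both quadratic terms survive.\<close>

lemma saddle_growth:
  assumes "x \<in> X" "y \<in> Y"
  shows "H (xs, y) + mx / 2 * (norm (x - xs))\<^sup>2 + my / 2 * (norm (y - ys))\<^sup>2 \<le> H (x, ys)"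
proof -
  have "A (xs, ys) \<bullet> ((xs, ys) - (x, y)) = - (A (xs, ys) \<bullet> ((x, y) - (xs, ys)))"
    by (metis inner_minus_right minus_diff_eq)
  then show ?thesis
    using gap_bound[OF xs_in ys_in assms] saddle_operator_nonneg[OF assms]
    by (simp add: norm_minus_commute del: diff_Pair)
qed

lemma saddle_le: "x \<in> X \<Longrightarrow> y \<in> Y \<Longrightarrow> H (xs, y) \<le> H (x, ys)"
  using saddle_growth mx my by (smt (verit) mult_nonneg_nonneg zero_le_power2 half_gt_zero)

text \<open>Against a residual bound \<rho> D the moduli contribute -(m / 2) D^2, and the maximum
  over D is \<rho>^2 / (2 m). This is how distances become duality gaps; taking for \<rho> the norm
  of the operator bounds the function itself.\<close>

lemma gap_le_square:
  assumes "x \<in> X" "y \<in> Y" "x' \<in> X" "y' \<in> Y" and m: "0 < m" "m \<le> mx" "m \<le> my"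
    and res: "A (x, y) \<bullet> ((x, y) - (x', y')) \<le> \<rho> * norm ((x, y) - (x', y'))"
  shows "H (x, y') - H (x', y) \<le> \<rho>\<^sup>2 / (2 * m)"
proof -
  let ?D = "norm ((x, y) - (x', y'))"
  have "m * ?D\<^sup>2 \<le> mx * (norm (x - x'))\<^sup>2 + my * (norm (y - y'))\<^sup>2"
    using m by (simp add: norm_prod_def distrib_left add_mono mult_right_mono)
  then have "H (x, y') - H (x', y) \<le> \<rho> * ?D - m / 2 * ?D\<^sup>2"
    using gap_bound[OF assms(1-4)] res by simp
  also have "\<dots> = \<rho>\<^sup>2 / (2 * m) - m / 2 * (?D - \<rho> / m)\<^sup>2"
    using m(1) by (simp add: power2_eq_square field_simps)
  also have "\<dots> \<le> \<rho>\<^sup>2 / (2 * m)" using m(1) by simp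
  finally show ?thesis .
qed

text \<open>Suprema and infima of reals carry information only for bounded sets. On unbounded
  \<open>X\<close> and \<open>Y\<close> the bounds come from strong convexity and concavity, through
  the gap estimate with one coordinate kept fixed.\<close>

lemma bdd_above_H: "x \<in> X \<Longrightarrow> bdd_above ((\<lambda>y. H (x, y)) ` Y)"
  and bdd_below_H: "y \<in> Y \<Longrightarrow> bdd_below ((\<lambda>x. H (x, y)) ` X)"
proof -
  have res: "A (x, y) \<bullet> w \<le> norm (A (x, y)) * norm w" for x y w
    by (rule norm_cauchy_schwarz)
  have gap: "H (x, y') - H (x', y) \<le> (norm (A (x, y)))\<^sup>2 / (2 * min mx my)"
    if "x \<in> X" "y \<in> Y" "x' \<in> X" "y' \<in> Y" for x y x' y'
    using that mx my by (intro gap_le_square res) auto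
  show "bdd_above ((\<lambda>y. H (x, y)) ` Y)" if "x \<in> X"
    using gap[OF that ys_in that] by (intro bdd_aboveI2[where M = "H (x, ys) + (norm (A (x, ys)))\<^sup>2 / (2 * min mx my)"])
      (simp add: algebra_simps)
  show "bdd_below ((\<lambda>x. H (x, y)) ` X)" if "y \<in> Y"
    using gap[OF xs_in that _ that] by (intro bdd_belowI2[where m = "H (xs, y) - (norm (A (xs, y)))\<^sup>2 / (2 * min mx my)"])
      (simp add: algebra_simps)
qed

lemma duality_gap_upper: "x \<in> X \<Longrightarrow> y \<in> Y \<Longrightarrow> x' \<in> X \<Longrightarrow> y' \<in> Y \<Longrightarrow>
    H (x, y') - H (x', y) \<le> duality_gap X Y H (x, y)"
  unfolding duality_gap_def fst_conv snd_conv
  by (intro diff_mono cSUP_upper cINF_lower bdd_above_H bdd_below_H)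

section \<open>The primal function\<close>

definition primal :: "'a \<Rightarrow> real"
  where "primal x = (SUP y\<in>Y. H (x, y))"

lemma primal_upper: "x \<in> X \<Longrightarrow> y \<in> Y \<Longrightarrow> H (x, y) \<le> primal x"
  unfolding primal_def by (intro cSUP_upper bdd_above_H)

lemma primal_least: "(\<And>y. y \<in> Y \<Longrightarrow> H (x, y) \<le> c) \<Longrightarrow> primal x \<le> c"
  unfolding primal_def by (intro cSUP_least Y(3))

lemma primal_xs: "primal xs = H (xs, ys)"
  using primal_upper[OF xs_in ys_in] primal_least[of xs] saddle_le[OF xs_in] by (meson antisym)

lemma primal_growth: "x \<in> X \<Longrightarrow> primal xs + mx / 2 * (norm (x - xs))\<^sup>2 \<le> primal x"
  using saddle_growth[of x ys] primal_upper[of x ys] ys_in by (simp add: primal_xs)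

lemma primal_strongly_convex:
  assumes "x \<in> X" "x' \<in> X" "0 \<le> t" "t \<le> 1"
  shows "primal ((1 - t) *\<^sub>R x + t *\<^sub>R x')
    \<le> (1 - t) * primal x + t * primal x' - mx / 2 * (t * (1 - t)) * (norm (x - x'))\<^sup>2"
proof (rule primal_least)
  fix y assume y: "y \<in> Y"
  have "H ((1 - t) *\<^sub>R x + t *\<^sub>R x', y)
      \<le> (1 - t) * H (x, y) + t * H (x', y) - mx / 2 * (t * (1 - t)) * (norm (x - x'))\<^sup>2"
    using strongly_convex[OF y] assms by (simp add: strongly_convex_on_def)
  also have "\<dots> \<le> (1 - t) * primal x + t * primal x' - mx / 2 * (t * (1 - t)) * (norm (x - x'))\<^sup>2"
    using assms y by (intro diff_right_mono add_mono mult_left_mono primal_upper) auto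
  finally show "H ((1 - t) *\<^sub>R x + t *\<^sub>R x', y) \<le> \<dots>" .
qed

end

lemma duality_gap_le:
  assumes "X \<noteq> {}" "Y \<noteq> {}"
    and "\<And>x' y'. x' \<in> X \<Longrightarrow> y' \<in> Y \<Longrightarrow> H (x, y') - H (x', y) \<le> e"
  shows "duality_gap X Y H (x, y) \<le> e"
proof -
  have "(SUP y'\<in>Y. H (x, y')) \<le> e + H (x', y)" if "x' \<in> X" for x'
    using assms that by (intro cSUP_least) (auto simp: algebra_simps)
  then have "(SUP y'\<in>Y. H (x, y')) - e \<le> (INF x'\<in>X. H (x', y))"
    using assms(1) by (intro cINF_greatest) (auto simp: algebra_simps)
  then show ?thesis by (simp add: duality_gap_def)
qed

lemma strongly_convex_on_add_prox:
  fixes h :: "'a::real_inner \<times> 'b \<Rightarrow> real"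
  assumes "strongly_convex_on m X (\<lambda>x. h (x, y))"
  shows "strongly_convex_on (m + 2 * c) X (\<lambda>x. add_prox c u h (x, y))"
proof -
  have "add_prox c u h ((1 - t) *\<^sub>R x + t *\<^sub>R x', y)
      \<le> (1 - t) * add_prox c u h (x, y) + t * add_prox c u h (x', y)
        - (m + 2 * c) / 2 * (t * (1 - t)) * (norm (x - x'))\<^sup>2"
    if "x \<in> X" "x' \<in> X" "t \<in> {0..1}" for x x' t
  proof -
    have N: "(norm ((1 - t) *\<^sub>R x + t *\<^sub>R x' - u))\<^sup>2
        = (1 - t) * (norm (x - u))\<^sup>2 + t * (norm (x' - u))\<^sup>2 - t * (1 - t) * (norm (x - x'))\<^sup>2"
      unfolding power2_norm_eq_inner by (simp add: inner_diff inner_add inner_commute algebra_simps)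
    have real: "h1 + c * ((1 - t) * a + t * b - t * (1 - t) * D)
        \<le> (1 - t) * (h0 + c * a) + t * (h2 + c * b) - (m + 2 * c) / 2 * (t * (1 - t)) * D"
      if "h1 \<le> (1 - t) * h0 + t * h2 - m / 2 * (t * (1 - t)) * D" for h0 h1 h2 a b D :: real
    proof -
      have "(1 - t) * (h0 + c * a) + t * (h2 + c * b) - (m + 2 * c) / 2 * (t * (1 - t)) * D
          = ((1 - t) * h0 + t * h2 - m / 2 * (t * (1 - t)) * D) + c * ((1 - t) * a + t * b - t * (1 - t) * D)"
        by (simp add: field_simps)
      then show ?thesis using that by linarith
    qed
    have "h ((1 - t) *\<^sub>R x + t *\<^sub>R x', y)
        \<le> (1 - t) * h (x, y) + t * h (x', y) - m / 2 * (t * (1 - t)) * (norm (x - x'))\<^sup>2"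
      using assms that by (simp add: strongly_convex_on_def)
    then show ?thesis
      unfolding add_prox_def fst_conv N by (rule real)
  qed
  then show ?thesis
    using assms by (simp add: strongly_convex_on_def)
qed

text \<open>The proximal term satisfies its own first-order inequality with equality, so it adds
  exactly \<beta> to the modulus in x. Each subproblem is thus an instance of the same locale, with
  its own saddle point.\<close>

lemma (in saddle_problem) saddle_problem_prox:
  assumes "0 \<le> \<beta>"
  shows "saddle_problem X Y (add_prox (\<beta> / 2) u H) (\<lambda>z. A z + (\<beta> *\<^sub>R (fst z - u), 0))
    (mx + \<beta>) my (\<Lambda> + \<beta>)"
proof unfold_locales
  show "strongly_convex_on (mx + \<beta>) X (\<lambda>x. add_prox (\<beta> / 2) u H (x, y))" if "y \<in> Y" for y
    using strongly_convex_on_add_prox[OF strongly_convex[OF that], of "\<beta> / 2"] by simp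
  show "add_prox (\<beta> / 2) u H (x, y') - add_prox (\<beta> / 2) u H (x', y)
      \<le> (A (x, y) + (\<beta> *\<^sub>R (fst (x, y) - u), 0)) \<bullet> ((x, y) - (x', y'))
        - (mx + \<beta>) / 2 * (norm (x - x'))\<^sup>2 - my / 2 * (norm (y - y'))\<^sup>2"
    if "x \<in> X" "y \<in> Y" "x' \<in> X" "y' \<in> Y" for x y x' y'
  proof -
    have "\<beta> / 2 * (norm (x - u))\<^sup>2 - \<beta> / 2 * (norm (x' - u))\<^sup>2
        = \<beta> *\<^sub>R (x - u) \<bullet> (x - x') - \<beta> / 2 * (norm (x - x'))\<^sup>2"
      unfolding power2_norm_eq_inner by (simp add: inner_diff inner_commute algebra_simps)
    moreover have "(A (x, y) + (\<beta> *\<^sub>R (x - u), 0)) \<bullet> ((x, y) - (x', y'))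
        = A (x, y) \<bullet> ((x, y) - (x', y')) + \<beta> *\<^sub>R (x - u) \<bullet> (x - x')"
      by (simp add: inner_add_left)
    moreover have "(mx + \<beta>) / 2 * (norm (x - x'))\<^sup>2
        = mx / 2 * (norm (x - x'))\<^sup>2 + \<beta> / 2 * (norm (x - x'))\<^sup>2"
      by (simp add: algebra_simps)
    ultimately show ?thesis
      using gap_bound[OF that] unfolding add_prox_def fst_conv by linarith
  qed
  show "norm (A z + (\<beta> *\<^sub>R (fst z - u), 0) - (A w + (\<beta> *\<^sub>R (fst w - u), 0))) \<le> (\<Lambda> + \<beta>) * norm (z - w)"
    if "z \<in> X \<times> Y" "w \<in> X \<times> Y" for z w
  proof -
    have "A z + (\<beta> *\<^sub>R (fst z - u), 0) - (A w + (\<beta> *\<^sub>R (fst w - u), 0))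
        = (A z - A w) + (\<beta> *\<^sub>R fst (z - w), 0)"
      by (simp add: prod_eq_iff scaleR_diff_right)
    also have "norm \<dots> \<le> norm (A z - A w) + \<beta> * norm (fst (z - w))"
      using assms by (intro order_trans[OF norm_triangle_ineq]) (simp add: norm_prod_def)
    also have "\<dots> \<le> \<Lambda> * norm (z - w) + \<beta> * norm (z - w)"
      using assms lipschitz[OF that] norm_fst_le[of "fst (z - w)" "snd (z - w)"]
      by (intro add_mono mult_left_mono) (auto simp del: fst_diff snd_diff)
    finally show ?thesis by (simp add: distrib_right)
  qed
qed (use X Y mx my assms in auto)

text \<open>The first-order inequalities for x alone and for y alone are added;
  \<open>H (x, y)\<close> cancels, which is why only the operator remains.\<close>

lemma saddle_problem_of_gradient:
  fixes X :: "'a::real_inner set" and Y :: "'b::real_inner set"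
  assumes XY: "complete X" "X \<noteq> {}" "complete Y" "Y \<noteq> {}" "0 < mx" "0 < my"
    and grad: "gradient_on (X \<times> Y) H G"
    and cc: "convex_concave mx my X Y H"
    and lip: "\<And>z w. z \<in> X \<times> Y \<Longrightarrow> w \<in> X \<times> Y \<Longrightarrow> norm (G z - G w) \<le> \<Lambda> * norm (z - w)"
  shows "saddle_problem X Y H (saddle_operator G) mx my \<Lambda>"
proof unfold_locales
  have scx: "strongly_convex_on mx X (\<lambda>x. H (x, y))" if "y \<in> Y" for y
    using cc that by (simp add: convex_concave_def)
  have scy: "strongly_convex_on my Y (\<lambda>y. - H (x, y))" if "x \<in> X" for x
    using cc that by (simp add: convex_concave_def)
  show "convex X" "convex Y"
    using scx scy XY by (auto simp: strongly_convex_on_def)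
  show "strongly_convex_on mx X (\<lambda>x. H (x, y))" if "y \<in> Y" for y by (rule scx[OF that])
  show "H (x, y') - H (x', y) \<le> saddle_operator G (x, y) \<bullet> ((x, y) - (x', y'))
      - mx / 2 * (norm (x - x'))\<^sup>2 - my / 2 * (norm (y - y'))\<^sup>2"
    if xy: "x \<in> X" "y \<in> Y" "x' \<in> X" "y' \<in> Y" for x y x' y'
  proof -
    have deriv: "(H has_derivative (\<lambda>h. G (x, y) \<bullet> h)) (at (x, y) within X \<times> Y)"
      using grad xy by (simp add: gradient_on_def)
    have segx: "x + t *\<^sub>R (x' - x) = (1 - t) *\<^sub>R x + t *\<^sub>R x'"
      and segy: "y + t *\<^sub>R (y' - y) = (1 - t) *\<^sub>R y + t *\<^sub>R y'" for t
      by (simp_all add: algebra_simps)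
    have "H (x, y) + G (x, y) \<bullet> ((x', y) - (x, y)) + mx / 2 * (norm (x - x'))\<^sup>2 \<le> H (x', y)"
      using scx[OF xy(2)] xy
      by (intro has_derivative_lower_bound[OF deriv])
        (auto simp: segx strongly_convex_on_def convex_alt mult_ac)
    moreover have "- H (x, y) + (- G (x, y)) \<bullet> ((x, y') - (x, y)) + my / 2 * (norm (y - y'))\<^sup>2 \<le> - H (x, y')"
      using scy[OF xy(1)] xy has_derivative_minus[OF deriv]
      by (intro has_derivative_lower_bound[of "\<lambda>z. - H z" _ _ "X \<times> Y"])
        (auto simp: segy strongly_convex_on_def convex_alt mult_ac)
    ultimately show ?thesis
      by (cases "G (x, y)") (simp add: saddle_operator_def inner_diff algebra_simps)
  qed
  show "norm (saddle_operator G z - saddle_operator G w) \<le> \<Lambda> * norm (z - w)"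
    if "z \<in> X \<times> Y" "w \<in> X \<times> Y" for z w
    using lip[OF that] by (simp add: saddle_operator_def norm_prod_def norm_minus_commute)
qed (use XY in auto)

section \<open>One step of the accelerated proximal point method\<close>

text \<open>The saddle point is a fixed point of the step, and \<tau> \<Lambda> \<le> 1 makes the
  step 2-Lipschitz. So z' is within 3 d of z, where d is the distance of z to the saddle point. The
  obtuse angle property bounds the residual with the operator at z by 3 d / \<tau>, and passing to
  the operator at z' costs another 3 d / \<tau>.\<close>

lemma (in saddle_problem) projected_step:
  assumes "z \<in> X \<times> Y" "0 < \<tau>" "\<tau> * \<Lambda> \<le> 1"
  defines "z' \<equiv> projection (X \<times> Y) (z - \<tau> *\<^sub>R A z)"
  shows "norm (z' - saddle) \<le> 2 * norm (z - saddle)"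
    and "w \<in> X \<times> Y \<Longrightarrow> A z' \<bullet> (z' - w) \<le> 6 / \<tau> * norm (z - saddle) * norm (z' - w)"
proof -
  let ?d = "norm (z - saddle)"
  note proj = XY
  have in_XY: "saddle \<in> X \<times> Y" "z' \<in> X \<times> Y"
    using saddle projection_in[OF proj] by (auto simp: z'_def)
  have fixpoint: "projection (X \<times> Y) (saddle - \<tau> *\<^sub>R A saddle) = saddle"
    using saddle \<open>0 < \<tau>\<close> by (intro projection_unique[OF proj]) auto
  have \<tau>\<Lambda>: "\<tau> * norm (A v - A w) \<le> norm (v - w)" if "v \<in> X \<times> Y" "w \<in> X \<times> Y" for v w
  proof -
    have "\<tau> * norm (A v - A w) \<le> \<tau> * (\<Lambda> * norm (v - w))"
      using lipschitz[OF that] \<open>0 < \<tau>\<close> by simp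
    also have "\<dots> \<le> 1 * norm (v - w)"
      using mult_right_mono[OF assms(3), of "norm (v - w)"] by (simp add: mult_ac)
    finally show ?thesis by simp
  qed
  have "norm (z' - saddle) \<le> norm ((z - \<tau> *\<^sub>R A z) - (saddle - \<tau> *\<^sub>R A saddle))"
    using projection_nonexpansive[OF proj, of "z - \<tau> *\<^sub>R A z" "saddle - \<tau> *\<^sub>R A saddle"]
    by (simp add: fixpoint z'_def)
  also have "(z - \<tau> *\<^sub>R A z) - (saddle - \<tau> *\<^sub>R A saddle) = (z - saddle) - \<tau> *\<^sub>R (A z - A saddle)"
    by (simp add: algebra_simps)
  also have "norm \<dots> \<le> ?d + \<tau> * norm (A z - A saddle)"
    using norm_triangle_ineq4[of "z - saddle" "\<tau> *\<^sub>R (A z - A saddle)"] \<open>0 < \<tau>\<close> by simp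
  also have "\<dots> \<le> 2 * ?d"
    using \<tau>\<Lambda>[OF assms(1) in_XY(1)] by simp
  finally show d2: "norm (z' - saddle) \<le> 2 * ?d" .
  have d3: "norm (z' - z) \<le> 3 * ?d"
    using d2 norm_triangle_ineq4[of "z' - saddle" "z - saddle"] by simp
  show "A z' \<bullet> (z' - w) \<le> 6 / \<tau> * ?d * norm (z' - w)" if w: "w \<in> X \<times> Y"
  proof -
    have "0 \<le> (z' - (z - \<tau> *\<^sub>R A z)) \<bullet> (w - z')"
      using projection_obtuse[OF proj w] by (simp add: z'_def)
    then have "\<tau> * (A z \<bullet> (z' - w)) \<le> (z' - z) \<bullet> (w - z')"
      by (simp add: inner_diff inner_add inner_commute algebra_simps)
    also have "\<dots> \<le> norm (z' - z) * norm (z' - w)"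
      using norm_cauchy_schwarz[of "z' - z" "w - z'"] by (simp add: norm_minus_commute)
    also have "\<dots> \<le> 3 * ?d * norm (z' - w)"
      using d3 by (intro mult_right_mono) auto
    finally have 1: "\<tau> * (A z \<bullet> (z' - w)) \<le> 3 * ?d * norm (z' - w)" .
    have "\<tau> * ((A z' - A z) \<bullet> (z' - w)) \<le> \<tau> * (norm (A z' - A z) * norm (z' - w))"
      using \<open>0 < \<tau>\<close> by (intro mult_left_mono norm_cauchy_schwarz) auto
    also have "\<dots> \<le> norm (z' - z) * norm (z' - w)"
      using mult_right_mono[OF \<tau>\<Lambda>[OF in_XY(2) assms(1)], of "norm (z' - w)"] by (simp add: mult_ac)
    also have "\<dots> \<le> 3 * ?d * norm (z' - w)"
      using d3 by (intro mult_right_mono) auto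
    finally have "\<tau> * (A z' \<bullet> (z' - w)) \<le> 6 * ?d * norm (z' - w)"
      using 1 by (simp add: inner_diff_left algebra_simps)
    then show ?thesis
      using \<open>0 < \<tau>\<close> by (simp add: field_simps)
  qed
qed

lemma weighted_norm_add_squared:
  fixes a b :: "'a::real_inner"
  assumes "0 \<le> s"
  shows "(norm (s *\<^sub>R a + b))\<^sup>2 \<le> (1 + s) * (s * (norm a)\<^sup>2 + (norm b)\<^sup>2)"
proof -
  have "(1 + s) * (s * (norm a)\<^sup>2 + (norm b)\<^sup>2) - (norm (s *\<^sub>R a + b))\<^sup>2 = s * (norm (a - b))\<^sup>2"
    unfolding power2_norm_eq_inner
    by (simp add: inner_diff inner_add inner_commute algebra_simps)
  then show ?thesis using assms by (smt (verit) mult_nonneg_nonneg zero_le_power2)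
qed

text \<open>A form of Young's inequality, read off the square of t a + (1 - t) b. It will trade the
  inexactness of a proximal step for part of the contraction rate.\<close>

lemma norm_diff_squared_lower:
  fixes a b :: "'a::real_inner"
  assumes "0 < t" "t < 1"
  shows "(1 - t) * (norm (a - b))\<^sup>2 - 1 / t * (norm b)\<^sup>2 \<le> (norm a)\<^sup>2"
proof -
  have "0 \<le> (norm (t *\<^sub>R (a - b) + b))\<^sup>2" by simp
  also have "\<dots> = t * (norm a)\<^sup>2 + (1 - t) * (norm b)\<^sup>2 - t * (1 - t) * (norm (a - b))\<^sup>2"
    unfolding power2_norm_eq_inner
    by (simp add: inner_diff inner_add inner_commute algebra_simps)
  also have "\<dots> \<le> t * (norm a)\<^sup>2 + 1 * (norm b)\<^sup>2 - t * (1 - t) * (norm (a - b))\<^sup>2"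
    using assms by (intro diff_right_mono add_left_mono mult_right_mono) auto
  finally have "t * ((1 - t) * (norm (a - b))\<^sup>2 - 1 / t * (norm b)\<^sup>2) \<le> t * (norm a)\<^sup>2"
    using assms by (simp add: algebra_simps)
  then show ?thesis using assms by (simp only: mult_le_cancel_left_pos)
qed

text \<open>The condition \<beta> \<le> my makes \<beta> a lower bound for both moduli of every
  proximal subproblem; \<kappa> measures how strongly the best response in y reacts to x.\<close>

locale accelerated_prox = saddle_problem +
  fixes \<beta> \<kappa> :: real
  assumes \<beta>: "0 < \<beta>" "\<beta> \<le> my"
    and mx_le_my: "mx \<le> my"
    and \<kappa>: "1 \<le> \<kappa>" "\<Lambda> \<le> \<kappa> * my"
begin

text \<open>This is the square root of the momentum parameter q. The identity (mx + \<beta>)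
  \<alpha>^2 = mx turns the quadratic term of the subproblem, taken at a point of the segment from x
  to \<open>xs\<close>, into the mx / 2 term of the Lyapunov function.\<close>

definition \<alpha> :: real where "\<alpha> = sqrt (mx / (mx + \<beta>))"

lemma \<alpha>: "0 < \<alpha>" "\<alpha> < 1" "\<alpha>\<^sup>2 = mx / (mx + \<beta>)"
  using mx \<beta> by (auto simp: \<alpha>_def)

text \<open>The Lyapunov function of Nesterov's method with the estimate sequence point \<open>v\<close>.\<close>

definition lyapunov :: "'a \<Rightarrow> 'a \<Rightarrow> real"
  where "lyapunov x v = primal x - primal xs + mx / 2 * (norm (v - xs))\<^sup>2"

lemma lyapunov_lower: "x \<in> X \<Longrightarrow> mx / 2 * ((norm (x - xs))\<^sup>2 + (norm (v - xs))\<^sup>2) \<le> lyapunov x v"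
  using primal_growth[of x] by (simp add: lyapunov_def distrib_left)

lemma lyapunov_nonneg: "x \<in> X \<Longrightarrow> 0 \<le> lyapunov x v"
  using lyapunov_lower[of x v] mx by (smt (verit) mult_nonneg_nonneg zero_le_power2 half_gt_zero)

definition prox_operator :: "'a \<Rightarrow> 'a \<times> 'b \<Rightarrow> 'a \<times> 'b"
  where "prox_operator u z = A z + (\<beta> *\<^sub>R (fst z - u), 0)"

definition next_x :: "'a \<Rightarrow> 'a \<times> 'b \<Rightarrow> real \<Rightarrow> 'a"
  where "next_x u z \<tau> = projection X (fst z - \<tau> *\<^sub>R fst (prox_operator u z))"

definition next_y :: "'a \<Rightarrow> 'a \<times> 'b \<Rightarrow> real \<Rightarrow> 'b"
  where "next_y u z \<tau> = projection Y (snd z - \<tau> *\<^sub>R snd (prox_operator u z))"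

context
  fixes u :: 'a
begin

interpretation P: saddle_problem X Y "add_prox (\<beta> / 2) u H" "prox_operator u" "mx + \<beta>" my "\<Lambda> + \<beta>"
  using saddle_problem_prox[of \<beta> u] \<beta> by (simp add: prox_operator_def[abs_def])

lemma prox_problem: "saddle_problem X Y (add_prox (\<beta> / 2) u H) (prox_operator u) (mx + \<beta>) my (\<Lambda> + \<beta>)"
  by unfold_locales

text \<open>The growth inequality of the subproblem is applied at the unregularised saddle point.
  There the values of \<open>H\<close> compare in the right direction by \<open>saddle_le\<close>,
  so only the quadratic terms with \<beta> remain.\<close>

lemma prox_xs_close: "(norm (P.xs - xs))\<^sup>2 \<le> (norm (u - xs))\<^sup>2"
proof -
  have "H (xs, P.ys) \<le> H (P.xs, ys)"
    using saddle_le[OF P.xs_in P.ys_in] .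
  moreover have "0 \<le> my / 2 * (norm (ys - P.ys))\<^sup>2" "0 \<le> \<beta> / 2 * (norm (P.xs - u))\<^sup>2"
    "0 \<le> mx / 2 * (norm (xs - P.xs))\<^sup>2"
    using my \<beta> mx by auto
  moreover have "(mx + \<beta>) / 2 * (norm (xs - P.xs))\<^sup>2 = mx / 2 * (norm (xs - P.xs))\<^sup>2 + \<beta> / 2 * (norm (xs - P.xs))\<^sup>2"
    by (simp add: algebra_simps)
  ultimately have "\<beta> / 2 * (norm (xs - P.xs))\<^sup>2 \<le> \<beta> / 2 * (norm (xs - u))\<^sup>2"
    using P.saddle_growth[OF xs_in ys_in] unfolding add_prox_def fst_conv by linarith
  then show ?thesis using \<beta> by (simp add: norm_minus_commute)
qed

text \<open>The proximal term does not involve y, so \<open>P.ys\<close> and \<open>ys\<close> are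
  the best responses in \<open>H\<close> to \<open>P.xs\<close> and \<open>xs\<close>. Subtracting
  their variational inequalities and playing strong concavity against the Lipschitz bound gives the
  factor \<kappa>.\<close>

lemma prox_ys_close: "(norm (P.ys - ys))\<^sup>2 \<le> \<kappa>\<^sup>2 * (norm (P.xs - xs))\<^sup>2"
proof -
  have inn: "P.xs \<in> X" "P.ys \<in> Y" "xs \<in> X" "ys \<in> Y"
    by (fact P.xs_in P.ys_in xs_in ys_in)+
  have "0 \<le> prox_operator u (P.xs, P.ys) \<bullet> ((P.xs, ys) - (P.xs, P.ys))"
    by (rule P.saddle_operator_nonneg) (simp_all add: inn)
  then have 1: "snd (A (P.xs, P.ys)) \<bullet> (P.ys - ys) \<le> 0"
    by (simp add: prox_operator_def inner_prod_def inner_diff)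
  have "0 \<le> A (xs, ys) \<bullet> ((xs, P.ys) - (xs, ys))"
    by (rule saddle_operator_nonneg) (simp_all add: inn)
  then have 2: "0 \<le> snd (A (xs, ys)) \<bullet> (P.ys - ys)"
    by (simp add: inner_prod_def)
  have "my * (norm (P.ys - ys))\<^sup>2 \<le> (A (P.xs, P.ys) - A (P.xs, ys)) \<bullet> ((P.xs, P.ys) - (P.xs, ys))"
    using monotone_operator[of P.xs P.ys P.xs ys] inn by simp
  also have "\<dots> = snd (A (P.xs, P.ys)) \<bullet> (P.ys - ys) - snd (A (P.xs, ys)) \<bullet> (P.ys - ys)"
    by (simp add: inner_prod_def inner_diff_left)
  also have "\<dots> \<le> snd (A (xs, ys) - A (P.xs, ys)) \<bullet> (P.ys - ys)"
    using 1 2 by (simp add: inner_diff_left)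
  also have "\<dots> \<le> norm (snd (A (xs, ys) - A (P.xs, ys))) * norm (P.ys - ys)"
    by (rule norm_cauchy_schwarz)
  also have "\<dots> \<le> (\<kappa> * my * norm (P.xs - xs)) * norm (P.ys - ys)"
  proof (rule mult_right_mono)
    have "norm (snd (A (xs, ys) - A (P.xs, ys))) \<le> norm (A (xs, ys) - A (P.xs, ys))"
      using norm_snd_le[of "snd (A (xs, ys) - A (P.xs, ys))" "fst (A (xs, ys) - A (P.xs, ys))"]
      by (simp del: fst_diff snd_diff)
    also have "\<dots> \<le> \<Lambda> * norm ((xs, ys) - (P.xs, ys))"
      by (rule lipschitz) (simp_all add: inn)
    also have "\<dots> = \<Lambda> * norm (P.xs - xs)"
      by (simp add: norm_prod_def norm_minus_commute)
    also have "\<dots> \<le> \<kappa> * my * norm (P.xs - xs)"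
      using \<kappa>(2) by (rule mult_right_mono) simp
    finally show "norm (snd (A (xs, ys) - A (P.xs, ys))) \<le> \<kappa> * my * norm (P.xs - xs)" .
  qed simp
  finally have "norm (P.ys - ys) * (my * norm (P.ys - ys)) \<le> norm (P.ys - ys) * (my * (\<kappa> * norm (P.xs - xs)))"
    by (simp add: power2_eq_square mult_ac)
  then have "norm (P.ys - ys) \<le> \<kappa> * norm (P.xs - xs)"
    using my \<kappa>(1) by (cases "norm (P.ys - ys) = 0") (simp_all add: mult_le_cancel_left_pos)
  then have "(norm (P.ys - ys))\<^sup>2 \<le> (\<kappa> * norm (P.xs - xs))\<^sup>2"
    by (intro power_mono) auto
  then show ?thesis by (simp add: power_mult_distrib)
qed

context
  fixes x v :: 'a and y :: 'b
  assumes xy: "x \<in> X" "y \<in> Y" and v: "(1 + \<alpha>) *\<^sub>R u = x + \<alpha> *\<^sub>R v"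
begin

text \<open>The relation assumed for \<open>v\<close> makes u a convex combination of x and v, and
  the Lyapunov function controls the distances of both to \<open>xs\<close>.\<close>

lemma extrapolation_close: "(norm (u - xs))\<^sup>2 \<le> 2 * (lyapunov x v / mx)"
proof -
  have "(1 + \<alpha>) *\<^sub>R (u - xs) = \<alpha> *\<^sub>R (v - xs) + (x - xs)"
    using v by (simp add: algebra_simps)
  then have "(1 + \<alpha>)\<^sup>2 * (norm (u - xs))\<^sup>2 = (norm (\<alpha> *\<^sub>R (v - xs) + (x - xs)))\<^sup>2"
    using \<alpha> by (metis norm_scaleR power2_abs power_mult_distrib)
  also have "\<dots> \<le> (1 + \<alpha>) * (\<alpha> * (norm (v - xs))\<^sup>2 + (norm (x - xs))\<^sup>2)"
    using \<alpha> by (intro weighted_norm_add_squared) auto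
  also have "\<dots> \<le> (1 + \<alpha>) * ((1 + \<alpha>) * ((norm (v - xs))\<^sup>2 + (norm (x - xs))\<^sup>2))"
    using \<alpha> by (intro mult_left_mono) (auto simp: distrib_right distrib_left)
  finally have "(norm (u - xs))\<^sup>2 \<le> (norm (v - xs))\<^sup>2 + (norm (x - xs))\<^sup>2"
    using \<alpha> by (simp add: power2_eq_square mult_le_cancel_left_pos mult.assoc)
  then have "mx * (norm (u - xs))\<^sup>2 \<le> mx * ((norm (v - xs))\<^sup>2 + (norm (x - xs))\<^sup>2)"
    using mx by simp
  then show ?thesis
    using lyapunov_lower[OF xy(1), of v] mx by (simp add: field_simps)
qed

lemma prox_xs_lyapunov: "(norm (P.xs - xs))\<^sup>2 \<le> 2 * (lyapunov x v / mx)"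
  by (rule order_trans[OF prox_xs_close extrapolation_close])

text \<open>This is the warm start error. Both coordinates are compared through
  \<open>(xs, ys)\<close>: x contributes 2 * 2 + 2 * 2, and the shift of the best response 2 * 2
  \<kappa>^2. The last term is the part that the Lyapunov function cannot see.\<close>

lemma prox_saddle_close:
  "(norm ((x, y) - P.saddle))\<^sup>2 \<le> (8 + 4 * \<kappa>\<^sup>2) * lyapunov x v / mx + 2 * (norm (y - ys))\<^sup>2"
proof -
  have x: "(norm (x - xs))\<^sup>2 \<le> 2 * (lyapunov x v / mx)"
  proof -
    have "mx / 2 * (norm (x - xs))\<^sup>2 \<le> mx / 2 * ((norm (x - xs))\<^sup>2 + (norm (v - xs))\<^sup>2)"
      using mx by (intro mult_left_mono) auto
    then have "mx / 2 * (norm (x - xs))\<^sup>2 \<le> lyapunov x v"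
      using lyapunov_lower[OF xy(1), of v] by linarith
    then show ?thesis using mx by (simp add: field_simps)
  qed
  have "(norm ((x, y) - P.saddle))\<^sup>2 = (norm (x - P.xs))\<^sup>2 + (norm (y - P.ys))\<^sup>2"
    by (simp add: P.saddle_eq norm_prod_def)
  also have "\<dots> \<le> (2 * (norm (x - xs))\<^sup>2 + 2 * (norm (P.xs - xs))\<^sup>2)
      + (2 * (norm (y - ys))\<^sup>2 + 2 * (norm (P.ys - ys))\<^sup>2)"
    by (intro add_mono) (metis norm_diff_squared_le norm_minus_commute)+
  also have "\<dots> \<le> (2 * (2 * (lyapunov x v / mx)) + 2 * (2 * (lyapunov x v / mx)))
      + (2 * (norm (y - ys))\<^sup>2 + 2 * (\<kappa>\<^sup>2 * (2 * (lyapunov x v / mx))))"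
    using x prox_xs_lyapunov
    by (intro add_mono mult_left_mono order_trans[OF prox_ys_close]) auto
  finally show ?thesis by (simp add: algebra_simps add_divide_distrib)
qed

context
  fixes zt :: "'a \<times> 'b" and \<tau> :: real
  assumes zt: "zt \<in> X \<times> Y" and \<tau>: "0 < \<tau>" "\<tau> * (\<Lambda> + \<beta>) \<le> 1"
begin

private abbreviation "nx \<equiv> next_x u zt \<tau>"
private abbreviation "ny \<equiv> next_y u zt \<tau>"

lemma next_point_eq: "projection (X \<times> Y) (zt - \<tau> *\<^sub>R prox_operator u zt) = (nx, ny)"
  using X Y by (simp add: projection_Times next_x_def next_y_def)

lemma next_in: "nx \<in> X" "ny \<in> Y"
  using X Y by (simp_all add: next_x_def next_y_def projection_in)

lemma next_close: "(norm (nx - P.xs))\<^sup>2 \<le> 4 * (norm (zt - P.saddle))\<^sup>2"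
  "(norm (ny - P.ys))\<^sup>2 \<le> 4 * (norm (zt - P.saddle))\<^sup>2"
proof -
  have "norm ((nx, ny) - P.saddle) \<le> 2 * norm (zt - P.saddle)"
    using P.projected_step(1)[OF zt \<tau>] by (simp add: next_point_eq)
  then have "(norm ((nx, ny) - P.saddle))\<^sup>2 \<le> (2 * norm (zt - P.saddle))\<^sup>2"
    by (intro power_mono) auto
  then have "(norm (nx - P.xs))\<^sup>2 + (norm (ny - P.ys))\<^sup>2 \<le> 4 * (norm (zt - P.saddle))\<^sup>2"
    by (simp add: P.saddle_eq norm_prod_def power_mult_distrib)
  then show "(norm (nx - P.xs))\<^sup>2 \<le> 4 * (norm (zt - P.saddle))\<^sup>2"
    "(norm (ny - P.ys))\<^sup>2 \<le> 4 * (norm (zt - P.saddle))\<^sup>2"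
    using zero_le_power2[of "norm (nx - P.xs)"] zero_le_power2[of "norm (ny - P.ys)"] by linarith+
qed

lemma next_residual:
  "w \<in> X \<Longrightarrow> w' \<in> Y \<Longrightarrow> prox_operator u (nx, ny) \<bullet> ((nx, ny) - (w, w'))
    \<le> 6 / \<tau> * norm (zt - P.saddle) * norm ((nx, ny) - (w, w'))"
  using P.projected_step(2)[OF zt \<tau>, of "(w, w')"] by (simp add: next_point_eq)

lemma next_ys_close: "(norm (ny - ys))\<^sup>2 \<le> 8 * (norm (zt - P.saddle))\<^sup>2 + 4 * \<kappa>\<^sup>2 * lyapunov x v / mx"
proof -
  have "(norm (ny - ys))\<^sup>2 \<le> 2 * (norm (ny - P.ys))\<^sup>2 + 2 * (norm (P.ys - ys))\<^sup>2"
    by (rule norm_diff_squared_le)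
  also have "\<dots> \<le> 2 * (4 * (norm (zt - P.saddle))\<^sup>2) + 2 * (\<kappa>\<^sup>2 * (2 * (lyapunov x v / mx)))"
    using prox_xs_lyapunov
    by (intro add_mono mult_left_mono order_trans[OF prox_ys_close] next_close) auto
  finally show ?thesis by simp
qed

text \<open>The gap is that of \<open>H\<close> itself. Its operator differs from the proximal one
  by \<beta> (nx - u), so the residual 6 d / \<tau> grows by \<beta> |nx - u|, where d is the
  distance of \<open>zt\<close> to the proximal saddle point; going through \<open>P.xs\<close> and
  \<open>xs\<close> bounds |nx - u|^2 by 8 d^2 plus 16 times the Lyapunov value over mx.\<close>

lemma next_gap:
  assumes "w \<in> X" "w' \<in> Y"
  shows "H (nx, w') - H (w, ny)
    \<le> ((36 / \<tau>\<^sup>2 + 8 * \<beta>\<^sup>2) * (norm (zt - P.saddle))\<^sup>2 + 16 * \<beta>\<^sup>2 * lyapunov x v / mx) / mx"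
proof -
  let ?d = "norm (zt - P.saddle)" and ?D = "norm ((nx, ny) - (w, w'))"
  have "(norm (nx - u))\<^sup>2 \<le> 2 * (norm (nx - P.xs))\<^sup>2 + 2 * (norm (P.xs - u))\<^sup>2"
    by (rule norm_diff_squared_le)
  moreover have "(norm (P.xs - u))\<^sup>2 \<le> 2 * (norm (P.xs - xs))\<^sup>2 + 2 * (norm (u - xs))\<^sup>2"
    by (metis norm_diff_squared_le norm_minus_commute)
  ultimately have xu: "(norm (nx - u))\<^sup>2 \<le> 8 * ?d\<^sup>2 + 16 * (lyapunov x v / mx)"
    using extrapolation_close prox_xs_lyapunov next_close(1) by linarith
  have "A (nx, ny) \<bullet> ((nx, ny) - (w, w'))
      = prox_operator u (nx, ny) \<bullet> ((nx, ny) - (w, w')) - \<beta> * ((nx - u) \<bullet> (nx - w))"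
    by (simp add: prox_operator_def inner_add_left)
  moreover have "- (\<beta> * ((nx - u) \<bullet> (nx - w))) \<le> \<beta> * (norm (nx - u) * ?D)"
  proof -
    have "- ((nx - u) \<bullet> (nx - w)) \<le> norm (nx - u) * norm (nx - w)"
      using norm_cauchy_schwarz[of "- (nx - u)" "nx - w"] by (simp only: inner_minus_left norm_minus_cancel)
    also have "\<dots> \<le> norm (nx - u) * ?D"
      using norm_fst_le[of "nx - w" "ny - w'"] by (intro mult_left_mono) auto
    finally show ?thesis using \<beta> mult_left_mono[of _ _ \<beta>] by fastforce
  qed
  ultimately have "A (nx, ny) \<bullet> ((nx, ny) - (w, w')) \<le> 6 / \<tau> * ?d * ?D + \<beta> * (norm (nx - u) * ?D)"
    using next_residual[OF assms] by linarith
  also have "\<dots> = (6 / \<tau> * ?d + \<beta> * norm (nx - u)) * ?D"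
    by (simp add: distrib_right)
  finally have "A (nx, ny) \<bullet> ((nx, ny) - (w, w')) \<le> (6 / \<tau> * ?d + \<beta> * norm (nx - u)) * ?D" .
  from gap_le_square[OF next_in assms mx order_refl mx_le_my this]
  have "H (nx, w') - H (w, ny) \<le> (6 / \<tau> * ?d + \<beta> * norm (nx - u))\<^sup>2 / (2 * mx)" .
  also have "\<dots> \<le> (2 * (6 / \<tau> * ?d)\<^sup>2 + 2 * (\<beta> * norm (nx - u))\<^sup>2) / (2 * mx)"
    using mx sum_squares_bound[of "6 / \<tau> * ?d" "\<beta> * norm (nx - u)"]
    by (intro divide_right_mono) (auto simp: power2_sum)
  also have "\<dots> = (36 / \<tau>\<^sup>2 * ?d\<^sup>2 + \<beta>\<^sup>2 * (norm (nx - u))\<^sup>2) / mx"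
    using mx by (simp add: field_simps power_mult_distrib)
  also have "\<dots> \<le> (36 / \<tau>\<^sup>2 * ?d\<^sup>2 + \<beta>\<^sup>2 * (8 * ?d\<^sup>2 + 16 * (lyapunov x v / mx))) / mx"
    using mx xu by (intro divide_right_mono add_left_mono mult_left_mono) auto
  finally show ?thesis by (simp add: algebra_simps)
qed

text \<open>Everything is tested at w = (1 - \<alpha>) x + \<alpha> xs. The growth of the subproblem
  bounds the new primal value by the one at w plus the difference of two quadratics: one is bounded
  by old Lyapunov terms, the other yields the new estimate term up to the inexactness of nx.\<close>

lemma lyapunov_step:
  assumes v': "\<alpha> *\<^sub>R (v' - x) = nx - x"
  shows "lyapunov nx v' \<le> (1 - \<alpha> / 2) * lyapunov x v + 108 / (\<alpha> * \<tau>\<^sup>2 * \<beta>) * (norm (zt - P.saddle))\<^sup>2"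
proof -
  let ?d = "norm (zt - P.saddle)"
  \<comment> \<open>The gap estimate with residual factor 6 |zt - P.saddle| / \<tau> and modulus
    \<beta>.\<close>
  define e where "e = 18 / (\<tau>\<^sup>2 * \<beta>) * ?d\<^sup>2"
  define w where "w = (1 - \<alpha>) *\<^sub>R x + \<alpha> *\<^sub>R xs"
  have e0: "0 \<le> e" using \<beta> by (simp add: e_def)
  have w_in: "w \<in> X"
    unfolding w_def using \<alpha> xs_in xy X(2) by (intro convexD) auto
  have gap: "add_prox (\<beta> / 2) u H (nx, b) - add_prox (\<beta> / 2) u H (a, ny) \<le> e"
    if "a \<in> X" "b \<in> Y" for a b
    using P.gap_le_square[OF next_in that \<beta>(1) _ \<beta>(2) next_residual[OF that]] mx
    by (simp add: e_def power_mult_distrib power_divide field_simps)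
  have next_x_close: "(mx + \<beta>) / 2 * (norm (nx - P.xs))\<^sup>2 \<le> e"
    using gap[OF P.xs_in P.ys_in] P.saddle_growth[OF next_in] my
      mult_nonneg_nonneg[of "my / 2" "(norm (ny - P.ys))\<^sup>2"] by (smt (verit) zero_le_power2 half_gt_zero)
  have "primal nx \<le> e + primal w + \<beta> / 2 * (norm (w - u))\<^sup>2 - (mx + \<beta>) / 2 * (norm (w - P.xs))\<^sup>2"
  proof (rule primal_least)
    fix b assume b: "b \<in> Y"
    have "0 \<le> my / 2 * (norm (ny - P.ys))\<^sup>2" "0 \<le> \<beta> / 2 * (norm (nx - u))\<^sup>2"
      using my \<beta> by auto
    then show "H (nx, b) \<le> e + primal w + \<beta> / 2 * (norm (w - u))\<^sup>2 - (mx + \<beta>) / 2 * (norm (w - P.xs))\<^sup>2"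
      using gap[OF P.xs_in b] P.saddle_growth[OF w_in next_in(2)] primal_upper[OF w_in P.ys_in]
      unfolding add_prox_def fst_conv by linarith
  qed
  also have "primal w \<le> (1 - \<alpha>) * primal x + \<alpha> * primal xs - mx / 2 * (\<alpha> * (1 - \<alpha>)) * (norm (x - xs))\<^sup>2"
    unfolding w_def using \<alpha> by (intro primal_strongly_convex xy xs_in) auto
  finally have 1: "primal nx \<le> e + ((1 - \<alpha>) * primal x + \<alpha> * primal xs
      - mx / 2 * (\<alpha> * (1 - \<alpha>)) * (norm (x - xs))\<^sup>2) + \<beta> / 2 * (norm (w - u))\<^sup>2
      - (mx + \<beta>) / 2 * (norm (w - P.xs))\<^sup>2"
    by simp
  have \<beta>_eq: "\<beta> * \<alpha>\<^sup>2 = mx * (1 - \<alpha>\<^sup>2)" and m_eq: "(mx + \<beta>) * \<alpha>\<^sup>2 = mx"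
    using mx \<beta> by (simp_all add: \<alpha>(3) field_simps)
  \<comment> \<open>Scaled by 1 + \<alpha>, the vector u - w is \<alpha> times \<alpha> (x - xs) +
    (v - xs). Convexity of the square costs one factor 1 + \<alpha>, and \<beta> \<alpha>^2 = mx (1
    - \<alpha>) (1 + \<alpha>) cancels the other. The term in x - xs will cancel against strong
    convexity of the primal function.\<close>
  have 2: "\<beta> / 2 * (norm (w - u))\<^sup>2 \<le> mx / 2 * (1 - \<alpha>) * (\<alpha> * (norm (x - xs))\<^sup>2 + (norm (v - xs))\<^sup>2)"
  proof -
    have "(1 + \<alpha>) *\<^sub>R (u - w) = x + \<alpha> *\<^sub>R v - (1 + \<alpha>) *\<^sub>R w"
      using v by (simp add: scaleR_diff_right)
    also have "\<dots> = \<alpha> *\<^sub>R (\<alpha> *\<^sub>R (x - xs) + (v - xs))"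
      by (simp add: w_def algebra_simps)
    finally have "(1 + \<alpha>)\<^sup>2 * (norm (u - w))\<^sup>2 = \<alpha>\<^sup>2 * (norm (\<alpha> *\<^sub>R (x - xs) + (v - xs)))\<^sup>2"
      using \<alpha> by (metis norm_scaleR power2_abs power_mult_distrib)
    also have "\<dots> \<le> \<alpha>\<^sup>2 * ((1 + \<alpha>) * (\<alpha> * (norm (x - xs))\<^sup>2 + (norm (v - xs))\<^sup>2))"
      using \<alpha>(1) by (intro mult_left_mono weighted_norm_add_squared) auto
    finally have "(1 + \<alpha>) * ((1 + \<alpha>) * (norm (u - w))\<^sup>2)
        \<le> (1 + \<alpha>) * (\<alpha>\<^sup>2 * (\<alpha> * (norm (x - xs))\<^sup>2 + (norm (v - xs))\<^sup>2))"
      by (simp add: power2_eq_square mult_ac)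
    then have "(1 + \<alpha>) * (norm (u - w))\<^sup>2 \<le> \<alpha>\<^sup>2 * (\<alpha> * (norm (x - xs))\<^sup>2 + (norm (v - xs))\<^sup>2)"
      using \<alpha> by (simp only: mult_le_cancel_left_pos)
    then have "\<beta> * ((1 + \<alpha>) * (norm (u - w))\<^sup>2) \<le> \<beta> * (\<alpha>\<^sup>2 * (\<alpha> * (norm (x - xs))\<^sup>2 + (norm (v - xs))\<^sup>2))"
      using \<beta> by simp
    also have "\<dots> = (1 + \<alpha>) * (mx * (1 - \<alpha>) * (\<alpha> * (norm (x - xs))\<^sup>2 + (norm (v - xs))\<^sup>2))"
    proof -
      have "mx * (1 - \<alpha>\<^sup>2) = (1 + \<alpha>) * (mx * (1 - \<alpha>))"
        by (simp add: algebra_simps power2_eq_square)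
      then show ?thesis by (simp add: \<beta>_eq flip: mult.assoc)
    qed
    finally have "(1 + \<alpha>) * (\<beta> * (norm (u - w))\<^sup>2)
        \<le> (1 + \<alpha>) * (mx * (1 - \<alpha>) * (\<alpha> * (norm (x - xs))\<^sup>2 + (norm (v - xs))\<^sup>2))"
      by (simp add: mult_ac)
    then have "\<beta> * (norm (u - w))\<^sup>2 \<le> mx * (1 - \<alpha>) * (\<alpha> * (norm (x - xs))\<^sup>2 + (norm (v - xs))\<^sup>2)"
      using \<alpha> by (simp only: mult_le_cancel_left_pos)
    then show ?thesis by (simp add: norm_minus_commute)
  qed
  \<comment> \<open>Since w - nx = \<alpha> (xs - v'), an exact proximal step would give the new
    estimate term in full. Young's inequality with parameter \<alpha> / 2 replaces
    \<open>P.xs\<close> by nx, at the price of 2 e / \<alpha> and half of the rate.\<close>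
  have 3: "(1 - \<alpha> / 2) * (mx / 2 * (norm (v' - xs))\<^sup>2) - 2 / \<alpha> * e
      \<le> (mx + \<beta>) / 2 * (norm (w - P.xs))\<^sup>2"
  proof -
    have "w - nx = \<alpha> *\<^sub>R (xs - x) - (nx - x)"
      by (simp add: w_def algebra_simps)
    also have "\<dots> = \<alpha> *\<^sub>R (xs - v')"
      by (simp add: algebra_simps flip: v')
    finally have "(norm (w - nx))\<^sup>2 = \<alpha>\<^sup>2 * (norm (v' - xs))\<^sup>2"
      by (simp add: power_mult_distrib norm_minus_commute)
    then have v'_eq: "(mx + \<beta>) / 2 * (norm (w - nx))\<^sup>2 = mx / 2 * (norm (v' - xs))\<^sup>2"
      using m_eq by (simp flip: mult.assoc)
    have "(1 - \<alpha> / 2) * (norm (w - nx))\<^sup>2 - 1 / (\<alpha> / 2) * (norm (nx - P.xs))\<^sup>2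
        \<le> (norm (w - P.xs))\<^sup>2"
      using norm_diff_squared_lower[of "\<alpha> / 2" "w - P.xs" "nx - P.xs"] \<alpha> by simp
    then have "(mx + \<beta>) / 2 * ((1 - \<alpha> / 2) * (norm (w - nx))\<^sup>2 - 1 / (\<alpha> / 2) * (norm (nx - P.xs))\<^sup>2)
        \<le> (mx + \<beta>) / 2 * (norm (w - P.xs))\<^sup>2"
      using mx \<beta> by (intro mult_left_mono) auto
    then have "(1 - \<alpha> / 2) * (mx / 2 * (norm (v' - xs))\<^sup>2)
        - 2 / \<alpha> * ((mx + \<beta>) / 2 * (norm (nx - P.xs))\<^sup>2) \<le> (mx + \<beta>) / 2 * (norm (w - P.xs))\<^sup>2"
      unfolding v'_eq[symmetric] by (simp add: right_diff_distrib mult_ac)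
    moreover have "2 / \<alpha> * ((mx + \<beta>) / 2 * (norm (nx - P.xs))\<^sup>2) \<le> 2 / \<alpha> * e"
      using next_x_close \<alpha> by (intro mult_left_mono) auto
    ultimately show ?thesis by linarith
  qed
  have "primal nx - primal xs + (1 - \<alpha> / 2) * (mx / 2 * (norm (v' - xs))\<^sup>2)
      \<le> e + 2 / \<alpha> * e + ((1 - \<alpha>) * primal x + \<alpha> * primal xs - primal xs
        - mx / 2 * (\<alpha> * (1 - \<alpha>)) * (norm (x - xs))\<^sup>2)
        + mx / 2 * (1 - \<alpha>) * (\<alpha> * (norm (x - xs))\<^sup>2 + (norm (v - xs))\<^sup>2)"
    using 1 2 3 by linarith
  also have "\<dots> = e + 2 / \<alpha> * e + (1 - \<alpha>) * lyapunov x v"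
    by (simp add: lyapunov_def field_simps)
  finally have 4: "primal nx - primal xs + (1 - \<alpha> / 2) * (mx / 2 * (norm (v' - xs))\<^sup>2)
      \<le> e + 2 / \<alpha> * e + (1 - \<alpha>) * lyapunov x v" .
  \<comment> \<open>The estimate term carries the factor 1 - \<alpha> / 2, so the primal gap is
    given it as well and the factor is divided out. This is affordable since 1 - \<alpha> \<le> (1 -
    \<alpha> / 2)^2 and 1 + 2 / \<alpha> \<le> (1 - \<alpha> / 2) 6 / \<alpha>; hence 108 = 6 *
    18.\<close>
  have "(1 - \<alpha> / 2) * (primal nx - primal xs) \<le> 1 * (primal nx - primal xs)"
    using primal_growth[OF next_in(1)] mx \<alpha> by (intro mult_right_mono) (auto intro: order_trans[rotated])
  with 4 have "(1 - \<alpha> / 2) * lyapunov nx v' \<le> e + 2 / \<alpha> * e + (1 - \<alpha>) * lyapunov x v"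
    by (simp add: lyapunov_def distrib_left)
  also have "\<dots> \<le> (1 - \<alpha> / 2) * (6 / \<alpha> * e) + (1 - \<alpha> / 2) * ((1 - \<alpha> / 2) * lyapunov x v)"
  proof (rule add_mono)
    have "1 + 2 / \<alpha> \<le> (1 - \<alpha> / 2) * (6 / \<alpha>)"
      using \<alpha> by (simp add: field_simps)
    then show "e + 2 / \<alpha> * e \<le> (1 - \<alpha> / 2) * (6 / \<alpha> * e)"
      using mult_right_mono[of "1 + 2 / \<alpha>" "(1 - \<alpha> / 2) * (6 / \<alpha>)" e] e0
      by (simp only: distrib_right mult_1_left mult.assoc)
    have "1 - \<alpha> \<le> (1 - \<alpha> / 2) * (1 - \<alpha> / 2)"
      by (simp add: algebra_simps)
    then show "(1 - \<alpha>) * lyapunov x v \<le> (1 - \<alpha> / 2) * ((1 - \<alpha> / 2) * lyapunov x v)"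
      using mult_right_mono[of "1 - \<alpha>" "(1 - \<alpha> / 2) * (1 - \<alpha> / 2)" "lyapunov x v"]
        lyapunov_nonneg[OF xy(1)] by (simp add: mult_ac)
  qed
  finally have "lyapunov nx v' \<le> 6 / \<alpha> * e + (1 - \<alpha> / 2) * lyapunov x v"
    using \<alpha> by (simp only: mult_le_cancel_left_pos flip: distrib_left)
  then show ?thesis by (simp add: e_def mult_ac)
qed

end

end

end

end

section \<open>Convergence of AL-SVRE\<close>

text \<open>The crude bound |a + b|^2 \<le> 2 |a|^2 + 2 |b|^2 doubles the constant. It is applied
  once for the regulariser and once for the proximal term.\<close>

lemma average_smooth_add_prox_grad:
  assumes "average_smooth n L S G" "0 \<le> c" "2 * c \<le> L" "n \<ge> 1"
  shows "average_smooth n (2 * L) S (\<lambda>i. add_prox_grad c u (G i))"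
  unfolding average_smooth_def
proof (intro ballI)
  fix z w assume zw: "z \<in> S" "w \<in> S"
  let ?F = "\<lambda>i. add_prox_grad c u (G i)"
  have "(norm (?F i z - ?F i w))\<^sup>2 \<le> 2 * (norm (G i z - G i w))\<^sup>2 + 2 * (L\<^sup>2 * (norm (z - w))\<^sup>2)" for i
  proof -
    let ?b = "((2 * c) *\<^sub>R fst (z - w), 0) :: 'a \<times> 'b"
    have "norm ?b = 2 * c * norm (fst (z - w))"
      using assms(2) by (simp add: norm_prod_def)
    also have "\<dots> \<le> L * norm (z - w)"
      using assms norm_fst_le[of "fst (z - w)" "snd (z - w)"] by (intro mult_mono) (auto simp del: fst_diff snd_diff)
    finally have b: "(norm ?b)\<^sup>2 \<le> L\<^sup>2 * (norm (z - w))\<^sup>2"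
      by (metis norm_ge_zero power_mono power_mult_distrib)
    have "?F i z - ?F i w = (G i z - G i w) - - ?b"
      by (simp add: add_prox_grad_def prod_eq_iff algebra_simps)
    then have "(norm (?F i z - ?F i w))\<^sup>2 \<le> 2 * (norm (G i z - G i w))\<^sup>2 + 2 * (norm ?b)\<^sup>2"
      using norm_diff_squared_le[of "G i z - G i w" "- ?b" 0] by simp
    with b show ?thesis by linarith
  qed
  then have "(\<Sum>i<n. (norm (?F i z - ?F i w))\<^sup>2)
      \<le> (\<Sum>i<n. 2 * (norm (G i z - G i w))\<^sup>2 + 2 * (L\<^sup>2 * (norm (z - w))\<^sup>2))"
    by (rule sum_mono)
  also have "\<dots> = 2 * (\<Sum>i<n. (norm (G i z - G i w))\<^sup>2) + n * (2 * (L\<^sup>2 * (norm (z - w))\<^sup>2))"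
    by (simp add: sum.distrib sum_distrib_left)
  also have "\<dots> \<le> 2 * (n * (L\<^sup>2 * (norm (z - w))\<^sup>2)) + n * (2 * (L\<^sup>2 * (norm (z - w))\<^sup>2))"
    using assms(1,4) zw by (auto simp: average_smooth_def field_simps)
  finally show "(\<Sum>i<n. (norm (?F i z - ?F i w))\<^sup>2) / real n \<le> (2 * L)\<^sup>2 * (norm (z - w))\<^sup>2"
    using assms(4) by (simp add: field_simps power_mult_distrib)
qed

lemma average_add_prox_grad:
  "n \<ge> 1 \<Longrightarrow> average n (\<lambda>i. add_prox_grad c u (G i)) = add_prox_grad c u (average n G)"
  by (simp add: fun_eq_iff average_def add_prox_grad_def sum.distrib sum_constant_scaleR scaleR_add_right
      prod_eq_iff fst_sum snd_sum)

lemma norm_average_diff_le: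
  assumes "average_smooth n L S G" "z \<in> S" "w \<in> S" "0 \<le> L"
  shows "norm (average n G z - average n G w) \<le> L * norm (z - w)"
proof (cases "n = 0")
  case False
  have "(norm (\<Sum>i<n. G i z - G i w))\<^sup>2 \<le> (\<Sum>i<n. norm (G i z - G i w))\<^sup>2"
    by (intro power_mono norm_sum) auto
  also have "\<dots> \<le> n * (\<Sum>i<n. (norm (G i z - G i w))\<^sup>2)"
    using sum_squared_le_sum_of_squares[of "\<lambda>i. norm (G i z - G i w)" "{..<n}"] by (simp add: mult.commute)
  also have "\<dots> \<le> n * (n * (L\<^sup>2 * (norm (z - w))\<^sup>2))"
    using assms False by (intro mult_left_mono) (auto simp: average_smooth_def field_simps)
  finally have "(norm (\<Sum>i<n. G i z - G i w))\<^sup>2 \<le> (n * (L * norm (z - w)))\<^sup>2"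
    by (simp add: power_mult_distrib power2_eq_square mult_ac)
  then have "norm (\<Sum>i<n. G i z - G i w) \<le> n * (L * norm (z - w))"
    by (rule power2_le_imp_le) (simp add: assms(4))
  moreover have "average n G z - average n G w = (1 / n) *\<^sub>R (\<Sum>i<n. G i z - G i w)"
    by (simp add: average_def sum_subtractf scaleR_diff_right)
  ultimately show ?thesis using False by (simp add: field_simps)
qed (use assms in \<open>simp add: average_def\<close>)

text \<open>The bound on \<tau> has 2 L because L-SVRE runs on proximal components; the rate r is
  governed by \<beta>, which bounds both moduli of the subproblem from below.\<close>

locale al_svre_problem = accelerated_prox X Y H A mx my L \<beta> \<kappa>
  for X :: "'a::real_inner set" and Y :: "'b::real_inner set" and H A mx my L \<beta> \<kappa> +
  fixes n :: nat and G :: "nat \<Rightarrow> 'a \<times> 'b \<Rightarrow> 'a \<times> 'b" and p \<tau> r :: real and T :: nat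
  assumes A_eq: "A = saddle_operator (average n G)"
    and n: "n \<ge> 1"
    and smooth: "average_smooth n L (X \<times> Y) G"
    and \<beta>_le: "\<beta> \<le> L"
    and p: "0 < p" "p \<le> 1/2"
    and \<tau>: "0 < \<tau>" "\<tau>\<^sup>2 * (2 * L)\<^sup>2 \<le> p / 2"
    and r: "r \<le> p / 4" "r \<le> \<tau> * \<beta> / 2"
begin

text \<open>The update of y feeds 4 \<kappa>^2 / mx times the Lyapunov value back into the y-term.
  With this weight that amounts to \<alpha> / 4, half of what Nesterov's step gains.\<close>

definition \<eta> :: real where "\<eta> = \<alpha> * mx / (16 * \<kappa>\<^sup>2)"

text \<open>The total coefficient of the squared L-SVRE error in one round: the first summand enters
  through the Lyapunov step, the second through the new y.\<close>

definition Q :: real where "Q = 108 / (\<alpha> * \<tau>\<^sup>2 * \<beta>) + 8 * \<eta>"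

lemma \<eta>: "0 < \<eta>" and Q: "0 < Q"
  using \<alpha> mx \<kappa> \<tau> \<beta> by (auto simp: \<eta>_def Q_def intro!: add_pos_pos)

lemma L_pos: "0 < L"
  using \<beta> \<beta>_le by simp

lemma \<tau>L: "\<tau> * (L + \<beta>) \<le> 1"
proof -
  have "(\<tau> * (2 * L))\<^sup>2 \<le> 1\<^sup>2"
    using \<tau>(2) p by (simp add: power_mult_distrib)
  then have "\<tau> * (2 * L) \<le> 1" by (rule power2_le_imp_le) simp
  moreover have "\<tau> * (L + \<beta>) \<le> \<tau> * (2 * L)"
    using \<tau> \<beta>_le by (intro mult_left_mono) auto
  ultimately show ?thesis by simp
qed

text \<open>The algorithm stores only the extrapolated point u; the estimate sequence point is
  recovered by solving \<open>(1 + \<alpha>) *\<^sub>R u = x + \<alpha> *\<^sub>R v\<close> for v.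
  At the start u = x gives v = x.\<close>

definition estimate :: "'a \<Rightarrow> 'a \<Rightarrow> 'a"
  where "estimate x u = (1 / \<alpha>) *\<^sub>R ((1 + \<alpha>) *\<^sub>R u - x)"

lemma estimate: "(1 + \<alpha>) *\<^sub>R u = x + \<alpha> *\<^sub>R estimate x u"
  using \<alpha> by (simp add: estimate_def)

text \<open>The term in \<open>y\<close> is needed since the warm start of the next L-SVRE run is measured in both
  variables, while Nesterov's Lyapunov function controls only \<open>x\<close>.\<close>

definition W :: "'a \<times> 'b \<times> 'a \<times> nat \<Rightarrow> real"
  where "W = (\<lambda>(x, y, u, c). lyapunov x (estimate x u) + \<eta> * (norm (y - ys))\<^sup>2)"

definition prox_components :: "'a \<Rightarrow> nat \<Rightarrow> 'a \<times> 'b \<Rightarrow> 'a \<times> 'b"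
  where "prox_components u i = add_prox_grad (\<beta> / 2) u (G i)"

definition inner_run :: "'a \<times> 'b \<times> 'a \<times> nat \<Rightarrow> (('a \<times> 'b) \<times> nat) pmf"
  where "inner_run = (\<lambda>(x, y, u, c). lsvre n (X \<times> Y) (prox_components u) (x, y) \<tau> p T)"

definition next_state :: "'a \<times> 'b \<times> 'a \<times> nat \<Rightarrow> ('a \<times> 'b) \<times> nat \<Rightarrow> 'a \<times> 'b \<times> 'a \<times> nat"
  where "next_state = (\<lambda>(x, y, u, c) (zt, c').
    (next_x u zt \<tau>, next_y u zt \<tau>,
     next_x u zt \<tau> + ((1 - \<alpha>) / (1 + \<alpha>)) *\<^sub>R (next_x u zt \<tau> - x), c + c' + n))"

definition prox_saddle :: "'a \<Rightarrow> 'a \<times> 'b"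
  where "prox_saddle u = saddle_problem.saddle X Y (prox_operator u)"

lemma saddle_operator_prox: "saddle_operator (average n (prox_components u)) = prox_operator u"
proof
  fix z
  have "saddle_operator (average n (prox_components u)) z = A z + (\<beta> *\<^sub>R (fst z - u), 0)"
    using n by (simp add: A_eq prox_components_def[abs_def] average_add_prox_grad add_prox_grad_def saddle_operator_def)
  then show "saddle_operator (average n (prox_components u)) z = prox_operator u z"
    by (simp add: prox_operator_def)
qed

lemma set_inner_run:
  assumes "x \<in> X" "y \<in> Y" "(zt, c') \<in> set_pmf (inner_run (x, y, u, c))"
  shows "zt \<in> X \<times> Y"
proof -
  obtain w new where "(zt, w, new, c') \<in> set_pmf (lsvre_iter n (X \<times> Y) (prox_components u) (x, y) \<tau> p T)"
    using assms(3) by (auto simp: inner_run_def lsvre_def)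
  then show ?thesis
    using set_lsvre_iter[OF XY(1,2) _ n] assms(1,2) by blast
qed

lemma finite_inner_run: "finite (set_pmf (inner_run s))"
  by (cases s) (simp add: inner_run_def lsvre_def finite_lsvre_iter[OF n])

lemma inner_run_distance:
  assumes "x \<in> X" "y \<in> Y"
  shows "measure_pmf.expectation (inner_run (x, y, u, c)) (\<lambda>(z, c). (norm (z - prox_saddle u))\<^sup>2)
    \<le> 4 * (1 - r) ^ T * (norm ((x, y) - prox_saddle u))\<^sup>2"
proof -
  interpret P: saddle_problem X Y "add_prox (\<beta> / 2) u H" "prox_operator u" "mx + \<beta>" my "L + \<beta>"
    by (rule prox_problem)
  interpret lsvre_problem n "X \<times> Y" "prox_components u" \<beta> "2 * L" \<tau> p P.saddle
  proof unfold_locales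
    show "average_smooth n (2 * L) (X \<times> Y) (prox_components u)"
      unfolding prox_components_def[abs_def]
      using \<beta> \<beta>_le by (intro average_smooth_add_prox_grad smooth n) auto
    show "\<beta> * (norm (z - P.saddle))\<^sup>2 \<le> saddle_operator (average n (prox_components u)) z \<bullet> (z - P.saddle)"
      if "z \<in> X \<times> Y" for z
    proof -
      have "\<beta> * (norm (z - P.saddle))\<^sup>2 \<le> (prox_operator u z - prox_operator u P.saddle) \<bullet> (z - P.saddle)"
        using mx \<beta> P.saddle that by (intro P.strongly_monotone_operator) auto
      moreover have "0 \<le> prox_operator u P.saddle \<bullet> (z - P.saddle)"
        using P.saddle that by blast
      ultimately show ?thesis
        unfolding saddle_operator_prox inner_diff_left by linarith
    qed
  qed (use XY n \<beta> p \<tau> P.saddle in auto)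
  show ?thesis
    unfolding inner_run_def prox_saddle_def using lsvre_distance[OF r, of "(x, y)" T] assms by simp
qed

lemma Q_accuracy: "Q * (\<alpha> * mx / (96 * \<kappa>\<^sup>2 * Q)) = \<alpha> * mx / (96 * \<kappa>\<^sup>2)"
  and Q_lower: "44 / \<tau>\<^sup>2 \<le> Q * \<beta>"
proof -
  show "Q * (\<alpha> * mx / (96 * \<kappa>\<^sup>2 * Q)) = \<alpha> * mx / (96 * \<kappa>\<^sup>2)"
    using Q by simp
  have "44 / \<tau>\<^sup>2 \<le> 108 / \<tau>\<^sup>2 / \<alpha>"
    using \<alpha> \<tau> by (simp add: field_simps)
  also have "\<dots> = 108 / (\<alpha> * \<tau>\<^sup>2 * \<beta>) * \<beta>"
    using \<beta> by simp
  also have "\<dots> \<le> Q * \<beta>"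
    unfolding Q_def using \<eta> \<beta> by (intro mult_right_mono) auto
  finally show "44 / \<tau>\<^sup>2 \<le> Q * \<beta>" .
qed

context
  assumes T: "4 * (1 - r) ^ T \<le> \<alpha> * mx / (96 * \<kappa>\<^sup>2 * Q)"
begin

text \<open>The accuracy in \<open>T\<close> is tuned to the warm start: with 8 + 4 \<kappa>^2 \<le>
  12 \<kappa>^2 the x part becomes exactly \<alpha> / 8, and the y part \<eta> / 3, rounded up to
  \<eta> / 2.\<close>

lemma inner_run_distance_lyapunov:
  assumes "x \<in> X" "y \<in> Y"
  shows "Q * measure_pmf.expectation (inner_run (x, y, u, c)) (\<lambda>(z, c). (norm (z - prox_saddle u))\<^sup>2)
    \<le> \<alpha> / 8 * lyapunov x (estimate x u) + \<eta> / 2 * (norm (y - ys))\<^sup>2"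
proof -
  let ?V = "lyapunov x (estimate x u)" and ?q = "\<alpha> * mx / (96 * \<kappa>\<^sup>2 * Q)"
  have q: "0 \<le> ?q" using \<alpha> mx Q by simp
  have V: "0 \<le> ?V" using lyapunov_nonneg[OF assms(1)] .
  have "measure_pmf.expectation (inner_run (x, y, u, c)) (\<lambda>(z, c). (norm (z - prox_saddle u))\<^sup>2)
      \<le> 4 * (1 - r) ^ T * (norm ((x, y) - prox_saddle u))\<^sup>2"
    by (rule inner_run_distance[OF assms])
  also have "\<dots> \<le> ?q * (norm ((x, y) - prox_saddle u))\<^sup>2"
    using T by (intro mult_right_mono) auto
  also have "\<dots> \<le> ?q * ((8 + 4 * \<kappa>\<^sup>2) * ?V / mx + 2 * (norm (y - ys))\<^sup>2)"
    using prox_saddle_close[OF assms estimate] q by (intro mult_left_mono) (auto simp: prox_saddle_def)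
  also have "\<dots> \<le> ?q * (12 * \<kappa>\<^sup>2 * ?V / mx + 2 * (norm (y - ys))\<^sup>2)"
    using \<kappa> mx V q by (intro mult_left_mono add_right_mono divide_right_mono mult_right_mono)
      (auto simp: one_le_power)
  finally have "Q * measure_pmf.expectation (inner_run (x, y, u, c)) (\<lambda>(z, c). (norm (z - prox_saddle u))\<^sup>2)
      \<le> Q * (?q * (12 * \<kappa>\<^sup>2 * ?V / mx + 2 * (norm (y - ys))\<^sup>2))"
    using Q by (intro mult_left_mono) auto
  also have "\<dots> = \<alpha> * mx / (96 * \<kappa>\<^sup>2) * (12 * \<kappa>\<^sup>2 * ?V / mx + 2 * (norm (y - ys))\<^sup>2)"
    by (simp only: mult.assoc flip: Q_accuracy)
  also have "\<dots> = \<alpha> / 8 * ?V + \<eta> / 3 * (norm (y - ys))\<^sup>2"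
    using \<kappa> mx by (simp add: \<eta>_def field_simps)
  also have "\<dots> \<le> \<alpha> / 8 * ?V + \<eta> / 2 * (norm (y - ys))\<^sup>2"
    using \<eta> by (intro add_left_mono mult_right_mono) auto
  finally show ?thesis .
qed

text \<open>The budget is 1 - \<alpha> / 2 from Nesterov's step, + \<alpha> / 4 from the new y and +
  \<alpha> / 8 from the L-SVRE error. The old y enters only through the warm start, so its weight
  drops to one half.\<close>

lemma W_step:
  assumes "x \<in> X" "y \<in> Y"
  shows "measure_pmf.expectation (inner_run (x, y, u, c)) (\<lambda>t. W (next_state (x, y, u, c) t))
    \<le> (1 - \<alpha> / 8) * W (x, y, u, c)"
proof -
  let ?V = "lyapunov x (estimate x u)" and ?Y = "(norm (y - ys))\<^sup>2"
  let ?d = "\<lambda>(z, c :: nat). (norm (z - prox_saddle u))\<^sup>2"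
  let ?c = "(1 - \<alpha> / 2) * ?V + \<eta> * (4 * \<kappa>\<^sup>2 * ?V / mx)"
  have "measure_pmf.expectation (inner_run (x, y, u, c)) (\<lambda>t. W (next_state (x, y, u, c) t))
      \<le> measure_pmf.expectation (inner_run (x, y, u, c)) (\<lambda>t. ?c + Q * ?d t)"
  proof (rule expectation_mono_finite[OF finite_inner_run])
    fix t assume "t \<in> set_pmf (inner_run (x, y, u, c))"
    then obtain zt c' where t: "t = (zt, c')" "zt \<in> X \<times> Y"
      using set_inner_run[OF assms] by (cases t) blast
    let ?x = "next_x u zt \<tau>" and ?u = "next_x u zt \<tau> + ((1 - \<alpha>) / (1 + \<alpha>)) *\<^sub>R (next_x u zt \<tau> - x)"
    \<comment> \<open>The extrapolation factor (1 - \<alpha>) / (1 + \<alpha>) is exactly the one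
      for which the new estimate point is x + (x' - x) / \<alpha>, as \<open>lyapunov_step\<close>
      requires.\<close>
    have "(1 + \<alpha>) *\<^sub>R ?u = (1 + \<alpha>) *\<^sub>R ?x + (1 - \<alpha>) *\<^sub>R (?x - x)"
      using \<alpha> by (simp add: scaleR_add_right)
    then have "\<alpha> *\<^sub>R (estimate ?x ?u - x) = ?x - x"
      using \<alpha>(1) by (simp add: estimate_def algebra_simps)
    from lyapunov_step[OF assms estimate t(2) \<tau>(1) \<tau>L this]
    have "lyapunov ?x (estimate ?x ?u) \<le> (1 - \<alpha> / 2) * ?V
        + 108 / (\<alpha> * \<tau>\<^sup>2 * \<beta>) * (norm (zt - prox_saddle u))\<^sup>2"
      by (simp add: prox_saddle_def)
    moreover have "\<eta> * (norm (next_y u zt \<tau> - ys))\<^sup>2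
        \<le> \<eta> * (8 * (norm (zt - prox_saddle u))\<^sup>2 + 4 * \<kappa>\<^sup>2 * ?V / mx)"
      using next_ys_close[OF assms estimate t(2) \<tau>(1) \<tau>L] \<eta>
      by (intro mult_left_mono) (auto simp: prox_saddle_def)
    ultimately show "W (next_state (x, y, u, c) t) \<le> ?c + Q * ?d t"
      by (simp add: t W_def next_state_def Q_def distrib_left distrib_right)
  qed
  also have "\<dots> = ?c + Q * measure_pmf.expectation (inner_run (x, y, u, c)) ?d"
    by (subst Bochner_Integration.integral_add)
      (simp_all add: integrable_measure_pmf_finite finite_inner_run case_prod_unfold)
  also have "\<dots> \<le> ?c + (\<alpha> / 8 * ?V + \<eta> / 2 * ?Y)"
    using inner_run_distance_lyapunov[OF assms] by (rule add_left_mono)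
  also have "\<dots> = (1 - \<alpha> / 8) * ?V + \<eta> / 2 * ?Y"
    using \<kappa> mx by (simp add: \<eta>_def field_simps)
  also have "\<dots> \<le> (1 - \<alpha> / 8) * ?V + (1 - \<alpha> / 8) * (\<eta> * ?Y)"
  proof -
    have "1 / 2 * (\<eta> * ?Y) \<le> (1 - \<alpha> / 8) * (\<eta> * ?Y)"
      using \<alpha> \<eta> by (intro mult_right_mono) auto
    then show ?thesis by simp
  qed
  finally show ?thesis by (simp add: W_def distrib_left)
qed

text \<open>\<open>W\<close> contains primal values and distances but no dual value; the projected
  step, whose residual is small, supplies the duality gap. The bound is therefore by
  \<open>W\<close> before the round, and the \<open>Suc\<close> in \<open>outer_choice\<close> pays
  for this shift.\<close>

lemma gap_step:
  assumes "x \<in> X" "y \<in> Y"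
  shows "measure_pmf.expectation (inner_run (x, y, u, c))
      (\<lambda>t. (\<lambda>(x, y, _). duality_gap X Y H (x, y)) (next_state (x, y, u, c) t))
    \<le> \<beta> / mx * (1 + 16 * (\<beta> / mx)) * W (x, y, u, c)"
proof -
  let ?V = "lyapunov x (estimate x u)" and ?Y = "(norm (y - ys))\<^sup>2"
  let ?d = "\<lambda>(z, c :: nat). (norm (z - prox_saddle u))\<^sup>2"
  let ?c = "16 * \<beta>\<^sup>2 * ?V / mx / mx"
  have V: "0 \<le> ?V" using lyapunov_nonneg[OF assms(1)] .
  \<comment> \<open>As \<beta> \<tau> \<le> 1, the 8 \<beta>^2 is at most 8 / \<tau>^2, whence the
    44 = 36 + 8 in \<open>Q_lower\<close>. The L-SVRE error is thus covered by the budget already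
    set for \<open>W\<close>.\<close>
  have b: "(36 / \<tau>\<^sup>2 + 8 * \<beta>\<^sup>2) / mx \<le> Q * (\<beta> / mx)"
  proof -
    have "\<beta> * \<tau> \<le> 1"
      using \<tau>L L_pos \<tau> by (simp add: algebra_simps) (smt (verit) mult_pos_pos)
    then have "(\<beta> * \<tau>)\<^sup>2 \<le> 1"
      using \<beta> \<tau> by (simp add: power_le_one)
    then have "8 * \<beta>\<^sup>2 \<le> 8 / \<tau>\<^sup>2"
      using \<tau> by (simp add: field_simps power_mult_distrib)
    then have "36 / \<tau>\<^sup>2 + 8 * \<beta>\<^sup>2 \<le> 44 / \<tau>\<^sup>2" by simp
    then have "36 / \<tau>\<^sup>2 + 8 * \<beta>\<^sup>2 \<le> Q * \<beta>" using Q_lower by linarith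
    then show ?thesis using mx by (simp add: divide_right_mono)
  qed
  have "measure_pmf.expectation (inner_run (x, y, u, c))
      (\<lambda>t. (\<lambda>(x, y, _). duality_gap X Y H (x, y)) (next_state (x, y, u, c) t))
      \<le> measure_pmf.expectation (inner_run (x, y, u, c)) (\<lambda>t. ?c + (Q * (\<beta> / mx)) * ?d t)"
  proof (rule expectation_mono_finite[OF finite_inner_run])
    fix t assume "t \<in> set_pmf (inner_run (x, y, u, c))"
    then obtain zt c' where t: "t = (zt, c')" "zt \<in> X \<times> Y"
      using set_inner_run[OF assms] by (cases t) blast
    let ?D = "(norm (zt - prox_saddle u))\<^sup>2"
    have "duality_gap X Y H (next_x u zt \<tau>, next_y u zt \<tau>)
        \<le> ((36 / \<tau>\<^sup>2 + 8 * \<beta>\<^sup>2) * ?D + 16 * \<beta>\<^sup>2 * ?V / mx) / mx"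
      using next_gap[OF assms estimate t(2) \<tau>(1) \<tau>L] X Y
      by (intro duality_gap_le) (auto simp: prox_saddle_def)
    also have "\<dots> = (36 / \<tau>\<^sup>2 + 8 * \<beta>\<^sup>2) / mx * ?D + ?c"
      by (subst add_divide_distrib) simp
    also have "\<dots> \<le> Q * (\<beta> / mx) * ?D + ?c"
      using b by (intro add_right_mono mult_right_mono) auto
    finally show "(\<lambda>(x, y, _). duality_gap X Y H (x, y)) (next_state (x, y, u, c) t)
        \<le> ?c + (Q * (\<beta> / mx)) * ?d t"
      by (simp add: t next_state_def)
  qed
  also have "\<dots> = ?c + \<beta> / mx * (Q * measure_pmf.expectation (inner_run (x, y, u, c)) ?d)"
    by (subst Bochner_Integration.integral_add)
      (simp_all add: integrable_measure_pmf_finite finite_inner_run case_prod_unfold)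
  also have "\<dots> \<le> ?c + \<beta> / mx * (\<alpha> / 8 * ?V + \<eta> / 2 * ?Y)"
    using inner_run_distance_lyapunov[OF assms] \<beta> mx by (intro add_left_mono mult_left_mono) auto
  also have "\<dots> \<le> 16 * (\<beta> / mx)\<^sup>2 * W (x, y, u, c) + \<beta> / mx * W (x, y, u, c)"
  proof (rule add_mono)
    have "?c = 16 * (\<beta> / mx)\<^sup>2 * ?V"
      by (simp add: power_divide power2_eq_square)
    also have "\<dots> \<le> 16 * (\<beta> / mx)\<^sup>2 * W (x, y, u, c)"
      using \<eta> by (intro mult_left_mono) (auto simp: W_def)
    finally show "?c \<le> 16 * (\<beta> / mx)\<^sup>2 * W (x, y, u, c)" .
    have "\<alpha> / 8 * ?V + \<eta> / 2 * ?Y \<le> 1 * ?V + \<eta> * ?Y"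
      using \<alpha> \<eta> V by (intro add_mono mult_right_mono) auto
    then show "\<beta> / mx * (\<alpha> / 8 * ?V + \<eta> / 2 * ?Y) \<le> \<beta> / mx * W (x, y, u, c)"
      using \<beta> mx by (intro mult_left_mono) (auto simp: W_def)
  qed
  finally show ?thesis by (simp add: algebra_simps power2_eq_square)
qed

end

text \<open>One n is the first full gradient of the L-SVRE run, the other serves the projected steps
  after it.\<close>

lemma cost_step:
  "measure_pmf.expectation (inner_run (x, y, u, c))
      (\<lambda>t. (\<lambda>(_, _, _, c). real c) (next_state (x, y, u, c) t))
    \<le> real c + (2 * real n + real T * (2 + p * real n))"
proof -
  have "measure_pmf.expectation (inner_run (x, y, u, c))
      (\<lambda>t. (\<lambda>(_, _, _, c). real c) (next_state (x, y, u, c) t))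
      = measure_pmf.expectation (inner_run (x, y, u, c)) (\<lambda>t. (\<lambda>(z, c). real c) t + (real c + real n))"
    by (rule Bochner_Integration.integral_cong) (auto simp: next_state_def)
  also have "\<dots> = measure_pmf.expectation (inner_run (x, y, u, c)) (\<lambda>(z, c). real c) + (real c + real n)"
    by (subst Bochner_Integration.integral_add)
      (simp_all add: integrable_measure_pmf_finite finite_inner_run)
  also have "\<dots> \<le> (real n + real T * (2 + p * real n)) + (real c + real n)"
    unfolding inner_run_def using lsvre_cost[OF n, of p] p by simp
  finally show ?thesis by simp
qed

section \<open>The chain of outer rounds\<close>

definition params :: "bool \<Rightarrow> nat \<Rightarrow> al_params"
  where "params b K = \<lparr>exchange = b, prox_weight = \<beta>, momentum = mx / (mx + \<beta>), iters = K,
    refresh_prob = p, step_size = (\<lambda>_. \<tau>), inner_iters = (\<lambda>_. T)\<rparr>"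

abbreviation run :: "bool \<Rightarrow> nat \<Rightarrow> 'a \<Rightarrow> 'b \<Rightarrow> nat \<Rightarrow> ('a \<times> 'b \<times> 'a \<times> nat) pmf"
  where "run b K \<equiv> al_svre_iter (params b K) n X Y G"

text \<open>This identifies a round of the algorithm with the analysed one: its momentum parameter
  is \<alpha>^2, and the ascent step in y is a descent step for the saddle operator.\<close>

lemma run_Suc:
  "run b K x0 y0 (Suc k) = bind_pmf (run b K x0 y0 k) (\<lambda>s. map_pmf (next_state s) (inner_run s))"
proof -
  have "prox_operator u z = (fst (average n (prox_components u) z), - snd (average n (prox_components u) z))" for u z
    by (simp add: saddle_operator_def flip: saddle_operator_prox)
  then have nx: "next_x u z \<tau> = projection X (fst z - \<tau> *\<^sub>R fst (average n (prox_components u) z))"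
    and ny: "next_y u z \<tau> = projection Y (snd z + \<tau> *\<^sub>R snd (average n (prox_components u) z))" for u z
    by (simp_all add: next_x_def next_y_def)
  show ?thesis
    by (auto intro!: bind_pmf_cong simp: params_def Let_def map_pmf_def inner_run_def next_state_def nx ny \<alpha>_def
        prox_components_def[abs_def] simp flip: real_sqrt_divide)
qed

context
  fixes b :: bool and K :: nat and x0 :: 'a and y0 :: 'b
  assumes start: "x0 \<in> X" "y0 \<in> Y"
begin

lemma finite_run: "finite (set_pmf (run b K x0 y0 k))"
  by (induction k) (auto simp: run_Suc finite_inner_run simp del: al_svre_iter.simps(2))

lemma set_run: "(x, y, u, c) \<in> set_pmf (run b K x0 y0 k) \<Longrightarrow> x \<in> X \<and> y \<in> Y"
proof (induction k arbitrary: x y u c)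
  case (Suc k)
  then obtain x1 y1 u1 c1 zt c' where "(x1, y1, u1, c1) \<in> set_pmf (run b K x0 y0 k)"
    "(zt, c') \<in> set_pmf (inner_run (x1, y1, u1, c1))"
    "(x, y, u, c) = next_state (x1, y1, u1, c1) (zt, c')"
    by (auto simp: run_Suc simp del: al_svre_iter.simps)
  moreover from this have "x1 \<in> X" "y1 \<in> Y" using Suc.IH by blast+
  moreover from this calculation(2) have "zt \<in> X \<times> Y" by (rule set_inner_run)
  ultimately show ?case
    using next_in[OF _ _ estimate _ \<tau>(1) \<tau>L] by (simp add: next_state_def)
qed (use start in simp)

lemma run_Suc_expectation_le:
  fixes h g :: "'a \<times> 'b \<times> 'a \<times> nat \<Rightarrow> real"
  assumes "\<And>x y u c. x \<in> X \<Longrightarrow> y \<in> Y \<Longrightarrow>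
    measure_pmf.expectation (inner_run (x, y, u, c)) (\<lambda>t. h (next_state (x, y, u, c) t)) \<le> g (x, y, u, c)"
  shows "measure_pmf.expectation (run b K x0 y0 (Suc k)) h \<le> measure_pmf.expectation (run b K x0 y0 k) g"
  unfolding run_Suc
proof (rule expectation_bind_le[OF finite_run])
  fix s assume "s \<in> set_pmf (run b K x0 y0 k)"
  then show "measure_pmf.expectation (map_pmf (next_state s) (inner_run s)) h \<le> g s"
    using set_run assms by (cases s) auto
qed (simp add: finite_inner_run)

lemma run_cost:
  "measure_pmf.expectation (run b K x0 y0 k) (\<lambda>(_, _, _, c). real c)
    \<le> real k * (2 * real n + real T * (2 + p * real n))"
proof (induction k)
  case (Suc k)
  let ?c = "2 * real n + real T * (2 + p * real n)"
  have "measure_pmf.expectation (run b K x0 y0 (Suc k)) (\<lambda>(_, _, _, c). real c)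
      \<le> measure_pmf.expectation (run b K x0 y0 k) (\<lambda>s. (\<lambda>(_, _, _, c). real c) s + ?c)"
    by (rule run_Suc_expectation_le) (use cost_step in auto)
  also have "\<dots> = measure_pmf.expectation (run b K x0 y0 k) (\<lambda>(_, _, _, c). real c) + ?c"
    by (subst Bochner_Integration.integral_add) (simp_all add: integrable_measure_pmf_finite finite_run)
  finally show ?case using Suc.IH by (simp add: algebra_simps)
qed simp

text \<open>The initial gap bounds each of the three summands: the primal gap, the distance in x
  because the estimate point starts at \<open>x0\<close>, and the distance in y because \<eta> \<le>
  my / 2.\<close>

lemma W_start: "W (x0, y0, x0, 0) \<le> 3 * duality_gap X Y H (x0, y0)"
proof -
  let ?\<Delta> = "duality_gap X Y H (x0, y0)"
  have est: "estimate x0 x0 = x0"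
    using \<alpha> by (simp add: estimate_def algebra_simps)
  have gap: "H (xs, ys) + mx / 2 * (norm (x0 - xs))\<^sup>2 + my / 2 * (norm (y0 - ys))\<^sup>2 \<le> H (xs, ys) + ?\<Delta>"
    using saddle_growth[OF start(1) ys_in] saddle_growth[OF xs_in start(2)]
      duality_gap_upper[OF start xs_in ys_in] by simp
  have nonneg: "0 \<le> mx / 2 * (norm (x0 - xs))\<^sup>2" "0 \<le> my / 2 * (norm (y0 - ys))\<^sup>2"
    using mx my by auto
  have "primal x0 \<le> H (xs, ys) + ?\<Delta>"
  proof (rule primal_least)
    fix b assume "b \<in> Y"
    then show "H (x0, b) \<le> H (xs, ys) + ?\<Delta>"
      using duality_gap_upper[OF start xs_in, of b] saddle_le[OF xs_in start(2)] by simp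
  qed
  then have "lyapunov x0 (estimate x0 x0) \<le> 2 * ?\<Delta>"
    using gap nonneg by (simp add: est lyapunov_def primal_xs)
  moreover have "\<eta> * (norm (y0 - ys))\<^sup>2 \<le> ?\<Delta>"
  proof -
    have "\<eta> \<le> my / 2"
    proof -
      have "\<alpha> * mx \<le> 1 * my" using \<alpha> mx mx_le_my by (intro mult_mono) auto
      moreover have "2 \<le> 16 * \<kappa>\<^sup>2" using one_le_power[OF \<kappa>(1), of 2] by linarith
      ultimately show ?thesis unfolding \<eta>_def using my by (intro frac_le) auto
    qed
    then have "\<eta> * (norm (y0 - ys))\<^sup>2 \<le> my / 2 * (norm (y0 - ys))\<^sup>2"
      by (rule mult_right_mono) simp
    then show ?thesis using gap nonneg by simp
  qed
  ultimately show ?thesis by (simp add: W_def)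
qed

context
  assumes T: "4 * (1 - r) ^ T \<le> \<alpha> * mx / (96 * \<kappa>\<^sup>2 * Q)"
begin

lemma run_W: "measure_pmf.expectation (run b K x0 y0 k) W \<le> (1 - \<alpha> / 8) ^ k * W (x0, y0, x0, 0)"
proof (induction k)
  case (Suc k)
  have "measure_pmf.expectation (run b K x0 y0 (Suc k)) W
      \<le> measure_pmf.expectation (run b K x0 y0 k) (\<lambda>s. (1 - \<alpha> / 8) * W s)"
    by (rule run_Suc_expectation_le) (rule W_step[OF T])
  also have "\<dots> \<le> (1 - \<alpha> / 8) * ((1 - \<alpha> / 8) ^ k * W (x0, y0, x0, 0))"
    using Suc.IH \<alpha> by simp
  finally show ?case by simp
qed simp

lemma run_gap:
  "measure_pmf.expectation (run b K x0 y0 (Suc k)) (\<lambda>(x, y, _). duality_gap X Y H (x, y))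
    \<le> \<beta> / mx * (1 + 16 * (\<beta> / mx)) * ((1 - \<alpha> / 8) ^ k * (3 * duality_gap X Y H (x0, y0)))"
proof -
  let ?B = "\<beta> / mx * (1 + 16 * (\<beta> / mx))"
  have B: "0 \<le> ?B" using \<beta> mx by simp
  have "measure_pmf.expectation (run b K x0 y0 (Suc k)) (\<lambda>(x, y, _). duality_gap X Y H (x, y))
      \<le> measure_pmf.expectation (run b K x0 y0 k) (\<lambda>s. ?B * W s)"
    by (rule run_Suc_expectation_le) (rule gap_step[OF T])
  also have "\<dots> = ?B * measure_pmf.expectation (run b K x0 y0 k) W"
    by (rule integral_mult_right_zero)
  also have "\<dots> \<le> ?B * ((1 - \<alpha> / 8) ^ k * W (x0, y0, x0, 0))"
    using B run_W by (rule mult_left_mono[rotated])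
  also have "\<dots> \<le> ?B * ((1 - \<alpha> / 8) ^ k * (3 * duality_gap X Y H (x0, y0)))"
    using B W_start \<alpha> by (intro mult_left_mono) auto
  finally show ?thesis .
qed

end

end

end

section \<open>Choice of the parameters\<close>

definition prox_choice :: "nat \<Rightarrow> real \<Rightarrow> real \<Rightarrow> real"
  where "prox_choice n L my = min my (L / sqrt n)"

text \<open>The argument of the logarithm is \<open>4 / \<rho>\<close> for the factor \<open>\<rho> = \<alpha> \<mu>\<^sub>x / (96 \<kappa>\<^sup>2 Q)\<close> by which an
  L-SVRE run has to reduce the squared distance; its rate is \<open>\<beta> / (8 L \<surd>n)\<close> per iteration.\<close>

definition inner_choice :: "nat \<Rightarrow> real \<Rightarrow> real \<Rightarrow> real \<Rightarrow> nat"
  where "inner_choice n L mx my = (let \<beta> = prox_choice n L my in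
    nat \<lceil>8 * sqrt n * (L / \<beta>) * ln (663552 * real n * (L / my)\<^sup>2 * (L / \<beta>) * (L / mx) * (1 + \<beta> / mx) + 192)\<rceil>)"

text \<open>Here 1 + B = 1 / \<alpha>^2, so 8 sqrt (1 + B) rounds reduce \<open>W\<close> by a
  factor e. The 6 combines the 3 of \<open>W_start\<close> with the target \<epsilon> / 2.\<close>

definition outer_choice :: "nat \<Rightarrow> real \<Rightarrow> real \<Rightarrow> real \<Rightarrow> real \<Rightarrow> real \<Rightarrow> nat"
  where "outer_choice n L mx my \<epsilon> \<Delta> = (let B = prox_choice n L my / mx in
    Suc (nat \<lceil>8 * sqrt (1 + B) * ln (1 + 6 * B * (1 + 16 * B) * \<Delta> / \<epsilon>)\<rceil>))"

text \<open>With this refresh probability p an iteration owes half a component call in expectation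
  for full gradients, and p \<le> 1/2 even for n = 1. The step size meets \<tau>^2 (2 L)^2 \<le> p /
  2 with equality.\<close>

definition al_choice :: "bool \<Rightarrow> nat \<Rightarrow> real \<Rightarrow> real \<Rightarrow> real \<Rightarrow> real \<Rightarrow> real \<Rightarrow> al_params"
  where "al_choice b n L mx my \<epsilon> \<Delta> = (let \<beta> = prox_choice n L my in
    \<lparr>exchange = b, prox_weight = \<beta>, momentum = mx / (mx + \<beta>), iters = outer_choice n L mx my \<epsilon> \<Delta>,
     refresh_prob = 1 / (2 * n), step_size = (\<lambda>_. 1 / (4 * L * sqrt n)),
     inner_iters = (\<lambda>_. inner_choice n L mx my)\<rparr>)"

lemma nat_ceiling_le: "0 \<le> x \<Longrightarrow> real (nat \<lceil>x\<rceil>) \<le> 1 + x"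
  by linarith

lemma power_le_exp_minus:
  fixes r :: real
  assumes "0 \<le> r" "r \<le> 1" "0 < R" "ln R \<le> r * real k"
  shows "(1 - r) ^ k \<le> 1 / R"
proof -
  have "(1 - r) ^ k \<le> exp (- r) ^ k"
    using assms exp_ge_add_one_self[of "- r"] by (intro power_mono) auto
  also have "\<dots> = exp (- (r * real k))"
    by (simp add: mult.commute flip: exp_of_nat_mult)
  also have "\<dots> \<le> exp (- ln R)"
    using assms by simp
  finally show ?thesis
    using assms by (simp add: exp_minus inverse_eq_divide)
qed

locale choice =
  fixes n :: nat and L mx my :: real
  assumes n: "n \<ge> 1" and mx: "0 < mx" "mx \<le> my" and my: "my \<le> L"
begin

definition \<beta> where "\<beta> = prox_choice n L my"
text \<open>Up to logarithms, \<open>sqrt (1 + B)\<close> counts the outer rounds and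
  \<open>sqrt n * w\<close> the inner iterations of each.\<close>

definition B where "B = \<beta> / mx"
definition w where "w = L / \<beta>"

lemma sqrt_n: "1 \<le> sqrt n" "sqrt n * sqrt n = n"
  using n by simp_all

lemma pos: "0 < my" "0 < L" "0 < \<beta>" "0 < B" "0 < w"
  using mx my sqrt_n by (auto simp: \<beta>_def B_def w_def prox_choice_def)

lemma \<beta>_le: "\<beta> \<le> my" "\<beta> \<le> L / sqrt n" "\<beta> \<le> L"
proof -
  show "\<beta> \<le> my" "\<beta> \<le> L / sqrt n" by (simp_all add: \<beta>_def prox_choice_def)
  then show "\<beta> \<le> L" using my by simp
qed

lemma w_eq: "w = max (L / my) (sqrt n)"
  using pos sqrt_n(1) by (auto simp: w_def \<beta>_def prox_choice_def min_def max_def field_simps)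

lemma kappas: "1 \<le> L / my" "L / my \<le> L / mx"
  using mx my pos by (auto intro: divide_left_mono)

lemma w_ge: "sqrt n \<le> w" "1 \<le> w" "L / my \<le> w"
proof -
  show "sqrt n \<le> w" "L / my \<le> w" by (simp_all add: w_eq)
  then show "1 \<le> w" using sqrt_n(1) by linarith
qed

lemma B_eq: "B = (L / mx) / w" "B \<le> L / mx"
proof -
  show "B = (L / mx) / w" using pos by (simp add: B_def w_def)
  moreover have "(L / mx) / w \<le> (L / mx) / 1"
    using w_ge(2) pos mx by (intro divide_left_mono) auto
  ultimately show "B \<le> L / mx" by simp
qed

end

lemma al_svre_direct_convergence:
  fixes X :: "'a::real_inner set" and Y :: "'b::real_inner set"
    and G :: "nat \<Rightarrow> 'a \<times> 'b \<Rightarrow> 'a \<times> 'b" and b x0 y0 mx my L n \<epsilon> H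
  assumes XY: "complete X" "complete Y" "x0 \<in> X" "y0 \<in> Y"
    and m: "0 < mx" "mx \<le> my" "my \<le> L" and n: "n \<ge> 1" and \<epsilon>: "0 < \<epsilon>"
    and grad: "gradient_on (X \<times> Y) H (average n G)"
    and cc: "convex_concave mx my X Y H"
    and smooth: "average_smooth n L (X \<times> Y) G"
  defines "R \<equiv> al_svre_direct (al_choice b n L mx my \<epsilon> (duality_gap X Y H (x0, y0))) n X Y G x0 y0"
  shows "finite (set_pmf R)" "set_pmf (map_pmf fst R) \<subseteq> X \<times> Y"
    and "measure_pmf.expectation (map_pmf fst R) (duality_gap X Y H) \<le> \<epsilon> / 2"
    and "measure_pmf.expectation R (\<lambda>(z, c). real c)
      \<le> real (outer_choice n L mx my \<epsilon> (duality_gap X Y H (x0, y0)))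
        * (2 * real n + 3 * real (inner_choice n L mx my))"
proof -
  interpret C: choice n L mx my
    using m n by unfold_locales
  let ?\<Delta> = "duality_gap X Y H (x0, y0)"
  let ?p = "1 / (2 * real n)" and ?\<tau> = "1 / (4 * L * sqrt n)" and ?r = "C.\<beta> / (8 * L * sqrt n)"
  let ?T = "inner_choice n L mx my" and ?K = "outer_choice n L mx my \<epsilon> ?\<Delta>"
  have "saddle_problem X Y H (saddle_operator (average n G)) mx my L"
    using XY m C.pos norm_average_diff_le[OF smooth]
    by (intro saddle_problem_of_gradient grad cc) auto
  then interpret S: saddle_problem X Y H "saddle_operator (average n G)" mx my L .
  have r_p: "?r \<le> ?p / 4"
  proof -
    have "C.\<beta> / (8 * L * sqrt n) \<le> (L / sqrt n) / (8 * L * sqrt n)"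
      using C.\<beta>_le(2) C.pos n by (intro divide_right_mono) auto
    also have "\<dots> = ?p / 4" using C.pos n by (simp add: field_simps)
    finally show ?thesis .
  qed
  interpret al_svre_problem X Y H "saddle_operator (average n G)" mx my L C.\<beta> "L / my" n G ?p ?\<tau> ?r ?T
    using m n C.pos C.\<beta>_le smooth r_p
    by unfold_locales (auto simp: power_divide power_mult_distrib field_simps)
  have \<alpha>_eq: "1 / \<alpha> = sqrt (1 + C.B)" "1 / \<alpha>\<^sup>2 = 1 + C.B"
  proof -
    show "1 / \<alpha>\<^sup>2 = 1 + C.B"
      unfolding \<alpha>(3) using m C.pos by (simp add: C.B_def field_simps)
    then show "1 / \<alpha> = sqrt (1 + C.B)"
      using \<alpha>(1) by (metis power_one_over real_sqrt_unique less_imp_le zero_less_divide_1_iff)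
  qed
  let ?R = "663552 * real n * (L / my)\<^sup>2 * (L / C.\<beta>) * (L / mx) * (1 + C.\<beta> / mx) + 192"
  \<comment> \<open>This accounts for the constants of \<open>inner_choice\<close>: 663552 = 4 * 96
    * 108 * 16 with 16 from 1 / \<tau>^2, and 192 = 4 * 48 from the summand 8 \<eta> of
    \<open>Q\<close>.\<close>
  have Q_eq: "\<alpha> * mx / (96 * (L / my)\<^sup>2 * Q) = 4 / ?R"
  proof -
    have "96 * (L / my)\<^sup>2 * Q / (\<alpha> * mx)
        = 96 * 108 * (L / my)\<^sup>2 * (1 / ?\<tau>\<^sup>2) * (1 / C.\<beta>) * (1 / mx) * (1 / \<alpha>\<^sup>2) + 48"
      using C.pos m \<alpha>(1) n unfolding Q_def \<eta>_def by (simp add: field_simps power2_eq_square)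
    also have "\<dots> = ?R / 4"
      unfolding \<alpha>_eq(2) using C.pos m n by (simp add: C.B_def power_mult_distrib power_divide power2_eq_square)
    finally have eq: "96 * (L / my)\<^sup>2 * Q / (\<alpha> * mx) = ?R / 4" .
    have "\<alpha> * mx / (96 * (L / my)\<^sup>2 * Q) = 1 / (96 * (L / my)\<^sup>2 * Q / (\<alpha> * mx))"
      by (simp only: divide_divide_eq_right mult_1)
    also have "\<dots> = 4 / ?R"
      unfolding eq by (simp only: divide_divide_eq_right mult_1)
    finally show ?thesis .
  qed
  have R1: "192 \<le> ?R"
    using C.pos m by (simp add: mult_nonneg_nonneg)
  have T: "4 * (1 - ?r) ^ ?T \<le> \<alpha> * mx / (96 * (L / my)\<^sup>2 * Q)"
  proof -
    have "ln ?R \<le> ?r * ?T"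
    proof -
      have "8 * sqrt n * (L / C.\<beta>) * ln ?R \<le> ?T"
        unfolding inner_choice_def Let_def C.\<beta>_def[symmetric] by linarith
      then have "?r * (8 * sqrt n * (L / C.\<beta>) * ln ?R) \<le> ?r * ?T"
        using C.pos by (intro mult_left_mono) auto
      then show ?thesis using C.pos n by simp
    qed
    moreover have "?r \<le> 1" by (rule order_trans[OF r_p]) (use n in \<open>simp add: field_simps\<close>)
    ultimately have "(1 - ?r) ^ ?T \<le> 1 / ?R"
      using C.pos R1 by (intro power_le_exp_minus) auto
    then show ?thesis unfolding Q_eq by simp
  qed
  obtain k where k: "?K = Suc k" "8 / \<alpha> * ln (1 + 6 * C.B * (1 + 16 * C.B) * ?\<Delta> / \<epsilon>) \<le> k"
  proof
    show "?K = Suc (nat \<lceil>8 * sqrt (1 + C.B) * ln (1 + 6 * C.B * (1 + 16 * C.B) * ?\<Delta> / \<epsilon>)\<rceil>)"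
      by (simp add: outer_choice_def Let_def C.B_def C.\<beta>_def)
    show "8 / \<alpha> * ln (1 + 6 * C.B * (1 + 16 * C.B) * ?\<Delta> / \<epsilon>)
        \<le> (nat \<lceil>8 * sqrt (1 + C.B) * ln (1 + 6 * C.B * (1 + 16 * C.B) * ?\<Delta> / \<epsilon>)\<rceil>)"
      using \<alpha>_eq(1) by (simp add: divide_inverse) linarith
  qed
  have P: "al_choice b n L mx my \<epsilon> ?\<Delta> = params b ?K"
    by (simp add: al_choice_def params_def Let_def flip: C.\<beta>_def)
  have iters: "iters (params b ?K) = ?K" by (simp add: params_def)
  have R: "R = map_pmf (\<lambda>(x, y, u, c). ((x, y), c)) (run b ?K x0 y0 ?K)"
    by (simp only: R_def P al_svre_direct_def iters)
  show "finite (set_pmf R)"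
    using finite_run[OF XY(3,4)] by (simp add: R)
  show "set_pmf (map_pmf fst R) \<subseteq> X \<times> Y"
    using set_run[OF XY(3,4)] by (auto simp: R)
  have "measure_pmf.expectation (map_pmf fst R) (duality_gap X Y H)
      = measure_pmf.expectation (run b ?K x0 y0 (Suc k)) (\<lambda>(x, y, _). duality_gap X Y H (x, y))"
    by (simp add: R k(1) case_prod_unfold del: al_svre_iter.simps)
  also have "\<dots> \<le> C.B * (1 + 16 * C.B) * ((1 - \<alpha> / 8) ^ k * (3 * ?\<Delta>))"
    using run_gap[OF XY(3,4) T] by (simp only: C.B_def)
  also have "\<dots> \<le> \<epsilon> / 2"
  proof -
    let ?E = "6 * C.B * (1 + 16 * C.B) * ?\<Delta>"
    have \<Delta>: "0 \<le> ?\<Delta>" using S.duality_gap_upper[OF XY(3,4,3,4)] by simp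
    then have E: "0 \<le> ?E" using C.pos by simp
    have "ln (1 + ?E / \<epsilon>) \<le> \<alpha> / 8 * k"
      using k(2) \<alpha>(1) by (simp add: field_simps)
    \<comment> \<open>The decay gives \<open>?E / (1 + ?E / \<epsilon>)\<close>, which is at most
      \<epsilon> for every nonnegative \<open>?E\<close>; the summand 1 also keeps the logarithm
      nonnegative.\<close>
    then have "(1 - \<alpha> / 8) ^ k \<le> 1 / (1 + ?E / \<epsilon>)"
      using \<alpha> E \<epsilon> by (intro power_le_exp_minus) (auto intro: add_pos_nonneg)
    then have "(1 - \<alpha> / 8) ^ k * ?E \<le> 1 / (1 + ?E / \<epsilon>) * ?E"
      using E by (rule mult_right_mono)
    also have "\<dots> \<le> \<epsilon>"
    proof -
      have "1 / (1 + F / \<epsilon>) * F \<le> \<epsilon>" if "0 \<le> F" for F :: real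
        using \<epsilon> that by (simp add: field_simps)
      then show ?thesis using E by blast
    qed
    finally show ?thesis by (simp add: algebra_simps)
  qed
  finally show "measure_pmf.expectation (map_pmf fst R) (duality_gap X Y H) \<le> \<epsilon> / 2" .
  have "measure_pmf.expectation R (\<lambda>(z, c). real c)
      = measure_pmf.expectation (run b ?K x0 y0 ?K) (\<lambda>(_, _, _, c). real c)"
    by (simp add: R case_prod_unfold del: al_svre_iter.simps)
  also have "\<dots> \<le> ?K * (2 * real n + ?T * (2 + ?p * real n))"
    by (rule run_cost[OF XY(3,4)])
  also have "\<dots> \<le> real ?K * (2 * real n + 3 * real ?T)"
    using n by (intro mult_left_mono) auto
  finally show "measure_pmf.expectation R (\<lambda>(z, c). real c) \<le> real ?K * (2 * real n + 3 * real ?T)" .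
qed

lemma admissible_al_choice:
  assumes "0 < mx" "mx \<le> my" "my \<le> L" "n \<ge> 1"
  shows "admissible (al_choice b n L mx my \<epsilon> \<Delta>)"
proof -
  interpret choice n L mx my using assms by unfold_locales
  show ?thesis
    using assms pos by (simp add: al_choice_def admissible_def Let_def flip: \<beta>_def)
qed

section \<open>Arithmetic of the total cost\<close>

context choice
begin

text \<open>The arguments of both logarithms are polynomially bounded in N, apart from 1 /
  \<epsilon> in the outer one. Since N \<ge> 2, numerical constants are absorbed into powers of N,
  so each logarithm is a constant times ln N.\<close>

lemma choice_cost:
  assumes \<epsilon>: "0 < \<epsilon>" and \<Delta>: "0 \<le> \<Delta>" "\<Delta> \<le> N" and N: "exp 1 \<le> N" "real n \<le> N" "L / mx \<le> 8 * N"
  shows "real (outer_choice n L mx my \<epsilon> \<Delta>) * (2 * real n + 3 * real (inner_choice n L mx my))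
    \<le> 136482 * (ln N)\<^sup>2 * max 1 (ln (1 / \<epsilon>)) *
      (real n + sqrt (2 * real n * (L / mx) * (L / my)) + sqrt (n * sqrt n * (L / mx)))"
proof -
  define E where "E = ln N"
  define M where "M = max 1 (ln (1 / \<epsilon>))"
  have N2: "2 \<le> N" using N(1) exp_ge_add_one_self[of 1] by simp
  have E1: "1 \<le> E" using N(1) N2 by (simp add: E_def ln_ge_iff)
  have M1: "1 \<le> M" by (simp add: M_def)
  have w8: "w \<le> 8 * N"
  proof -
    have "sqrt n \<le> n" using mult_right_mono[OF sqrt_n(1), of "sqrt n"] sqrt_n(2) by simp
    then show ?thesis unfolding w_eq using kappas N(2,3) N2 by (intro max.boundedI) linarith+
  qed
  have B8: "B \<le> 8 * N" using B_eq(2) N(3) by simp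
  let ?R = "663552 * real n * (L / my)\<^sup>2 * (L / \<beta>) * (L / mx) * (1 + \<beta> / mx) + 192"
  \<comment> \<open>The five factors are at most N, (8 N)^2, 8 N, 8 N and 9 N; the constant
    collected in front of N^6 is below 2^35.\<close>
  have R: "?R \<le> N ^ 41"
  proof -
    have "real n * (L / my)\<^sup>2 * w * (L / mx) * (1 + B) \<le> N * (8 * N)\<^sup>2 * (8 * N) * (8 * N) * (9 * N)"
      using N N2 w8 B8 kappas pos mx by (intro mult_mono power_mono) auto
    then have "663552 * (real n * (L / my)\<^sup>2 * w * (L / mx) * (1 + B)) + 192 \<le> 24461180928 * N ^ 6 + 192"
      by (simp add: power2_eq_square eval_nat_numeral)
    also have "\<dots> \<le> 24461180928 * N ^ 6 + 192 * N ^ 6"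
      using N2 by (simp add: one_le_power)
    also have "\<dots> \<le> 2 ^ 35 * N ^ 6"
      using N2 by simp
    also have "\<dots> \<le> N ^ 35 * N ^ 6"
      using N2 by (intro mult_right_mono power_mono) auto
    finally show ?thesis by (simp add: w_def B_def mult.assoc flip: power_add)
  qed
  have R1: "192 \<le> ?R" using pos mx by simp
  have lnR: "0 \<le> ln ?R" "ln ?R \<le> 41 * E"
  proof -
    show "0 \<le> ln ?R" using R1 by (intro ln_ge_zero) linarith
    have "ln ?R \<le> ln (N ^ 41)" using R R1 N2 by (subst ln_le_cancel_iff) auto
    then show "ln ?R \<le> 41 * E" using N2 by (simp add: ln_realpow E_def)
  qed
  have "inner_choice n L mx my \<le> 1 + 8 * sqrt n * w * ln ?R"
    using lnR pos unfolding inner_choice_def Let_def \<beta>_def[symmetric] w_def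
    by (intro nat_ceiling_le mult_nonneg_nonneg) auto
  also have "\<dots> \<le> 1 + 8 * sqrt n * w * (41 * E)"
    using lnR pos by (intro add_left_mono mult_left_mono) auto
  finally have T: "inner_choice n L mx my \<le> 1 + 328 * (sqrt n * w * E)" by simp
  have nw: "real n \<le> sqrt n * w" "1 \<le> sqrt n * w"
  proof -
    show "real n \<le> sqrt n * w" using mult_left_mono[OF w_ge(1), of "sqrt n"] sqrt_n by simp
    then show "1 \<le> sqrt n * w" using n by linarith
  qed
  \<comment> \<open>989 = 2 + 3 + 3 * 328, where n, 1 and E are absorbed by n \<le> sqrt n * w, 1
    \<le> sqrt n * w and 1 \<le> E.\<close>
  have TT: "2 * real n + 3 * real (inner_choice n L mx my) \<le> 989 * (sqrt n * w * E)"
  proof -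
    have "sqrt n * w * 1 \<le> sqrt n * w * E" using E1 nw(2) by (intro mult_left_mono) auto
    then show ?thesis using T nw by linarith
  qed
  let ?S = "1 + 6 * B * (1 + 16 * B) * \<Delta> / \<epsilon>"
  have S: "?S \<le> N ^ 16 * max 1 (1 / \<epsilon>)"
  proof -
    have "6 * B * (1 + 16 * B) * \<Delta> \<le> 6 * (8 * N) * (129 * N) * N"
      using pos B8 N2 \<Delta> by (intro mult_mono) auto
    also have "\<dots> = 6192 * N ^ 3" by (simp add: eval_nat_numeral)
    finally have "6 * B * (1 + 16 * B) * \<Delta> * (1 / \<epsilon>) \<le> 6192 * N ^ 3 * max 1 (1 / \<epsilon>)"
      by (rule mult_mono) (use N2 \<epsilon> in auto)
    moreover have "1 * 1 \<le> N ^ 3 * max 1 (1 / \<epsilon>)"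
      using N2 by (intro mult_mono) (auto simp: one_le_power)
    ultimately have "?S \<le> 6193 * (N ^ 3 * max 1 (1 / \<epsilon>))" by simp
    also have "\<dots> \<le> 2 ^ 13 * (N ^ 3 * max 1 (1 / \<epsilon>))"
      using N2 by (intro mult_right_mono) auto
    also have "\<dots> \<le> N ^ 13 * (N ^ 3 * max 1 (1 / \<epsilon>))"
      using N2 by (intro mult_right_mono power_mono) auto
    finally show ?thesis by (simp add: mult.assoc flip: power_add)
  qed
  have S1: "1 \<le> ?S" using pos \<Delta> \<epsilon> by simp
  have lnS: "0 \<le> ln ?S" "ln ?S \<le> 17 * (E * M)"
  proof -
    show "0 \<le> ln ?S" using S1 by (rule ln_ge_zero)
    have "ln ?S \<le> ln (N ^ 16 * max 1 (1 / \<epsilon>))" using S S1 N2 by (subst ln_le_cancel_iff) auto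
    also have "\<dots> = 16 * E + ln (max 1 (1 / \<epsilon>))"
      using N2 by (subst ln_mult) (auto simp: ln_realpow E_def)
    also have "ln (max 1 (1 / \<epsilon>)) \<le> M"
    proof (cases "1 / \<epsilon> \<le> 1")
      case True
      then show ?thesis using M1 by simp
    next
      case False
      then show ?thesis by (simp add: M_def)
    qed
    also have "16 * E + M \<le> 16 * (E * M) + E * M"
    proof -
      have "E * 1 \<le> E * M" "1 * M \<le> E * M"
        using E1 M1 by (intro mult_left_mono mult_right_mono; simp)+
      then show ?thesis by linarith
    qed
    finally show "ln ?S \<le> 17 * (E * M)" by simp
  qed
  have EM: "1 \<le> E * M" using mult_mono[OF E1 M1] E1 by simp
  have sq: "1 \<le> sqrt (1 + B)" using pos by simp
  have "outer_choice n L mx my \<epsilon> \<Delta> \<le> 2 + 8 * sqrt (1 + B) * ln ?S"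
    using nat_ceiling_le[of "8 * sqrt (1 + B) * ln ?S"] lnS pos
    unfolding outer_choice_def Let_def \<beta>_def[symmetric] B_def[symmetric] by simp
  also have "\<dots> \<le> 2 * (sqrt (1 + B) * (E * M)) + 8 * sqrt (1 + B) * (17 * (E * M))"
    using lnS sq EM mult_mono[OF sq EM] by (intro add_mono mult_left_mono) auto
  finally have K: "outer_choice n L mx my \<epsilon> \<Delta> \<le> 138 * (sqrt (1 + B) * (E * M))" by (simp add: mult_ac)
  have "real (outer_choice n L mx my \<epsilon> \<Delta>) * (2 * real n + 3 * real (inner_choice n L mx my))
      \<le> 138 * (sqrt (1 + B) * (E * M)) * (989 * (sqrt n * w * E))"
    using sq EM by (intro mult_mono K TT) auto
  also have "\<dots> = 136482 * E\<^sup>2 * M * (sqrt n * w * sqrt (1 + B))"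
    by (simp add: power2_eq_square)
  \<comment> \<open>Under the root, B w = L / mx turns n w^2 (1 + B) into n (w^2 + w L / mx). If w =
    sqrt n this is n^2 + n sqrt n L / mx; if w = L / my, both summands are at most n (L / mx) (L /
    my) because mx \<le> my. The sum of both cases is then split by subadditivity of the
    root.\<close>
  also have "sqrt n * w * sqrt (1 + B)
      \<le> real n + sqrt (2 * real n * (L / mx) * (L / my)) + sqrt (n * sqrt n * (L / mx))"
  proof -
    have "sqrt n * w * sqrt (1 + B) = sqrt (n * (w\<^sup>2 + w * (L / mx)))"
    proof -
      have "w\<^sup>2 * (1 + B) = w\<^sup>2 + w * (L / mx)"
        using pos by (simp add: B_eq(1) power2_eq_square field_simps)
      moreover have "sqrt n * w * sqrt (1 + B) = sqrt (n * (w\<^sup>2 * (1 + B)))"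
        using pos by (simp add: real_sqrt_mult)
      ultimately show ?thesis by simp
    qed
    also have "\<dots> \<le> sqrt ((real n)\<^sup>2 + 2 * real n * (L / mx) * (L / my) + n * sqrt n * (L / mx))"
    proof (rule real_sqrt_le_mono)
      have "w\<^sup>2 + w * (L / mx) \<le> real n + 2 * (L / mx) * (L / my) + sqrt n * (L / mx)"
      proof (cases "w = sqrt n")
        case True
        moreover have "0 \<le> 2 * (L / mx) * (L / my)"
          using pos mx by (intro mult_nonneg_nonneg) auto
        ultimately show ?thesis by simp
      next
        case False
        then have w: "w = L / my" by (auto simp: w_eq max_def)
        have "w\<^sup>2 \<le> (L / mx) * (L / my)"
          unfolding w power2_eq_square using kappas by (intro mult_right_mono) auto
        moreover have "0 \<le> sqrt n * (L / mx)" using pos mx by simp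
        moreover have "w * (L / mx) = (L / mx) * (L / my)" by (simp add: w)
        moreover have "2 * (L / mx) * (L / my) = 2 * ((L / mx) * (L / my))" by simp
        moreover have "0 \<le> real n" by simp
        ultimately show ?thesis by argo
      qed
      then have "n * (w\<^sup>2 + w * (L / mx)) \<le> n * (real n + 2 * (L / mx) * (L / my) + sqrt n * (L / mx))"
        by (rule mult_left_mono) simp
      then show "n * (w\<^sup>2 + w * (L / mx)) \<le> (real n)\<^sup>2 + 2 * real n * (L / mx) * (L / my) + n * sqrt n * (L / mx)"
        by (simp add: algebra_simps power2_eq_square)
    qed
    also have "\<dots> \<le> sqrt ((real n)\<^sup>2 + 2 * real n * (L / mx) * (L / my)) + sqrt (n * sqrt n * (L / mx))"
      using pos mx by (intro sqrt_add_le_add_sqrt) auto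
    also have "\<dots> \<le> sqrt ((real n)\<^sup>2) + sqrt (2 * real n * (L / mx) * (L / my)) + sqrt (n * sqrt n * (L / mx))"
      using pos mx by (intro add_right_mono sqrt_add_le_add_sqrt) auto
    finally show ?thesis by simp
  qed
  finally show ?thesis
    using M1 by (simp add: E_def M_def mult_left_mono)
qed

end

section \<open>The regularised problem\<close>

lemma norm_lookup_le: "norm (Poly_Mapping.lookup v k) \<le> norm v" for v :: "'a \<Rightarrow>\<^sub>0 'b::real_normed_vector"
proof -
  have "norm v = L2_set (\<lambda>k. norm (Poly_Mapping.lookup v k)) (insert k (Poly_Mapping.keys v))"
    by (rule norm_poly_mapping_superset) auto
  then show ?thesis
    by (simp only:) (rule member_le_L2_set, simp_all)
qed

text \<open>Limits are taken coordinatewise. Within one dimension bound d all supports lie in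
  \<open>{..<d}\<close>, so the limit is again finitely supported and the norm is a fixed finite
  sum.\<close>

lemma complete_eucl: "complete (eucl d)"
  unfolding complete_def
proof (intro allI impI, elim conjE)
  fix s :: "nat \<Rightarrow> rvec"
  assume s: "\<forall>j. s j \<in> eucl d" "Cauchy s"
  have "Cauchy (\<lambda>j. Poly_Mapping.lookup (s j) k)" for k
  proof (rule metric_CauchyI)
    fix e :: real assume "0 < e"
    then obtain M where M: "\<And>i j. i \<ge> M \<Longrightarrow> j \<ge> M \<Longrightarrow> dist (s i) (s j) < e"
      using metric_CauchyD[OF s(2)] by blast
    have "dist (Poly_Mapping.lookup (s i) k) (Poly_Mapping.lookup (s j) k) < e" if "i \<ge> M" "j \<ge> M" for i j
      using M[OF that] norm_lookup_le[of "s i - s j" k] by (simp add: dist_norm lookup_minus)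
    then show "\<exists>M. \<forall>i\<ge>M. \<forall>j\<ge>M. dist (Poly_Mapping.lookup (s i) k) (Poly_Mapping.lookup (s j) k) < e"
      by blast
  qed
  then have "\<exists>l. (\<lambda>j. Poly_Mapping.lookup (s j) k) \<longlonglongrightarrow> l" for k
    by (simp add: real_Cauchy_convergent convergent_def[symmetric])
  then obtain l where l: "\<And>k. (\<lambda>j. Poly_Mapping.lookup (s j) k) \<longlonglongrightarrow> l k"
    by metis
  have zero: "l k = 0" if "k \<ge> d" for k
  proof -
    have "k \<notin> Poly_Mapping.keys (s j)" for j
      using s(1) that by (fastforce simp: eucl_def)
    then have "Poly_Mapping.lookup (s j) k = 0" for j
      by (simp add: in_keys_iff)
    then show ?thesis using l[of k] LIMSEQ_unique[OF _ tendsto_const] by simp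
  qed
  have "{k. l k \<noteq> 0} \<subseteq> {..<d}" using zero by (auto simp: not_le[symmetric])
  then have fin: "finite {k. l k \<noteq> 0}" by (rule finite_subset) simp
  define v where "v = Abs_poly_mapping l"
  have v: "Poly_Mapping.lookup v = l" unfolding v_def using fin by simp
  have v_in: "v \<in> eucl d"
    using zero by (auto simp: eucl_def in_keys_iff v not_le[symmetric])
  have norm_eq: "norm (s j - v) = sqrt (\<Sum>k<d. (Poly_Mapping.lookup (s j) k - l k)\<^sup>2)" for j
  proof -
    have "Poly_Mapping.keys (s j - v) \<subseteq> {..<d}"
      using s(1) v_in unfolding eucl_def by (auto dest!: subsetD[OF keys_diff])
    then show ?thesis
      by (simp add: norm_poly_mapping_superset[of "{..<d}"] L2_set_def lookup_minus v)
  qed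
  have "(\<lambda>j. sqrt (\<Sum>k<d. (Poly_Mapping.lookup (s j) k - l k)\<^sup>2)) \<longlonglongrightarrow> sqrt (\<Sum>k<d. (l k - l k)\<^sup>2)"
    by (intro tendsto_intros l)
  then have "(\<lambda>j. norm (s j - v)) \<longlonglongrightarrow> 0" by (simp add: norm_eq)
  then have "s \<longlonglongrightarrow> v" by (metis LIM_zero_cancel tendsto_norm_zero_iff)
  with v_in show "\<exists>v\<in>eucl d. s \<longlonglongrightarrow> v" by blast
qed

lemma complete_closed_eucl: "closed S \<Longrightarrow> S \<subseteq> eucl d \<Longrightarrow> complete S"
  using complete_Int_closed[OF complete_eucl, of S d] by (simp add: Int_absorb1)

lemma average_smooth_mono:
  assumes "average_smooth n L S g" "0 \<le> L" "L \<le> L'"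
  shows "average_smooth n L' S g"
  unfolding average_smooth_def
proof (intro ballI)
  fix z w assume "z \<in> S" "w \<in> S"
  then have "(\<Sum>i<n. (norm (g i z - g i w))\<^sup>2) / real n \<le> L\<^sup>2 * (norm (z - w))\<^sup>2"
    using assms(1) by (simp add: average_smooth_def)
  also have "\<dots> \<le> L'\<^sup>2 * (norm (z - w))\<^sup>2"
    using assms by (intro mult_right_mono power_mono) auto
  finally show "(\<Sum>i<n. (norm (g i z - g i w))\<^sup>2) / real n \<le> L'\<^sup>2 * (norm (z - w))\<^sup>2" .
qed

lemma strongly_convex_on_mono:
  assumes "strongly_convex_on m S \<phi>" "m' \<le> m"
  shows "strongly_convex_on m' S \<phi>"
  unfolding strongly_convex_on_def
proof (intro conjI ballI)
  show "convex S" using assms(1) by (simp add: strongly_convex_on_def)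
  fix x y t assume xyt: "x \<in> S" "y \<in> S" "t \<in> {0..1::real}"
  have "m' / 2 * (t * (1 - t)) * (norm (x - y))\<^sup>2 \<le> m / 2 * (t * (1 - t)) * (norm (x - y))\<^sup>2"
    using assms(2) xyt by (intro mult_right_mono) auto
  moreover have "\<phi> ((1 - t) *\<^sub>R x + t *\<^sub>R y)
      \<le> (1 - t) * \<phi> x + t * \<phi> y - m / 2 * (t * (1 - t)) * (norm (x - y))\<^sup>2"
    using assms(1) xyt by (simp add: strongly_convex_on_def)
  ultimately show "\<phi> ((1 - t) *\<^sub>R x + t *\<^sub>R y)
      \<le> (1 - t) * \<phi> x + t * \<phi> y - m' / 2 * (t * (1 - t)) * (norm (x - y))\<^sup>2" by linarith
qed

lemma strongly_convex_on_diff_const: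
  assumes "strongly_convex_on m S \<phi>"
  shows "strongly_convex_on m S (\<lambda>x. \<phi> x - k)"
proof -
  have eq: "(1 - t) * (a - k) + t * (b - k) - e = (1 - t) * a + t * b - e - k" for t a b e :: real
    by (simp add: algebra_simps)
  show ?thesis
    using assms unfolding strongly_convex_on_def eq diff_le_eq diff_add_cancel .
qed

lemma convex_concave_add_prox:
  assumes "convex_concave m \<mu> X Y h" "\<mu>' \<le> \<mu>"
  shows "convex_concave (m + 2 * c) \<mu>' X Y (add_prox c u h)"
proof -
  have "strongly_convex_on \<mu>' Y (\<lambda>y. - add_prox c u h (x, y))" if "x \<in> X" for x
  proof -
    have "strongly_convex_on \<mu>' Y (\<lambda>y. - h (x, y) - c * (norm (x - u))\<^sup>2)"
      using assms that by (intro strongly_convex_on_diff_const) (auto simp: convex_concave_def intro: strongly_convex_on_mono)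
    then show ?thesis by (simp add: add_prox_def)
  qed
  then show ?thesis
    using assms(1) by (simp add: convex_concave_def strongly_convex_on_add_prox)
qed

lemma gradient_on_average:
  assumes "\<And>i. i < n \<Longrightarrow> gradient_on S (f i) (g i)"
  shows "gradient_on S (average n f) (average n g)"
  unfolding gradient_on_def
proof
  fix z assume "z \<in> S"
  then have "((\<lambda>z. \<Sum>i<n. f i z) has_derivative (\<lambda>h. \<Sum>i<n. g i z \<bullet> h)) (at z within S)"
    using assms by (intro has_derivative_sum) (auto simp: gradient_on_def)
  then have "((\<lambda>z. (1 / real n) *\<^sub>R (\<Sum>i<n. f i z)) has_derivative (\<lambda>h. (1 / real n) *\<^sub>R (\<Sum>i<n. g i z \<bullet> h))) (at z within S)"
    by (rule has_derivative_scaleR_right)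
  moreover have "(\<lambda>h. (1 / real n) *\<^sub>R (\<Sum>i<n. g i z \<bullet> h)) = (\<bullet>) (average n g z)"
    by (simp add: fun_eq_iff average_def inner_sum_left)
  ultimately show "(average n f has_derivative (\<bullet>) (average n g z)) (at z within S)"
    by (simp add: average_def[abs_def])
qed

section \<open>Exchanging the roles of the variables\<close>

lemma average_exchange_grad: "average n (\<lambda>i. exchange_grad (G i)) = exchange_grad (average n G)"
  by (simp add: fun_eq_iff average_def exchange_grad_def sum_negf prod_eq_iff fst_sum snd_sum)

lemma average_smooth_exchange:
  assumes "average_smooth n L (X \<times> Y) G"
  shows "average_smooth n L (Y \<times> X) (\<lambda>i. exchange_grad (G i))"
proof -
  have norm_swap: "norm (prod.swap z) = norm z" for z :: "'d::real_normed_vector \<times> 'e::real_normed_vector"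
    by (simp add: norm_prod_def add.commute)
  have "norm (exchange_grad (G i) z - exchange_grad (G i) w) = norm (G i (prod.swap z) - G i (prod.swap w))" for i z w
  proof -
    have "exchange_grad (G i) z - exchange_grad (G i) w = prod.swap (G i (prod.swap w) - G i (prod.swap z))"
      by (simp add: exchange_grad_def prod_eq_iff)
    then show ?thesis by (simp add: norm_swap norm_minus_commute)
  qed
  moreover have "norm (prod.swap z - prod.swap w) = norm (z - w)" for z w :: "'b \<times> 'a"
    by (metis norm_swap fst_diff snd_diff prod.swap_def prod.collapse diff_Pair)
  ultimately show ?thesis
    using assms by (auto simp: average_smooth_def)
qed

lemma convex_concave_exchange:
  assumes "convex_concave mx my X Y H"
  shows "convex_concave my mx Y X (\<lambda>z. - H (prod.swap z))"
  using assms by (simp add: convex_concave_def)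

lemma duality_gap_exchange: "duality_gap Y X (\<lambda>z. - H (prod.swap z)) (prod.swap z) = duality_gap X Y H z"
  by (simp add: duality_gap_def Inf_real_def image_image)

text \<open>Acceleration asks for the smaller modulus in the first variable, so
  \<open>my < mx\<close> triggers the exchange. The duality gap is invariant under swapping and
  negating, hence the initial gap and the target stay the same.\<close>

lemma al_svre_convergence:
  fixes X :: "'a::real_inner set" and Y :: "'b::real_inner set"
    and G :: "nat \<Rightarrow> 'a \<times> 'b \<Rightarrow> 'a \<times> 'b" and x0 y0 mx my L n \<epsilon> H
  assumes XY: "complete X" "complete Y" "x0 \<in> X" "y0 \<in> Y"
    and m: "0 < mx" "0 < my" "mx \<le> L" "my \<le> L" and n: "n \<ge> 1" and \<epsilon>: "0 < \<epsilon>"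
    and grad: "gradient_on (X \<times> Y) H (average n G)"
    and cc: "convex_concave mx my X Y H"
    and smooth: "average_smooth n L (X \<times> Y) G"
  defines "\<Delta> \<equiv> duality_gap X Y H (x0, y0)"
  defines "R \<equiv> al_svre (al_choice (my < mx) n L (min mx my) (max mx my) \<epsilon> \<Delta>) n X Y G x0 y0"
  shows "finite (set_pmf R)" "set_pmf (map_pmf fst R) \<subseteq> X \<times> Y"
    and "measure_pmf.expectation (map_pmf fst R) (duality_gap X Y H) \<le> \<epsilon> / 2"
    and "measure_pmf.expectation R (\<lambda>(z, c). real c)
      \<le> real (outer_choice n L (min mx my) (max mx my) \<epsilon> \<Delta>)
        * (2 * real n + 3 * real (inner_choice n L (min mx my) (max mx my)))"
proof -
  have "finite (set_pmf R) \<and> set_pmf (map_pmf fst R) \<subseteq> X \<times> Y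
    \<and> measure_pmf.expectation (map_pmf fst R) (duality_gap X Y H) \<le> \<epsilon> / 2
    \<and> measure_pmf.expectation R (\<lambda>(z, c). real c)
      \<le> real (outer_choice n L (min mx my) (max mx my) \<epsilon> \<Delta>)
        * (2 * real n + 3 * real (inner_choice n L (min mx my) (max mx my)))"
  proof (cases "my < mx")
    case False
    then have "R = al_svre_direct (al_choice False n L mx my \<epsilon> \<Delta>) n X Y G x0 y0"
      by (simp add: R_def al_svre_def al_choice_def Let_def)
    then show ?thesis
      using al_svre_direct_convergence[OF XY m(1) _ m(4) n \<epsilon> grad cc smooth, of False] False
      by (simp add: \<Delta>_def)
  next
    case True
    let ?H = "\<lambda>z. - H (prod.swap z)" and ?G = "\<lambda>i. exchange_grad (G i)"
    define S where "S = al_svre_direct (al_choice True n L my mx \<epsilon> \<Delta>) n Y X ?G y0 x0"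
    have \<Delta>: "duality_gap Y X ?H (y0, x0) = \<Delta>"
      using duality_gap_exchange[of Y X H "(x0, y0)"] by (simp add: \<Delta>_def)
    have R: "R = map_pmf (\<lambda>(z, c). (prod.swap z, c)) S"
      using True by (simp add: R_def S_def al_svre_def al_choice_def Let_def)
    have "gradient_on (Y \<times> X) ?H (average n ?G)"
      using gradient_on_exchange[OF grad] by (simp add: average_exchange_grad)
    note conv = al_svre_direct_convergence[OF XY(2,1,4,3) m(2) less_imp_le[OF True] m(3) n \<epsilon> this
        convex_concave_exchange[OF cc] average_smooth_exchange[OF smooth], of True,
        unfolded \<Delta>, folded S_def]
    have gap: "duality_gap X Y H (prod.swap z) = duality_gap Y X ?H z" for z
      using duality_gap_exchange[of Y X H "prod.swap z"] by simp
    have "measure_pmf.expectation (map_pmf fst R) (duality_gap X Y H)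
        = measure_pmf.expectation (map_pmf fst S) (duality_gap Y X ?H)"
      by (simp add: R case_prod_unfold gap)
    moreover have "measure_pmf.expectation R (\<lambda>(z, c). real c) = measure_pmf.expectation S (\<lambda>(z, c). real c)"
      by (simp add: R case_prod_unfold)
    moreover have "set_pmf (map_pmf fst R) \<subseteq> X \<times> Y"
      using conv(2) by (fastforce simp: R)
    ultimately show ?thesis
      using conv True by (simp add: R)
  qed
  then show "finite (set_pmf R)" "set_pmf (map_pmf fst R) \<subseteq> X \<times> Y"
    and "measure_pmf.expectation (map_pmf fst R) (duality_gap X Y H) \<le> \<epsilon> / 2"
    and "measure_pmf.expectation R (\<lambda>(z, c). real c)
      \<le> real (outer_choice n L (min mx my) (max mx my) \<epsilon> \<Delta>)
        * (2 * real n + 3 * real (inner_choice n L (min mx my) (max mx my)))"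
    by blast+
qed

text \<open>Here 8 k and 4 max \<kappa> 1 stand for 4 L over the two moduli. Where \<kappa> < 1 the
  excess is absorbed by sqrt n \<ge> 1: n k goes into n sqrt n k, and n sqrt n into n^2. The worst
  coefficient is 8 + 3 = 11.\<close>

lemma complexity_bound:
  fixes n :: nat and k \<kappa> :: real
  assumes "n \<ge> 1" "0 \<le> k" "0 \<le> \<kappa>"
  shows "real n + sqrt (2 * real n * ((8 * k) * (4 * max \<kappa> 1))) + sqrt (n * sqrt n * max (8 * k) (4 * max \<kappa> 1))
    \<le> 11 * (real n + sqrt (n * k * \<kappa>) + sqrt (n * sqrt n * \<kappa>) + sqrt (n * sqrt n * k))"
proof -
  have n: "1 \<le> sqrt n" "sqrt n * sqrt n = n" using assms(1) by simp_all
  have "sqrt (2 * real n * ((8 * k) * (4 * max \<kappa> 1))) = 8 * sqrt (n * k * max \<kappa> 1)"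
  proof -
    have "2 * real n * ((8 * k) * (4 * max \<kappa> 1)) = 64 * (n * k * max \<kappa> 1)" by simp
    moreover have "sqrt 64 = 8" by (rule real_sqrt_unique) auto
    ultimately show ?thesis by (simp only: real_sqrt_mult)
  qed
  also have "sqrt (n * k * max \<kappa> 1) \<le> sqrt (n * k * \<kappa> + n * sqrt n * k)"
  proof (rule real_sqrt_le_mono)
    have "max \<kappa> 1 \<le> \<kappa> + sqrt n"
      using assms(3) n(1) by linarith
    then have "n * k * max \<kappa> 1 \<le> n * k * (\<kappa> + sqrt n)"
      using assms by (intro mult_left_mono) auto
    then show "n * k * max \<kappa> 1 \<le> n * k * \<kappa> + n * sqrt n * k" by (simp add: algebra_simps)
  qed
  also have "\<dots> \<le> sqrt (n * k * \<kappa>) + sqrt (n * sqrt n * k)"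
    using assms by (intro sqrt_add_le_add_sqrt) auto
  finally have 1: "sqrt (2 * real n * ((8 * k) * (4 * max \<kappa> 1))) \<le> 8 * (sqrt (n * k * \<kappa>) + sqrt (n * sqrt n * k))"
    by simp
  have "sqrt (n * sqrt n * max (8 * k) (4 * max \<kappa> 1)) \<le> sqrt (9 * (n * sqrt n * k) + 4 * (n * sqrt n * \<kappa>) + 4 * (real n)\<^sup>2)"
  proof (rule real_sqrt_le_mono)
    have "n * sqrt n * max (8 * k) (4 * max \<kappa> 1) \<le> n * sqrt n * (9 * k + 4 * \<kappa> + 4)"
      using assms by (intro mult_left_mono) auto
    moreover have "n * sqrt n \<le> (real n)\<^sup>2"
      using mult_right_mono[OF n(1), of "sqrt n"] n(2) by (simp add: power2_eq_square mult_left_mono)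
    ultimately show "n * sqrt n * max (8 * k) (4 * max \<kappa> 1)
        \<le> 9 * (n * sqrt n * k) + 4 * (n * sqrt n * \<kappa>) + 4 * (real n)\<^sup>2"
      by (simp add: algebra_simps)
  qed
  also have "\<dots> \<le> sqrt (9 * (n * sqrt n * k) + 4 * (n * sqrt n * \<kappa>)) + sqrt (4 * (real n)\<^sup>2)"
    using assms by (intro sqrt_add_le_add_sqrt) auto
  also have "\<dots> \<le> sqrt (9 * (n * sqrt n * k)) + sqrt (4 * (n * sqrt n * \<kappa>)) + sqrt (4 * (real n)\<^sup>2)"
    using assms by (intro add_right_mono sqrt_add_le_add_sqrt) auto
  also have "\<dots> = 3 * sqrt (n * sqrt n * k) + 2 * sqrt (n * sqrt n * \<kappa>) + 2 * n"
    by (simp add: real_sqrt_mult)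
  finally have 2: "sqrt (n * sqrt n * max (8 * k) (4 * max \<kappa> 1))
      \<le> 3 * sqrt (n * sqrt n * k) + 2 * sqrt (n * sqrt n * \<kappa>) + 2 * real n"
    by simp
  have "0 \<le> sqrt (n * k * \<kappa>)" "0 \<le> sqrt (n * sqrt n * \<kappa>)" "0 \<le> real n"
    using assms by auto
  with 1 2 show ?thesis by argo
qed

theorem corollary2:
  shows "\<exists>(C::real) (m::nat)
      (params :: nat \<Rightarrow> real \<Rightarrow> real \<Rightarrow> real \<Rightarrow> real \<Rightarrow> real \<Rightarrow> al_params).
    \<forall>(dx::nat) (dy::nat) (n::nat) (X::rvec set) (Y::rvec set)
      (f :: nat \<Rightarrow> rvec \<times> rvec \<Rightarrow> real) (g :: nat \<Rightarrow> rvec \<times> rvec \<Rightarrow> rvec \<times> rvec)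
      (L::real) (\<mu>\<^sub>y::real) (D\<^sub>x::real) (\<epsilon>::real) (x\<^sub>0::rvec) (y\<^sub>0::rvec).
      X \<subseteq> eucl dx \<and> closed X \<and> convex X \<and> Y \<subseteq> eucl dy \<and> closed Y \<and> convex Y \<and>
      n \<ge> 1 \<and>
      (\<forall>i<n. gradient_on (X \<times> Y) (f i) (g i) \<and> g i ` (X \<times> Y) \<subseteq> eucl dx \<times> eucl dy \<and>
             convex_concave 0 0 X Y (f i)) \<and>
      average_smooth n L (X \<times> Y) g \<and>
      \<mu>\<^sub>y > 0 \<and> convex_concave 0 \<mu>\<^sub>y X Y (average n f) \<and>
      bounded X \<and> D\<^sub>x = diameter X \<and> x\<^sub>0 \<in> X \<and> y\<^sub>0 \<in> Y \<and>
      0 < \<epsilon> \<and> \<epsilon> \<le> 4 * L * D\<^sub>x\<^sup>2 \<longrightarrow>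
      (let \<kappa>\<^sub>y = L / \<mu>\<^sub>y;
           c = \<epsilon> / (4 * D\<^sub>x\<^sup>2);
           f\<^sub>\<epsilon> = add_prox c x\<^sub>0 (average n f);
           \<Delta> = duality_gap X Y f\<^sub>\<epsilon> (x\<^sub>0, y\<^sub>0);
           P = params n L \<mu>\<^sub>y D\<^sub>x \<epsilon> \<Delta>;
           R = al_svre P n X Y (\<lambda>i. add_prox_grad c x\<^sub>0 (g i)) x\<^sub>0 y\<^sub>0
       in admissible P \<and>
          saddle_in_expectation X Y f\<^sub>\<epsilon> (\<epsilon> / 2) (map_pmf fst R) \<and>
          saddle_in_expectation X Y (average n f) \<epsilon> (map_pmf fst R) \<and>
          measure_pmf.expectation R (\<lambda>(z, calls). real calls)
            \<le> C * ln (exp 1 + real n + L * D\<^sub>x\<^sup>2 / \<epsilon> + \<kappa>\<^sub>y + \<Delta>) ^ m *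
              ((real n + D\<^sub>x * sqrt (real n * L * \<kappa>\<^sub>y / \<epsilon>) + real n powr (3/4) * sqrt \<kappa>\<^sub>y
                + real n powr (3/4) * D\<^sub>x * sqrt (L / \<epsilon>)) * max 1 (ln (1 / \<epsilon>))))"
proof -
  \<comment> \<open>The modulus in y is capped by L since for a one-point \<open>Y\<close> nothing
    bounds \<open>\<mu>\<close> by L; the analysis needs condition numbers at least 1.\<close>
  define params where "params = (\<lambda>(n::nat) L \<mu> D \<epsilon> \<Delta>.
    let mx = \<epsilon> / (2 * D\<^sup>2); my = min \<mu> L
    in al_choice (my < mx) n (4 * L) (min mx my) (max mx my) \<epsilon> \<Delta>)"
  show ?thesis
  \<comment> \<open>The constant is 11 * 136482, and the exponent counts the two logarithms.\<close>
  proof (rule exI[of _ 1501302], rule exI[of _ 2], rule exI[of _ params], intro allI impI, elim conjE)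
    fix dx dy n :: nat and X Y :: "rvec set" and f :: "nat \<Rightarrow> rvec \<times> rvec \<Rightarrow> real"
      and g :: "nat \<Rightarrow> rvec \<times> rvec \<Rightarrow> rvec \<times> rvec" and L \<mu>\<^sub>y D\<^sub>x \<epsilon> :: real and x\<^sub>0 y\<^sub>0 :: rvec
    assume X: "X \<subseteq> eucl dx" "closed X" "convex X" and Y: "Y \<subseteq> eucl dy" "closed Y" "convex Y"
      and n: "1 \<le> n"
      and comp: "\<forall>i<n. gradient_on (X \<times> Y) (f i) (g i) \<and> g i ` (X \<times> Y) \<subseteq> eucl dx \<times> eucl dy \<and>
        convex_concave 0 0 X Y (f i)"
      and smooth: "average_smooth n L (X \<times> Y) g"
      and \<mu>: "0 < \<mu>\<^sub>y" and cc: "convex_concave 0 \<mu>\<^sub>y X Y (average n f)"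
      and bdd: "bounded X" and D: "D\<^sub>x = diameter X" and x0: "x\<^sub>0 \<in> X" and y0: "y\<^sub>0 \<in> Y"
      and \<epsilon>: "0 < \<epsilon>" "\<epsilon> \<le> 4 * L * D\<^sub>x\<^sup>2"
    define \<kappa> where "\<kappa> = L / \<mu>\<^sub>y"
    define c where "c = \<epsilon> / (4 * D\<^sub>x\<^sup>2)"
    define F where "F = add_prox c x\<^sub>0 (average n f)"
    define \<Delta> where "\<Delta> = duality_gap X Y F (x\<^sub>0, y\<^sub>0)"
    define mx where "mx = \<epsilon> / (2 * D\<^sub>x\<^sup>2)"
    define my where "my = min \<mu>\<^sub>y L"
    define k where "k = L * D\<^sub>x\<^sup>2 / \<epsilon>"
    define G where "G = (\<lambda>i. add_prox_grad c x\<^sub>0 (g i))"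
    define R where "R = al_svre (params n L \<mu>\<^sub>y D\<^sub>x \<epsilon> \<Delta>) n X Y G x\<^sub>0 y\<^sub>0"
    \<comment> \<open>The range of \<epsilon> yields L > 0 and a positive diameter, so the divisions
      below are harmless.\<close>
    have "0 < L * D\<^sub>x\<^sup>2" using \<epsilon> by linarith
    then have L: "0 < L" and D2: "0 < D\<^sub>x\<^sup>2" by (auto simp: zero_less_mult_iff not_less)
    have D0: "0 \<le> D\<^sub>x" using D bdd by (simp add: diameter_ge_0)
    have c: "0 < c" "mx = 0 + 2 * c" using \<epsilon> D2 by (simp_all add: c_def mx_def)
    have mx: "0 < mx" "mx \<le> 2 * L" using \<epsilon> D2 by (auto simp: mx_def field_simps)
    have my: "0 < my" "my \<le> L" "my \<le> \<mu>\<^sub>y" using \<mu> L by (auto simp: my_def)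
    have complete: "complete X" "complete Y"
      using complete_closed_eucl X Y by blast+
    \<comment> \<open>The range of \<epsilon> gives only mx \<le> 2 L, so the constant is first
      relaxed to 2 L and then doubled by the regulariser.\<close>
    have G_smooth: "average_smooth n (4 * L) (X \<times> Y) G"
    proof -
      have "average_smooth n (2 * L) (X \<times> Y) g"
        by (rule average_smooth_mono[OF smooth]) (use L in auto)
      then have "average_smooth n (2 * (2 * L)) (X \<times> Y) G"
        unfolding G_def using c mx n by (intro average_smooth_add_prox_grad) auto
      then show ?thesis by simp
    qed
    have F_cc: "convex_concave mx my X Y F"
      unfolding F_def c(2) using cc my(3) by (rule convex_concave_add_prox)
    have F_grad: "gradient_on (X \<times> Y) F (average n G)"
      unfolding F_def G_def average_add_prox_grad[OF n]
      using comp by (intro gradient_on_add_prox gradient_on_average) auto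
    have P: "params n L \<mu>\<^sub>y D\<^sub>x \<epsilon> \<Delta> = al_choice (my < mx) n (4 * L) (min mx my) (max mx my) \<epsilon> \<Delta>"
      by (simp add: params_def mx_def my_def Let_def)
    have bounds: "mx \<le> 4 * L" "my \<le> 4 * L" using mx my L by linarith+
    note conv = al_svre_convergence[OF complete x0 y0 mx(1) my(1) bounds n \<epsilon>(1) F_grad F_cc G_smooth,
        folded \<Delta>_def, folded P, folded R_def]
    interpret F: saddle_problem X Y F "saddle_operator (average n G)" mx my "4 * L"
      using complete x0 y0 mx my F_grad F_cc norm_average_diff_le[OF G_smooth] L
      by (intro saddle_problem_of_gradient) auto
    \<comment> \<open>On \<open>X\<close> the regulariser lies between 0 and c times the squared
      diameter, which is \<epsilon> / 4. An \<epsilon> / 2 bound for the regularised gap thus leaves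
      room to spare.\<close>
    have gap_f: "duality_gap X Y (average n f) z \<le> duality_gap X Y F z + \<epsilon> / 4" if "z \<in> X \<times> Y" for z
    proof -
      obtain x y where z: "z = (x, y)" "x \<in> X" "y \<in> Y" using \<open>z \<in> X \<times> Y\<close> by auto
      have "average n f (x, y') - average n f (x', y) \<le> duality_gap X Y F (x, y) + \<epsilon> / 4"
        if "x' \<in> X" "y' \<in> Y" for x' y'
      proof -
        have "norm (x' - x\<^sub>0) \<le> D\<^sub>x"
          using diameter_bounded_bound[OF bdd that(1) x0] by (simp add: D dist_norm)
        then have "c * (norm (x' - x\<^sub>0))\<^sup>2 \<le> c * D\<^sub>x\<^sup>2"
          using c by (intro mult_left_mono power_mono) auto
        also have "\<dots> = \<epsilon> / 4" using D2 by (simp add: c_def)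
        finally have "c * (norm (x' - x\<^sub>0))\<^sup>2 \<le> \<epsilon> / 4" .
        moreover have "0 \<le> c * (norm (x - x\<^sub>0))\<^sup>2" using c by simp
        ultimately show ?thesis
          using F.duality_gap_upper[OF z(2,3) that] unfolding F_def add_prox_def fst_conv by linarith
      qed
      then show ?thesis
        unfolding z(1) using x0 y0 by (intro duality_gap_le) auto
    qed
    have saddle_F: "saddle_in_expectation X Y F (\<epsilon> / 2) (map_pmf fst R)"
      using conv(2,3) by (simp add: saddle_in_expectation_def)
    have saddle_f: "saddle_in_expectation X Y (average n f) \<epsilon> (map_pmf fst R)"
    proof -
      have fin: "finite (set_pmf (map_pmf fst R))" using conv(1) by simp
      have "measure_pmf.expectation (map_pmf fst R) (duality_gap X Y (average n f))
          \<le> measure_pmf.expectation (map_pmf fst R) (\<lambda>z. duality_gap X Y F z + \<epsilon> / 4)"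
        using gap_f conv(2) by (intro expectation_mono_finite fin) blast
      also have "\<dots> = measure_pmf.expectation (map_pmf fst R) (duality_gap X Y F) + \<epsilon> / 4"
        by (subst Bochner_Integration.integral_add) (auto intro!: integrable_measure_pmf_finite conv(1) simp del: set_map_pmf)
      also have "\<dots> \<le> \<epsilon>" using conv(3) \<epsilon> by simp
      finally show ?thesis using conv(2) by (simp add: saddle_in_expectation_def)
    qed
    have \<Delta>0: "0 \<le> \<Delta>" using F.duality_gap_upper[OF x0 y0 x0 y0] by (simp add: \<Delta>_def)
    have \<kappa>0: "0 \<le> \<kappa>" using L \<mu> by (simp add: \<kappa>_def)
    have k0: "0 \<le> k" using L \<epsilon> by (simp add: k_def)
    have kx: "4 * L / mx = 8 * k"
      using D2 \<epsilon> by (simp add: mx_def k_def field_simps)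
    have ky: "4 * L / my = 4 * max \<kappa> 1"
      using L \<mu> by (auto simp: my_def \<kappa>_def min_def max_def field_simps)
    \<comment> \<open>The argument of the logarithm in the claim; the summand \<open>exp 1\<close>
      makes the logarithm at least 1.\<close>
    define N where "N = exp 1 + real n + k + \<kappa> + \<Delta>"
    have N: "exp 1 \<le> N" "real n \<le> N" "k \<le> N" "max \<kappa> 1 \<le> N" "\<Delta> \<le> N"
      using \<Delta>0 \<kappa>0 k0 exp_ge_add_one_self[of 1] by (auto simp: N_def)
    have km: "4 * L / min mx my = max (8 * k) (4 * max \<kappa> 1)"
      "(4 * L / min mx my) * (4 * L / max mx my) = (8 * k) * (4 * max \<kappa> 1)"
    proof -
      have "4 * L / min mx my = max (4 * L / mx) (4 * L / my)"
      proof (cases "mx \<le> my")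
        case True
        then have "4 * L / my \<le> 4 * L / mx" using mx L by (intro divide_left_mono) auto
        with True show ?thesis by simp
      next
        case False
        then have "4 * L / mx \<le> 4 * L / my" using my L by (intro divide_left_mono) auto
        with False show ?thesis by simp
      qed
      then show "4 * L / min mx my = max (8 * k) (4 * max \<kappa> 1)" by (simp only: kx ky)
      have "(4 * L / min mx my) * (4 * L / max mx my) = (4 * L / mx) * (4 * L / my)"
        by (simp add: min_def max_def)
      then show "(4 * L / min mx my) * (4 * L / max mx my) = (8 * k) * (4 * max \<kappa> 1)"
        by (simp only: kx ky)
    qed
    interpret C: choice n "4 * L" "min mx my" "max mx my"
      using n mx my bounds by unfold_locales auto
    have N8: "4 * L / min mx my \<le> 8 * N" unfolding km(1) using N k0 by auto
    have powr: "real n powr (3/4) * sqrt t = sqrt (n * sqrt n * t)" if "0 \<le> t" for t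
    proof -
      have "real n powr (3/4) = (real n powr 1 * real n powr (1/2)) powr (1/2)"
        using n by (simp only: powr_powr flip: powr_add) simp
      also have "\<dots> = sqrt (n * sqrt n)"
        using n by (simp add: powr_half_sqrt)
      finally show ?thesis by (simp add: real_sqrt_mult)
    qed
    have D_sqrt: "D\<^sub>x * sqrt t = sqrt (D\<^sub>x\<^sup>2 * t)" for t
      using D0 by (simp add: real_sqrt_mult)
    let ?U = "real n + D\<^sub>x * sqrt (real n * L * \<kappa> / \<epsilon>) + real n powr (3/4) * sqrt \<kappa>
        + real n powr (3/4) * D\<^sub>x * sqrt (L / \<epsilon>)"
    have U: "?U = real n + sqrt (n * k * \<kappa>) + sqrt (n * sqrt n * \<kappa>) + sqrt (n * sqrt n * k)"
    proof -
      have "D\<^sub>x * sqrt (real n * L * \<kappa> / \<epsilon>) = sqrt (n * k * \<kappa>)"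
        unfolding D_sqrt by (simp add: k_def mult_ac)
      moreover have "real n powr (3/4) * D\<^sub>x * sqrt (L / \<epsilon>) = sqrt (n * sqrt n * k)"
        using powr[OF k0] unfolding mult.assoc D_sqrt by (simp add: k_def mult_ac)
      ultimately show ?thesis using powr[OF \<kappa>0] by simp
    qed
    let ?M = "max 1 (ln (1 / \<epsilon>))"
    have "measure_pmf.expectation R (\<lambda>(z, c). real c)
        \<le> 136482 * (ln N)\<^sup>2 * ?M * (real n + sqrt (2 * real n * (4 * L / min mx my) * (4 * L / max mx my))
          + sqrt (n * sqrt n * (4 * L / min mx my)))"
      using C.choice_cost[OF \<epsilon>(1) \<Delta>0 N(5,1,2) N8] conv(4) by linarith
    also have "\<dots> \<le> 136482 * (ln N)\<^sup>2 * ?M * (11 * ?U)"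
      unfolding U mult.assoc[of "2 * real n"] km(2) unfolding km(1)
      using complexity_bound[OF n k0 \<kappa>0] by (intro mult_left_mono) auto
    finally have cost: "measure_pmf.expectation R (\<lambda>(z, c). real c) \<le> 1501302 * ln N ^ 2 * (?U * ?M)"
      by (simp add: mult_ac)
    have "admissible (params n L \<mu>\<^sub>y D\<^sub>x \<epsilon> \<Delta>)"
      unfolding P using mx my bounds n by (intro admissible_al_choice) auto
    then show "let \<kappa>\<^sub>y = L / \<mu>\<^sub>y; c = \<epsilon> / (4 * D\<^sub>x\<^sup>2); f\<^sub>\<epsilon> = add_prox c x\<^sub>0 (average n f);
        \<Delta> = duality_gap X Y f\<^sub>\<epsilon> (x\<^sub>0, y\<^sub>0); P = params n L \<mu>\<^sub>y D\<^sub>x \<epsilon> \<Delta>;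
        R = al_svre P n X Y (\<lambda>i. add_prox_grad c x\<^sub>0 (g i)) x\<^sub>0 y\<^sub>0
      in admissible P \<and> saddle_in_expectation X Y f\<^sub>\<epsilon> (\<epsilon> / 2) (map_pmf fst R) \<and>
        saddle_in_expectation X Y (average n f) \<epsilon> (map_pmf fst R) \<and>
        measure_pmf.expectation R (\<lambda>(z, calls). real calls)
          \<le> 1501302 * ln (exp 1 + real n + L * D\<^sub>x\<^sup>2 / \<epsilon> + \<kappa>\<^sub>y + \<Delta>) ^ 2 *
            ((real n + D\<^sub>x * sqrt (real n * L * \<kappa>\<^sub>y / \<epsilon>) + real n powr (3/4) * sqrt \<kappa>\<^sub>y
              + real n powr (3/4) * D\<^sub>x * sqrt (L / \<epsilon>)) * max 1 (ln (1 / \<epsilon>)))"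
      using saddle_F saddle_f cost
      unfolding Let_def R_def G_def N_def k_def \<Delta>_def F_def c_def \<kappa>_def by blast
  qed
qed

end
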